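(* Let $G$ be a finitely generated group hyperbolic relative to a finite collection $\mathcal P=\{P_\lambda\}_{\lambda\in\Lambda}$, and $S$ a finite generating set. Then for all sufficiently large $n$, for every subgroup $H\le G$ the fixed-point set $(\Gamma_n^\blacktriangle)^H$ of $H$ in the $n$-Rips complex is either empty or contractible.
   Context: Let $\Gamma$ be the Cayley graph of $G$ with respect to $S$, $V=G$, $W$ the set of cosets $gP_\lambda$. Relative hyperbolicity means the coned-off Cayley graph (vertex set $V\cup W$, edges of $\Gamma$ plus an edge $(v,w)$ whenever $v\in w$) is fine and $\delta$-hyperbolic. Extend $|\cdot,\cdot|_S$ to $V\cup W$ via distances in $\Gamma$ between the corresponding elements/cosets. $\Gamma_n$ has vertex set $V\cup W$ and an edge between $u\ne u'$ whenever $|u,u'|_S\le n$; $\Gamma_n^\blacktriangle$ is obtained by spanning simplices on all cliques of $\Gamma_n$, with $G$ acting by left multiplication. *)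

theory Defs
  imports "HOL-Analysis.Analysis" "HOL-Algebra.Coset" "HOL-Algebra.Generated_Groups"
begin

definition walk :: "('v \<Rightarrow> 'v \<Rightarrow> bool) \<Rightarrow> 'v list \<Rightarrow> bool" where
  "walk E xs \<longleftrightarrow> xs \<noteq> [] \<and> (\<forall>i. Suc i < length xs \<longrightarrow> E (xs ! i) (xs ! Suc i))"

definition graph_connected :: "'v set \<Rightarrow> ('v \<Rightarrow> 'v \<Rightarrow> bool) \<Rightarrow> bool" where
  "graph_connected Vs E \<longleftrightarrow>
     (\<forall>u\<in>Vs. \<forall>v\<in>Vs. \<exists>xs. walk E xs \<and> set xs \<subseteq> Vs \<and> hd xs = u \<and> last xs = v)"

definition gdist :: "'v set \<Rightarrow> ('v \<Rightarrow> 'v \<Rightarrow> bool) \<Rightarrow> 'v \<Rightarrow> 'v \<Rightarrow> nat" where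
  "gdist Vs E u v = (LEAST n. \<exists>xs. walk E xs \<and> set xs \<subseteq> Vs \<and> hd xs = u \<and> last xs = v
                                  \<and> length xs = Suc n)"

definition circuit :: "('v \<Rightarrow> 'v \<Rightarrow> bool) \<Rightarrow> 'v list \<Rightarrow> bool" where
  "circuit E c \<longleftrightarrow> 3 \<le> length c \<and> distinct c \<and>
     (\<forall>i<length c. E (c ! i) (c ! ((i + 1) mod length c)))"

definition edge_in_circuit :: "'v \<Rightarrow> 'v \<Rightarrow> 'v list \<Rightarrow> bool" where
  "edge_in_circuit u v c \<longleftrightarrow> (\<exists>i<length c. {c ! i, c ! ((i + 1) mod length c)} = {u, v})"

definition fine_graph :: "'v set \<Rightarrow> ('v \<Rightarrow> 'v \<Rightarrow> bool) \<Rightarrow> bool" where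
  "fine_graph Vs E \<longleftrightarrow>
     (\<forall>u\<in>Vs. \<forall>v\<in>Vs. E u v \<longrightarrow>
        (\<forall>n. finite {c. circuit E c \<and> set c \<subseteq> Vs \<and> length c = n \<and> edge_in_circuit u v c}))"

definition gromov_prod :: "('v \<Rightarrow> 'v \<Rightarrow> nat) \<Rightarrow> 'v \<Rightarrow> 'v \<Rightarrow> 'v \<Rightarrow> real" where
  "gromov_prod d w x y = (real (d w x) + real (d w y) - real (d x y)) / 2"

definition hyperbolic_graph :: "'v set \<Rightarrow> ('v \<Rightarrow> 'v \<Rightarrow> bool) \<Rightarrow> real \<Rightarrow> bool" where
  "hyperbolic_graph Vs E \<delta> \<longleftrightarrow> graph_connected Vs E \<and>
     (\<forall>w\<in>Vs. \<forall>x\<in>Vs. \<forall>y\<in>Vs. \<forall>z\<in>Vs.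
        gromov_prod (gdist Vs E) w x z \<ge>
          min (gromov_prod (gdist Vs E) w x y) (gromov_prod (gdist Vs E) w y z) - \<delta>)"

definition cay_edge :: "('a, 'b) monoid_scheme \<Rightarrow> 'a set \<Rightarrow> 'a \<Rightarrow> 'a \<Rightarrow> bool" where
  "cay_edge G S g h \<longleftrightarrow> g \<in> carrier G \<and> h \<in> carrier G \<and>
     (\<exists>s\<in>S. h = g \<otimes>\<^bsub>G\<^esub> s \<or> g = h \<otimes>\<^bsub>G\<^esub> s)"

definition word_dist :: "('a, 'b) monoid_scheme \<Rightarrow> 'a set \<Rightarrow> 'a \<Rightarrow> 'a \<Rightarrow> nat" where
  "word_dist G S = gdist (carrier G) (cay_edge G S)"

definition coset_verts :: "('a, 'b) monoid_scheme \<Rightarrow> 'a set set \<Rightarrow> 'a set set" where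
  "coset_verts G Ps = {g <#\<^bsub>G\<^esub> P | g P. g \<in> carrier G \<and> P \<in> Ps}"

definition cverts :: "('a, 'b) monoid_scheme \<Rightarrow> 'a set set \<Rightarrow> ('a + 'a set) set" where
  "cverts G Ps = Inl ` carrier G \<union> Inr ` coset_verts G Ps"

definition coned_edge :: "('a, 'b) monoid_scheme \<Rightarrow> 'a set \<Rightarrow> 'a set set \<Rightarrow> ('a + 'a set) \<Rightarrow> ('a + 'a set) \<Rightarrow> bool" where
  "coned_edge G S Ps u v \<longleftrightarrow>
     (\<exists>g h. u = Inl g \<and> v = Inl h \<and> cay_edge G S g h) \<or>
     (\<exists>g C. g \<in> carrier G \<and> C \<in> coset_verts G Ps \<and> g \<in> C \<and>
            ((u = Inl g \<and> v = Inr C) \<or> (u = Inr C \<and> v = Inl g)))"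

primrec elems :: "('a + 'a set) \<Rightarrow> 'a set" where
  "elems (Inl g) = {g}"
| "elems (Inr C) = C"

definition dS :: "('a, 'b) monoid_scheme \<Rightarrow> 'a set \<Rightarrow> ('a + 'a set) \<Rightarrow> ('a + 'a set) \<Rightarrow> nat" where
  "dS G S u u' = (LEAST k. \<exists>a\<in>elems u. \<exists>b\<in>elems u'. word_dist G S a b = k)"

definition rips_simplices :: "('a, 'b) monoid_scheme \<Rightarrow> 'a set \<Rightarrow> 'a set set \<Rightarrow> nat \<Rightarrow> ('a + 'a set) set set" where
  "rips_simplices G S Ps n = {\<sigma>. finite \<sigma> \<and> \<sigma> \<noteq> {} \<and> \<sigma> \<subseteq> cverts G Ps \<and>
       (\<forall>u\<in>\<sigma>. \<forall>v\<in>\<sigma>. u \<noteq> v \<longrightarrow> dS G S u v \<le> n)}"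

definition csimplex :: "'v set \<Rightarrow> ('v \<Rightarrow> real) set" where
  "csimplex \<sigma> = {x. (\<forall>u. 0 \<le> x u) \<and> (\<forall>u. u \<notin> \<sigma> \<longrightarrow> x u = 0) \<and> sum x \<sigma> = 1}"

definition real_points :: "'v set set \<Rightarrow> ('v \<Rightarrow> real) set" where
  "real_points K = (\<Union>\<sigma>\<in>K. csimplex \<sigma>)"

definition realization :: "'v set set \<Rightarrow> ('v \<Rightarrow> real) topology" where
  "realization K = topology (\<lambda>U. U \<subseteq> real_points K \<and>
      (\<forall>\<sigma>\<in>K. openin (subtopology (powertop_real UNIV) (csimplex \<sigma>)) (U \<inter> csimplex \<sigma>)))"

definition vmap :: "('a, 'b) monoid_scheme \<Rightarrow> 'a \<Rightarrow> ('a + 'a set) \<Rightarrow> ('a + 'a set)" where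
  "vmap G g u = (case u of Inl h \<Rightarrow> Inl (g \<otimes>\<^bsub>G\<^esub> h) | Inr C \<Rightarrow> Inr (g <#\<^bsub>G\<^esub> C))"

definition pact :: "('a, 'b) monoid_scheme \<Rightarrow> 'a set set \<Rightarrow> 'a \<Rightarrow> (('a + 'a set) \<Rightarrow> real) \<Rightarrow> (('a + 'a set) \<Rightarrow> real)" where
  "pact G Ps g x = (\<lambda>u. if u \<in> cverts G Ps then x (vmap G (inv\<^bsub>G\<^esub> g) u) else 0)"

definition rips_fixed :: "('a, 'b) monoid_scheme \<Rightarrow> 'a set \<Rightarrow> 'a set set \<Rightarrow> nat \<Rightarrow> 'a set \<Rightarrow> (('a + 'a set) \<Rightarrow> real) set" where
  "rips_fixed G S Ps n H = {x \<in> real_points (rips_simplices G S Ps n). \<forall>h\<in>H. pact G Ps h x = x}"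

end

theory Submission
  imports Defs "HOL-Real_Asymp.Real_Asymp"
begin

text \<open>
  Fineness and hyperbolicity of the coned-off graph give thin triangles whose sides are close even
  in the word metric, at all group elements on them.  Give the edges of the coned-off graph at cone
  points the length \<open>n\<close> and all others the length \<open>1\<close>, and let \<open>d\<close> be the resulting metric.  Then
  \<open>dS u v \<le> n\<close> means \<open>d u v \<le> n + ht u + ht v\<close>, where \<open>ht\<close> is \<open>0\<close> on group elements and \<open>n\<close> on
  cone points.  By a Morse argument \<open>d\<close>-geodesics follow the group elements of coned-off geodesics up
  to an error \<open>M\<close> of smaller order than \<open>n\<close>.  Hence a vertex \<open>u\<close> with \<open>d u c > n + ht u + ht c\<close> can
  be pushed along a coned-off geodesic towards \<open>c\<close> such that it stays adjacent to all its neighbours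
  that are not further away from \<open>c\<close> than \<open>u\<close> itself.

  If \<open>H\<close> fixes a point of the Rips complex, let \<open>C\<close> be its support.  The farthest vertices
  from \<open>C\<close> are pushed first, equivariantly on \<open>H\<close>-orbits, until only the star of \<open>C\<close> is left, which
  is then coned off to the barycentre of \<open>C\<close>.  On a given simplex only finitely many of these stages
  act, so together they form a contraction of the fixed-point set in the weak topology.
\<close>

section \<open>Graph metrics\<close>

text \<open>The function \<open>dS\<close> violates the triangle inequality, as two distant vertices
  may both be close to a third coset. The length \<open>n\<close> of the edges at cone points turns
  adjacency into a condition on a genuine metric: a path that crosses a cone point other than its
  ends pays \<open>2 * n\<close> there, too much for adjacent vertices. The price is that the
  metric, and with it the Morse error \<open>M\<close>, depends on \<open>n\<close>. Pushing needs
  \<open>n\<close> to exceed a quadratic polynomial in \<open>M\<close>, while in the Morse argument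
  an exponential has to beat a bound linear in \<open>n\<close>; an \<open>M\<close> of the order of
  the cube root of \<open>n\<close> meets both demands. Fineness enters only as a bound on the word
  distance of group elements on a circuit of given length. Hyperbolicity alone would give thin
  triangles in the coned-off metric, which says nothing about word distances inside a coset. An
  infinite \<open>H\<close> is the other obstacle, since pushing spreads mass over an orbit, which
  has to be finite. Such an \<open>H\<close> has a finite orbit on at most one vertex, so its fixed
  points leave nothing to push.\<close>

inductive wreach :: "('v \<Rightarrow> 'v \<Rightarrow> bool) \<Rightarrow> ('v \<Rightarrow> 'v \<Rightarrow> nat) \<Rightarrow> 'v \<Rightarrow> 'v \<Rightarrow> nat \<Rightarrow> bool"
  for E \<omega> where
  wreach_refl: "wreach E \<omega> u u 0"
| wreach_step: "E u v \<Longrightarrow> wreach E \<omega> v w k \<Longrightarrow> wreach E \<omega> u w (\<omega> u v + k)"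

text \<open>Three metrics are instances: the coned-off metric and the word metric, both with unit
  weights, and the weighted metric. If no walk joins \<open>u\<close> to \<open>v\<close>, the value
  is unspecified, hence the assumption \<open>conn\<close> below.\<close>

definition wdist :: "('v \<Rightarrow> 'v \<Rightarrow> bool) \<Rightarrow> ('v \<Rightarrow> 'v \<Rightarrow> nat) \<Rightarrow> 'v \<Rightarrow> 'v \<Rightarrow> nat" where
  "wdist E \<omega> u v = (LEAST k. wreach E \<omega> u v k)"

lemma wreach_trans:
  "wreach E \<omega> u v j \<Longrightarrow> wreach E \<omega> v w k \<Longrightarrow> wreach E \<omega> u w (j + k)"
  by (induction rule: wreach.induct) (auto simp: add.assoc intro: wreach.intros)

lemma wreach_edge: "E u v \<Longrightarrow> wreach E \<omega> u v (\<omega> u v)"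
  using wreach_step[of E u v \<omega> v 0] wreach_refl[of E \<omega> v] by simp

locale wgraph =
  fixes X :: "'v set" and E :: "'v \<Rightarrow> 'v \<Rightarrow> bool" and \<omega> :: "'v \<Rightarrow> 'v \<Rightarrow> nat"
  assumes E_sym: "E u v \<Longrightarrow> E v u"
    and E_in: "E u v \<Longrightarrow> u \<in> X"
    and \<omega>_sym: "\<omega> u v = \<omega> v u"
    and \<omega>_pos: "E u v \<Longrightarrow> 0 < \<omega> u v"
    and conn: "u \<in> X \<Longrightarrow> v \<in> X \<Longrightarrow> \<exists>k. wreach E \<omega> u v k"
begin

abbreviation d where "d \<equiv> wdist E \<omega>"

lemma E_in2: "E u v \<Longrightarrow> v \<in> X"
  using E_sym E_in by blast

lemma wreach_sym: "wreach E \<omega> u v k \<Longrightarrow> wreach E \<omega> v u k"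
proof (induction rule: wreach.induct)
  case (wreach_step u v w k)
  show ?case
    using wreach_trans[OF wreach_step.IH wreach_edge[of E v u \<omega>, OF E_sym[OF wreach_step.hyps(1)]]]
    by (simp add: \<omega>_sym[of v u] add.commute)
qed (rule wreach_refl)

lemma wreach_d: "u \<in> X \<Longrightarrow> v \<in> X \<Longrightarrow> wreach E \<omega> u v (d u v)"
  unfolding wdist_def using conn by (meson LeastI_ex)

lemma d_le: "wreach E \<omega> u v k \<Longrightarrow> d u v \<le> k"
  unfolding wdist_def by (rule Least_le)

lemma d_refl [simp]: "d u u = 0"
  using d_le[OF wreach_refl] by simp

lemma d_sym: "u \<in> X \<Longrightarrow> v \<in> X \<Longrightarrow> d u v = d v u"
  by (meson antisym d_le wreach_d wreach_sym)

lemma d_tri: "u \<in> X \<Longrightarrow> v \<in> X \<Longrightarrow> w \<in> X \<Longrightarrow> d u w \<le> d u v + d v w"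
  by (meson d_le wreach_d wreach_trans)

lemma d_edge: "E u v \<Longrightarrow> d u v \<le> \<omega> u v"
  by (simp add: d_le wreach_edge)

lemma d_step:
  assumes "u \<in> X" "v \<in> X" "u \<noteq> v"
  obtains u' where "E u u'" "u' \<in> X" "d u v = \<omega> u u' + d u' v"
proof -
  have "wreach E \<omega> u v (d u v)" using wreach_d assms by blast
  then show ?thesis
  proof (cases rule: wreach.cases)
    case wreach_refl then show ?thesis using assms by simp
  next
    case (wreach_step u' k)
    have "d u' v \<le> k" using d_le wreach_step by blast
    moreover have "d u v \<le> \<omega> u u' + d u' v"
      using d_tri[of u u' v] d_edge[of u u'] E_in2[of u u'] wreach_step assms by fastforce
    ultimately show ?thesis using that[of u'] wreach_step E_in2 by auto
  qed
qed

lemma d_eq_0: "u \<in> X \<Longrightarrow> v \<in> X \<Longrightarrow> d u v = 0 \<longleftrightarrow> u = v"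
  using d_step[of u v] \<omega>_pos[of u] by (metis add_is_0 d_refl less_numeral_extra(3))

text \<open>Prepend the first edge of a geodesic to a list for the next vertex. Weights are positive
  integers, so the distance to \<open>v\<close> drops by at least one per vertex. The last clause
  records this in order that the weighted length of a piece of the list bounds its number of
  vertices.\<close>

lemma geodesic_list:
  assumes "u \<in> X" "v \<in> X"
  shows "\<exists>xs. xs \<noteq> [] \<and> successively E xs \<and> hd xs = u \<and> last xs = v \<and> set xs \<subseteq> X \<and>
     (\<forall>i<length xs. d u (xs ! i) + d (xs ! i) v = d u v) \<and>
     (\<forall>j<length xs. \<forall>i\<le>j. d (xs ! j) v + (j - i) \<le> d (xs ! i) v)"
  using assms
proof (induction "d u v" arbitrary: u rule: less_induct)
  case less
  show ?case
  proof (cases "u = v")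
    case True
    then show ?thesis using less by (intro exI[of _ "[u]"]) auto
  next
    case False
    then obtain u' where u': "E u u'" "u' \<in> X" "d u v = \<omega> u u' + d u' v"
      using d_step less by metis
    then have "d u' v < d u v" using \<omega>_pos by simp
    from less.hyps[OF this u'(2) less.prems(2)] obtain xs where xs: "xs \<noteq> []" "successively E xs"
      "hd xs = u'" "last xs = v" "set xs \<subseteq> X"
      "\<forall>i<length xs. d u' (xs ! i) + d (xs ! i) v = d u' v"
      "\<forall>j<length xs. \<forall>i\<le>j. d (xs ! j) v + (j - i) \<le> d (xs ! i) v" by blast
    have du: "d u u' = \<omega> u u'"
      using d_edge[OF u'(1)] d_tri[of u u' v] u' less.prems by linarith
    have A: "d u ((u # xs) ! i) + d ((u # xs) ! i) v = d u v" if "i < length (u # xs)" for i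
    proof (cases i)
      case (Suc j)
      then have j: "j < length xs" using that by simp
      then have in_X: "xs ! j \<in> X" using xs(5) nth_mem by blast
      have "d u (xs ! j) \<le> \<omega> u u' + d u' (xs ! j)"
        using d_tri[of u u' "xs ! j"] du in_X u' less.prems by simp
      then have "d u (xs ! j) + d (xs ! j) v \<le> d u v" using xs(6) j u'(3) by fastforce
      moreover have "d u v \<le> d u (xs ! j) + d (xs ! j) v" using d_tri in_X less.prems by blast
      ultimately show ?thesis using Suc by simp
    qed simp
    have B: "d ((u # xs) ! j) v + (j - i) \<le> d ((u # xs) ! i) v"
      if ji: "j < length (u # xs)" "i \<le> j" for i j
    proof (cases i)
      case i: 0
      show ?thesis
      proof (cases j)
        case (Suc k)
        have "d (xs ! k) v + (k - 0) \<le> d (xs ! 0) v" using xs(7)[rule_format, of k 0] Suc ji by simp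
        moreover have "xs ! 0 = u'" using xs by (simp add: hd_conv_nth)
        ultimately show ?thesis using Suc i u' \<omega>_pos[OF u'(1)] by simp
      qed (use i in simp)
    next
      case (Suc k)
      then obtain l where "j = Suc l" using ji by (cases j) auto
      then show ?thesis using xs(7) ji Suc by auto
    qed
    show ?thesis
      using xs u' A B less.prems by (intro exI[of _ "u # xs"]) (simp add: successively_Cons)
  qed
qed

lemma geodesic_list_sep:
  assumes "u \<in> X" "v \<in> X"
  obtains xs where "xs \<noteq> []" "successively E xs" "hd xs = u" "last xs = v" "set xs \<subseteq> X"
     "\<And>q. q \<in> set xs \<Longrightarrow> d u q + d q v = d u v"
     "\<And>i j. i \<le> j \<Longrightarrow> j < length xs \<Longrightarrow> j - i \<le> d (xs ! i) (xs ! j)"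
proof -
  obtain xs where xs: "xs \<noteq> []" "successively E xs" "hd xs = u" "last xs = v" "set xs \<subseteq> X"
     "\<forall>i<length xs. d u (xs ! i) + d (xs ! i) v = d u v"
     "\<forall>j<length xs. \<forall>i\<le>j. d (xs ! j) v + (j - i) \<le> d (xs ! i) v"
    using geodesic_list[OF assms] by (elim exE conjE)
  have "j - i \<le> d (xs ! i) (xs ! j)" if "i \<le> j" "j < length xs" for i j
  proof -
    have "xs ! i \<in> X" "xs ! j \<in> X"
      using xs(5) that nth_mem[of i xs] nth_mem[of j xs] le_less_trans[OF that] by blast+
    then have "d (xs ! i) v \<le> d (xs ! i) (xs ! j) + d (xs ! j) v"
      using d_tri assms by blast
    with xs(7)[rule_format, of j i] that show ?thesis by linarith
  qed
  moreover have "d u q + d q v = d u v" if "q \<in> set xs" for q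
    using xs(6) that by (auto simp: in_set_conv_nth)
  ultimately show ?thesis by (intro that[OF xs(1-5)])
qed

end

section \<open>Graphs with edges of length one: metric intervals and parametrised geodesics\<close>

definition unit_weight :: "'v \<Rightarrow> 'v \<Rightarrow> nat" where
  "unit_weight u v = 1"

locale ugraph = wgraph X E unit_weight for X :: "'v set" and E
begin

abbreviation h where "h \<equiv> wdist E unit_weight"

lemma h_edge: "E u v \<Longrightarrow> h u v \<le> 1"
  using d_edge[of u v] by (simp only: unit_weight_def)

lemma h_step:
  assumes "u \<in> X" "v \<in> X" "u \<noteq> v"
  obtains u' where "E u u'" "u' \<in> X" "h u v = 1 + h u' v"
  using assms
proof (rule d_step)
  fix u' assume "E u u'" "u' \<in> X" "h u v = unit_weight u u' + h u' v"
  then show thesis using that by (simp add: unit_weight_def)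
qed

text \<open>The metric interval, that is, the union of all geodesics from \<open>u\<close> to
  \<open>v\<close>. Statements about it hold for all geodesics at once and involve no
  choice.\<close>

definition btw :: "'v \<Rightarrow> 'v \<Rightarrow> 'v \<Rightarrow> bool" where
  "btw u p v \<longleftrightarrow> p \<in> X \<and> h u p + h p v = h u v"

lemma btw_sym: "u \<in> X \<Longrightarrow> v \<in> X \<Longrightarrow> btw u p v \<Longrightarrow> btw v p u"
  unfolding btw_def using d_sym by (metis add.commute)

lemma btw_in: "btw u p v \<Longrightarrow> p \<in> X" by (simp add: btw_def)

lemma btw_trans:
  assumes "u \<in> X" "v \<in> X" "btw u p v" "btw p q v"
  shows "btw u q v" "btw u p q"
proof -
  have "h u v \<le> h u q + h q v" "h u q \<le> h u p + h p q"
    using assms d_tri unfolding btw_def by auto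
  then show "btw u q v" "btw u p q" using assms unfolding btw_def by linarith+
qed

lemma btw_trans':
  assumes "u \<in> X" "v \<in> X" "btw u p v" "btw u q p"
  shows "btw u q v" "btw q p v"
proof -
  have "btw v q u" "btw v p q"
    using btw_trans[of v u p q] assms btw_sym btw_in by metis+
  then show "btw u q v" "btw q p v" using assms btw_sym btw_in by metis+
qed

lemma geo_edge: "E a b \<Longrightarrow> a \<noteq> b \<Longrightarrow> h a b = 1"
  using h_edge[of a b] d_eq_0[of a b] E_in[of a b] E_in2[of a b] by fastforce

definition geod :: "'v \<Rightarrow> 'v \<Rightarrow> (nat \<Rightarrow> 'v) \<Rightarrow> bool" where
  "geod u v \<gamma> \<longleftrightarrow> \<gamma> 0 = u \<and> \<gamma> (h u v) = v \<and>
     (\<forall>i\<le>h u v. \<gamma> i \<in> X \<and> h u (\<gamma> i) = i \<and> h (\<gamma> i) v = h u v - i) \<and>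
     (\<forall>i<h u v. E (\<gamma> i) (\<gamma> (Suc i)))"

lemma geod_ex:
  assumes "u \<in> X" "v \<in> X"
  shows "\<exists>\<gamma>. geod u v \<gamma>"
  using assms
proof (induction "h u v" arbitrary: u)
  case 0
  then have "u = v" using d_eq_0 by metis
  then show ?case using 0 by (intro exI[of _ "\<lambda>_. u"]) (auto simp: geod_def)
next
  case (Suc k)
  then have "u \<noteq> v" by auto
  then obtain u' where u': "E u u'" "u' \<in> X" "h u v = 1 + h u' v"
    using h_step[of u v] Suc.prems by auto
  then obtain \<gamma> where \<gamma>: "geod u' v \<gamma>" using Suc.hyps Suc.prems(2) by (metis Suc_inject plus_1_eq_Suc)
  have uu': "h u u' = 1" using geo_edge u' by fastforce
  let ?\<gamma> = "\<lambda>i. case i of 0 \<Rightarrow> u | Suc j \<Rightarrow> \<gamma> j"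
  have "h u (\<gamma> j) = Suc j" if "j \<le> h u' v" for j
  proof -
    have j: "\<gamma> j \<in> X" "h u' (\<gamma> j) = j" "h (\<gamma> j) v = h u' v - j" using \<gamma> that by (auto simp: geod_def)
    have "h u (\<gamma> j) \<le> 1 + j" using d_tri[of u u' "\<gamma> j"] j u' uu' Suc.prems by simp
    moreover have "h u v \<le> h u (\<gamma> j) + h (\<gamma> j) v" using d_tri j Suc.prems by blast
    ultimately show ?thesis using j u' that by linarith
  qed
  then have "geod u v ?\<gamma>"
    using \<gamma> u' Suc.prems unfolding geod_def by (auto split: nat.splits)
  then show ?case by blast
qed

lemma geod_btw: "geod u v \<gamma> \<Longrightarrow> i \<le> h u v \<Longrightarrow> btw u (\<gamma> i) v"
  unfolding geod_def btw_def by auto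

lemma geod_through:
  assumes "u \<in> X" "v \<in> X" "btw u p v"
  shows "\<exists>\<gamma>. geod u v \<gamma> \<and> \<gamma> (h u p) = p"
proof -
  have p: "p \<in> X" "h u p + h p v = h u v" using assms by (auto simp: btw_def)
  then obtain \<alpha> \<beta> where \<alpha>: "geod u p \<alpha>" and \<beta>: "geod p v \<beta>"
    using geod_ex assms(1,2) by blast
  define \<gamma> where "\<gamma> i = (if i < h u p then \<alpha> i else \<beta> (i - h u p))" for i
  have 1: "\<gamma> i \<in> X" "h u (\<gamma> i) = i" "h (\<gamma> i) v = h u v - i" if "i \<le> h u v" for i
  proof -
    have "\<gamma> i \<in> X \<and> h u (\<gamma> i) = i \<and> h (\<gamma> i) v = h u v - i"
    proof (cases "i < h u p")
      case True
      then have a: "\<alpha> i \<in> X" "h u (\<alpha> i) = i" "h (\<alpha> i) p = h u p - i" using \<alpha> by (auto simp: geod_def)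
      have "h (\<alpha> i) v \<le> h (\<alpha> i) p + h p v" "h u v \<le> h u (\<alpha> i) + h (\<alpha> i) v"
        using d_tri[of "\<alpha> i" p v] d_tri[of u "\<alpha> i" v] a(1) p(1) assms(1,2) by blast+
      then show ?thesis using a p True by (auto simp: \<gamma>_def)
    next
      case False
      then have le: "i - h u p \<le> h p v" using that p by linarith
      then have a: "\<beta> (i - h u p) \<in> X" "h p (\<beta> (i - h u p)) = i - h u p"
        "h (\<beta> (i - h u p)) v = h p v - (i - h u p)" using \<beta> by (auto simp: geod_def)
      have "h u (\<beta> (i - h u p)) \<le> h u p + h p (\<beta> (i - h u p))"
        "h u v \<le> h u (\<beta> (i - h u p)) + h (\<beta> (i - h u p)) v"
        using d_tri a(1) p(1) assms(1,2) by blast+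
      then have "h u (\<beta> (i - h u p)) = i" "h (\<beta> (i - h u p)) v = h u v - i"
        using a p False le that by linarith+
      then show ?thesis using a False by (simp add: \<gamma>_def)
    qed
    then show "\<gamma> i \<in> X" "h u (\<gamma> i) = i" "h (\<gamma> i) v = h u v - i" by auto
  qed
  have 2: "E (\<gamma> i) (\<gamma> (Suc i))" if "i < h u v" for i
  proof -
    consider "Suc i < h u p" | "Suc i = h u p" | "h u p \<le> i" by linarith
    then show ?thesis
    proof cases
      case 1
      then have "i < h u p" by linarith
      then show ?thesis using \<alpha> 1 unfolding geod_def \<gamma>_def by simp
    next
      case 2
      then have "i < h u p" by linarith
      then have "E (\<alpha> i) (\<alpha> (Suc i))" "\<alpha> (h u p) = p" "\<beta> 0 = p"
        using \<alpha> \<beta> unfolding geod_def by blast+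
      then show ?thesis using 2[symmetric] by (simp add: \<gamma>_def)
    next
      case 3
      then have "i - h u p < h p v" using p that by linarith
      then have "E (\<beta> (i - h u p)) (\<beta> (Suc (i - h u p)))"
        using \<beta> unfolding geod_def by blast
      then show ?thesis using 3 by (simp add: \<gamma>_def Suc_diff_le)
    qed
  qed
  have "\<gamma> 0 = u" using 1[of 0] d_eq_0[of u "\<gamma> 0"] assms by simp
  moreover have "\<gamma> (h u v) = v" using 1[of "h u v"] d_eq_0[of "\<gamma> (h u v)" v] assms by simp
  moreover have "\<gamma> (h u p) = p" using \<beta> by (simp add: \<gamma>_def geod_def)
  ultimately have "geod u v \<gamma>" "\<gamma> (h u p) = p" using 1 2 unfolding geod_def by blast+
  then show ?thesis by blast
qed

lemma geod_dist:
  assumes "u \<in> X" "v \<in> X" "geod u v \<gamma>" "i \<le> j" "j \<le> h u v"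
  shows "h (\<gamma> i) (\<gamma> j) = j - i"
  using assms(4,5)
proof (induction j)
  case 0
  then show ?case by simp
next
  case (Suc j)
  have X: "\<gamma> i \<in> X" "\<gamma> (Suc j) \<in> X" "h u (\<gamma> i) = i" "h u (\<gamma> (Suc j)) = Suc j"
    using assms(3) Suc.prems by (auto simp: geod_def)
  have lower: "Suc j \<le> i + h (\<gamma> i) (\<gamma> (Suc j))"
    using d_tri[of u "\<gamma> i" "\<gamma> (Suc j)"] X assms by simp
  show ?case
  proof (cases "i = Suc j")
    case False
    then have IH: "h (\<gamma> i) (\<gamma> j) = j - i" using Suc by auto
    have "\<gamma> j \<in> X" "E (\<gamma> j) (\<gamma> (Suc j))" using assms(3) Suc.prems by (auto simp: geod_def)
    then have "h (\<gamma> i) (\<gamma> (Suc j)) \<le> (j - i) + 1"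
      using d_tri[of "\<gamma> i" "\<gamma> j" "\<gamma> (Suc j)"] h_edge[of "\<gamma> j" "\<gamma> (Suc j)"] IH X by simp
    then show ?thesis using lower False Suc.prems by linarith
  qed simp
qed

end

section \<open>Circuits and walks\<close>

lemma circuitI:
  assumes "successively E c" "E (last c) (hd c)" "distinct c" "3 \<le> length c"
  shows "circuit E c"
  unfolding circuit_def
proof (intro conjI allI impI assms)
  fix i assume i: "i < length c"
  show "E (c ! i) (c ! ((i + 1) mod length c))"
  proof (cases "Suc i < length c")
    case True
    then show ?thesis using assms(1)[unfolded successively_conv_nth] by simp
  next
    case False
    then have "Suc i = length c" using i by simp
    moreover from this have "c ! i = last c" using i by (metis diff_Suc_1 last_conv_nth length_0_conv not_less0)
    moreover have "c ! 0 = hd c" using i hd_conv_nth[of c] by fastforce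
    ultimately show ?thesis using assms(2) by simp
  qed
qed

lemma relpow_seg:
  assumes "\<And>m. i \<le> m \<Longrightarrow> m < j \<Longrightarrow> (f m, f (Suc m)) \<in> R" "i \<le> j"
  shows "(f i, f j) \<in> R ^^ (j - i)"
  unfolding relpow_fun_conv
  using assms by (intro exI[of _ "\<lambda>m. f (i + m)"]) auto

lemma relpow_sub: "(R :: ('a \<times> 'a) set) \<subseteq> S \<Longrightarrow> (a, b) \<in> R ^^ n \<Longrightarrow> (a, b) \<in> S ^^ n"
proof (induction n arbitrary: b)
  case (Suc n)
  from Suc.prems(2) obtain c where "(a, c) \<in> R ^^ n" "(c, b) \<in> R" by (rule relpow_Suc_E)
  then show ?case using Suc by (intro relpow_Suc_I[of a c]) auto
qed simp

text \<open>A shortest \<open>R\<close>-walk from one side of \<open>p\<close> to the other is automatically embedded and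
  meets the arc only in its endpoints.\<close>

lemma circuit_through:
  assumes E_sym: "\<And>u v. E u v \<Longrightarrow> E v u"
    and A: "successively E (Ls @ p # Rs)" "distinct (Ls @ p # Rs)"
    and R: "\<And>u v. (u, v) \<in> R \<Longrightarrow> E u v \<and> u \<noteq> p \<and> v \<noteq> p"
    and ab: "a \<in> set Ls" "b \<in> set Rs" "(a, b) \<in> R ^^ N"
  obtains ys c where "distinct ys" "successively (\<lambda>u v. (u, v) \<in> R) ys" "2 \<le> length ys"
    "hd ys \<in> set Ls" "last ys \<in> set Rs"
    "circuit E c" "p \<in> set c" "set ys \<subseteq> set c" "length c \<le> length Ls + length Rs + 1 + N"
proof -
  let ?P = "\<lambda>k. \<exists>a\<in>set Ls. \<exists>b\<in>set Rs. (a, b) \<in> R ^^ k"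
  define k where "k = (LEAST k. ?P k)"
  have "\<exists>k. ?P k" using ab by blast
  from LeastI_ex[OF this] have "?P k" unfolding k_def .
  then obtain a b where a: "a \<in> set Ls" and b: "b \<in> set Rs" and k: "(a, b) \<in> R ^^ k" by blast
  have least: "k \<le> m" if "?P m" for m unfolding k_def by (rule Least_le[of ?P, OF that])
  then have kN: "k \<le> N" using ab by blast
  obtain f where f: "f 0 = a" "f k = b" "\<And>i. i < k \<Longrightarrow> (f i, f (Suc i)) \<in> R"
    using k by (auto simp: relpow_fun_conv)
  have seg: "(f i, f j) \<in> R ^^ (j - i)" if "i \<le> j" "j \<le> k" for i j
    using that f(3) by (intro relpow_seg) auto
  have "a \<noteq> b" using A(2) a b by auto
  then have k0: "0 < k" using f by (cases k) auto
  have inj: "f i \<noteq> f j" if "i < j" "j \<le> k" for i j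
  proof
    assume "f i = f j"
    then have "(a, b) \<in> R ^^ ((i - 0) + (k - j))"
      using relpow_trans[OF seg[of 0 i], of "f k" "k - j"] seg[of j k] that f \<open>f i = f j\<close>
      by simp
    then have "k \<le> i - 0 + (k - j)" using a b by (intro least) blast
    then show False using that by linarith
  qed
  have nL: "f i \<notin> set Ls" if "0 < i" "i \<le> k" for i
  proof
    assume "f i \<in> set Ls"
    then have "?P (k - i)" using seg[of i k] that f b by auto
    then show False using least that k0 by fastforce
  qed
  have nR: "f i \<notin> set Rs" if "i < k" for i
  proof
    assume "f i \<in> set Rs"
    then have "?P i" using seg[of 0 i] that f a by auto
    then show False using least that by fastforce
  qed
  \<comment> \<open>Each vertex of the walk is an end of one of its edges, and no edge in
    \<open>R\<close> touches \<open>p\<close>; \<open>0 < k\<close> ensures that there is an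
    edge.\<close>
  have np: "f i \<noteq> p" if "i \<le> k" for i
    using R[OF f(3)[of i]] R[OF f(3)[of "i - 1"]] that k0 by (cases "i < k") auto
  have Ef: "E (f i) (f (Suc i))" if "i < k" for i using R f(3) that by blast
  define ys where "ys = map f [0..<Suc k]"
  define mid where "mid = map f [1..<k]"
  obtain L1 L2 where L: "Ls = L1 @ a # L2" using split_list[OF a] by blast
  obtain R1 R2 where Rr: "Rs = R1 @ b # R2" using split_list[OF b] by blast
  \<comment> \<open>The circuit follows the arc from \<open>a\<close> through \<open>p\<close> to
    \<open>b\<close> and returns along the interior of the shortest walk, which is empty for
    \<open>k = 1\<close>.\<close>
  define zs where "zs = a # L2 @ p # R1 @ [b]"
  define c where "c = zs @ rev mid"
  have zs: "successively E zs" "distinct zs" "set zs \<subseteq> set Ls \<union> {p} \<union> set Rs"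
  proof -
    have "Ls @ p # Rs = L1 @ zs @ R2" by (simp add: zs_def L Rr)
    then show "successively E zs" "distinct zs"
      using A by (simp_all add: successively_append_iff)
    show "set zs \<subseteq> set Ls \<union> {p} \<union> set Rs" by (auto simp: zs_def L Rr)
  qed
  have dmid: "distinct mid" unfolding mid_def distinct_map
  proof (intro conjI inj_onI)
    fix i j assume "i \<in> set [1..<k]" "j \<in> set [1..<k]" "f i = f j"
    then show "i = j" using inj[of i j] inj[of j i] by (cases i j rule: linorder_cases) auto
  qed simp
  have dys: "distinct ys" unfolding ys_def distinct_map
  proof (intro conjI inj_onI)
    fix i j assume "i \<in> set [0..<Suc k]" "j \<in> set [0..<Suc k]" "f i = f j"
    then show "i = j" using inj[of i j] inj[of j i] by (cases i j rule: linorder_cases) auto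
  qed simp
  have sucmap: "successively P (map f [i..<j])" if "\<And>m. i \<le> m \<Longrightarrow> Suc m < j \<Longrightarrow> P (f m) (f (Suc m))" for P i j
    using that
  proof (induction j)
    case (Suc j)
    have "last (map f [i..<j]) = f (j - 1)" "Suc (j - 1) = j" if "i < j"
      using that by (simp_all add: last_map)
    then have "P (last (map f [i..<j])) (f j)" if "i < j"
      using Suc.prems[of "j - 1"] that by simp
    then show ?case using Suc by (cases "i < j") (auto simp: successively_append_iff le_Suc_eq)
  qed simp
  have smid: "successively E (rev mid)" unfolding mid_def successively_rev
    using Ef E_sym by (intro sucmap) auto
  have sys: "successively (\<lambda>u v. (u, v) \<in> R) ys" unfolding ys_def using f(3) by (intro sucmap) auto
  have "q \<notin> set zs" if q: "q \<in> set mid" for q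
  proof -
    from q obtain i where i: "q = f i" "0 < i" "i < k" by (auto simp: mid_def)
    then show ?thesis using zs(3) nL[of i] nR[of i] np[of i] by (simp add: subset_iff) blast
  qed
  then have dc: "distinct c" using dmid zs(2) unfolding c_def by auto
  have junction: "E b (hd (rev mid))" if "mid \<noteq> []"
  proof -
    have "1 < k" using that by (simp add: mid_def)
    then have "hd (rev mid) = f (k - 1)" by (simp add: mid_def hd_rev last_map)
    then show ?thesis using Ef[of "k - 1"] f(2) k0 E_sym by simp
  qed
  have hz: "hd zs = a" "last zs = b" "zs \<noteq> []" by (auto simp: zs_def)
  have sc: "successively E c"
    using zs smid junction hz by (auto simp: c_def successively_append_iff)
  have closing: "E (last c) (hd c)"
  proof (cases "mid = []")
    case True
    then have "k = 1" using k0 by (simp add: mid_def)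
    then show ?thesis using Ef[of 0] f True E_sym hz by (simp add: c_def)
  next
    case False
    then have "1 < k" by (simp add: mid_def)
    then have "last (rev mid) = f 1" by (simp add: mid_def last_rev hd_map)
    then show ?thesis using Ef[of 0] f False E_sym hz k0 by (simp add: c_def last_rev)
  qed
  have c: "circuit E c"
    using sc closing dc by (intro circuitI) (auto simp: c_def zs_def)
  have "f i \<in> set c" if ik: "i \<le> k" for i
  proof -
    consider "i = 0" | "i = k" | "1 \<le> i \<and> i < k" using ik by linarith
    then show ?thesis using f by cases (auto simp: c_def zs_def mid_def)
  qed
  then have ysc: "set ys \<subseteq> set c" by (auto simp: ys_def)
  have len: "length c \<le> length Ls + length Rs + 1 + N"
    using kN k0 by (simp add: c_def zs_def mid_def L Rr)
  have "hd ys = a" "last ys = b" "length ys = Suc k"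
    using f by (auto simp: ys_def hd_map last_map simp del: upt_Suc)
  then show ?thesis
    using that[of ys c] dys sys c ysc len a b k0 by (auto simp: c_def zs_def)
qed

text \<open>Consecutive pairs of a list without repetition are distinct, so every step consumes a
  new member of \<open>B\<close>. For a walk made of exceptional edges only, this bounds its length
  by their number.\<close>

lemma successively_all_in_length:
  assumes "successively (\<lambda>u v. (u, v) \<in> B) ys" "distinct ys" "finite B"
  shows "length ys \<le> Suc (card B)"
proof -
  let ?f = "\<lambda>i. (ys ! i, ys ! Suc i)"
  have "inj_on ?f {..<length ys - 1}"
    using assms(2) by (auto simp: inj_on_def nth_eq_iff_index_eq)
  moreover have "?f ` {..<length ys - 1} \<subseteq> B"
    using assms(1)[unfolded successively_conv_nth] by auto
  ultimately have "card {..<length ys - 1} \<le> card B"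
    using assms(3) card_inj_on_le by blast
  then show ?thesis by simp
qed

context ugraph
begin

lemma h_successively:
  "successively E ys \<Longrightarrow> ys \<noteq> [] \<Longrightarrow> set ys \<subseteq> X \<Longrightarrow> h (hd ys) (last ys) \<le> length ys - 1"
proof (induction ys)
  case (Cons y ys)
  show ?case
  proof (cases "ys = []")
    case False
    then have "h y (last ys) \<le> h y (hd ys) + h (hd ys) (last ys)"
      using Cons.prems by (intro d_tri) auto
    moreover have "h y (hd ys) \<le> 1" using Cons.prems False h_edge[of y "hd ys"]
      by (simp add: successively_Cons)
    moreover have "0 < length ys" using False by simp
    moreover have "h (hd ys) (last ys) \<le> length ys - 1"
      using Cons False by (simp add: successively_Cons)
    ultimately have "h y (last ys) \<le> length ys" by linarith
    then show ?thesis using False by simp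
  qed simp
qed simp

text \<open>A geodesic in the form of its set of edges, ready to be united with other edge sets into
  one relation. The distance bounds serve to keep it away from a given point.\<close>

lemma geod_rel:
  assumes "a \<in> X" "b \<in> X"
  obtains B where "finite B" "card B \<le> h a b" "(a, b) \<in> B ^^ (h a b)"
    "\<forall>u v. (u, v) \<in> B \<longrightarrow> E u v \<and> h a u \<le> h a b \<and> h a v \<le> h a b \<and> h u b \<le> h a b \<and> h v b \<le> h a b"
proof -
  obtain \<gamma> where \<gamma>: "geod a b \<gamma>" using geod_ex assms by blast
  let ?B = "(\<lambda>i. (\<gamma> i, \<gamma> (Suc i))) ` {..<h a b}"
  have "(\<gamma> 0, \<gamma> (h a b)) \<in> ?B ^^ (h a b - 0)" by (rule relpow_seg) auto
  then have "(a, b) \<in> ?B ^^ (h a b)" using \<gamma> by (simp add: geod_def)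
  moreover have "card ?B \<le> h a b" using card_image_le[of "{..<h a b}"] by fastforce
  moreover have "E u v \<and> h a u \<le> h a b \<and> h a v \<le> h a b \<and> h u b \<le> h a b \<and> h v b \<le> h a b" if "(u, v) \<in> ?B" for u v
  proof -
    from that obtain i where i: "i < h a b" "u = \<gamma> i" "v = \<gamma> (Suc i)" by blast
    have "i \<le> h a b" "Suc i \<le> h a b" using i(1) by auto
    then have "E (\<gamma> i) (\<gamma> (Suc i))" "h a (\<gamma> i) = i" "h a (\<gamma> (Suc i)) = Suc i"
      "h (\<gamma> i) b = h a b - i" "h (\<gamma> (Suc i)) b = h a b - Suc i"
      using \<gamma> i(1) unfolding geod_def by blast+
    then show ?thesis using i by simp
  qed
  ultimately show ?thesis using that[of ?B] by auto
qed

lemma geod_rel':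
  assumes "a \<in> X" "b \<in> X" "p \<in> X" "h a b \<le> \<Delta>" "a = b \<or> T + \<Delta> \<le> h p a \<or> T + \<Delta> \<le> h p b"
  obtains B where "finite B" "card B \<le> \<Delta>" "(a, b) \<in> B ^^ (h a b)"
    "\<forall>u v. (u, v) \<in> B \<longrightarrow> E u v \<and> T \<le> h p u \<and> T \<le> h p v"
proof -
  obtain B where B: "finite B" "card B \<le> h a b" "(a, b) \<in> B ^^ (h a b)"
    "\<forall>u v. (u, v) \<in> B \<longrightarrow> E u v \<and> h a u \<le> h a b \<and> h a v \<le> h a b \<and> h u b \<le> h a b \<and> h v b \<le> h a b"
    using geod_rel[OF assms(1,2)] by blast
  show ?thesis
  proof (cases "a = b")
    case True
    then show ?thesis using that[of "{}"] by simp
  next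
    case False
    have "T \<le> h p u" if "u \<in> X" "h a u \<le> h a b" "h u b \<le> h a b" for u
      using d_tri[of p u a] d_tri[of p u b] d_sym[of u a] that False assms by linarith
    then have "E u v \<and> T \<le> h p u \<and> T \<le> h p v" if "(u, v) \<in> B" for u v
      using B(4) that E_in E_in2 by blast
    then show ?thesis using that[OF B(1) le_trans[OF B(2) assms(4)] B(3)] by blast
  qed
qed

lemma geod_list:
  assumes "x \<in> X" "y \<in> X" "geod x y \<gamma>" "i \<le> j" "j \<le> Suc (h x y)"
  shows "successively E (map \<gamma> [i..<j])" "distinct (map \<gamma> [i..<j])"
proof -
  show "successively E (map \<gamma> [i..<j])"
    using assms(4,5)
  proof (induction j)
    case (Suc j)
    have "E (\<gamma> (j - 1)) (\<gamma> j)" if "i < j"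
    proof -
      have "j - 1 < h x y" using Suc.prems that by simp
      then have "E (\<gamma> (j - 1)) (\<gamma> (Suc (j - 1)))" using assms(3) unfolding geod_def by blast
      then show ?thesis using that by simp
    qed
    moreover have "last (map \<gamma> [i..<j]) = \<gamma> (j - 1)" if "i < j"
      using that by (simp add: last_map)
    ultimately show ?case using Suc
      by (cases "i < j") (auto simp: successively_append_iff le_Suc_eq)
  qed simp
  have "inj_on \<gamma> {..h x y}"
    using assms(3) by (intro inj_on_inverseI[of _ "h x"]) (auto simp: geod_def)
  then show "distinct (map \<gamma> [i..<j])"
    using assms(5) by (auto simp: distinct_map intro: inj_on_subset)
qed

end

section \<open>Thin triangles\<close>

text \<open>\<open>V\<close> are the group elements and \<open>X - V\<close> the cone points; \<open>S.h\<close> is the word metric.\<close>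

locale relhyp_graph = ugraph X E + S: ugraph V "\<lambda>u v. E u v \<and> u \<in> V \<and> v \<in> V"
  for X :: "'v set" and E and V +
  fixes \<delta> :: nat
  assumes V_sub: "V \<subseteq> X"
    and edge_V: "E u v \<Longrightarrow> u \<in> V \<or> v \<in> V"
    and four_point: "\<lbrakk>w \<in> X; x \<in> X; y \<in> X; z \<in> X\<rbrakk> \<Longrightarrow>
       h x z + h w y \<le> max (h x y + h w z) (h y z + h w x) + \<delta>"
    and circuits_bounded: "\<exists>D. \<forall>c. circuit E c \<and> length c \<le> n \<longrightarrow>
       (\<forall>p\<in>set c \<inter> V. \<forall>q\<in>set c \<inter> V. S.h p q \<le> D)"
begin

text \<open>The last hypothesis says that \<open>t\<close> is at most the Gromov product of
  \<open>u\<close> and \<open>v\<close> at \<open>o'\<close>. One use of the four-point inequality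
  shows that passing through \<open>a\<close> lengthens the way from \<open>o'\<close> to
  \<open>v\<close> by at most \<delta>; a second one compares \<open>a\<close> with
  \<open>b\<close>.\<close>

lemma thin:
  assumes "o' \<in> X" "u \<in> X" "v \<in> X" "btw o' a u" "btw o' b v" "h o' a = t" "h o' b = t"
    and "2 * t + h u v \<le> h o' u + h o' v"
  shows "h a b \<le> 2 * \<delta>"
proof -
  have ab: "a \<in> X" "b \<in> X" "t + h a u = h o' u" "t + h b v = h o' v"
    using assms by (auto simp: btw_def)
  have "h a v + h o' u \<le> max (h a u + h o' v) (h u v + h o' a) + \<delta>"
    using four_point[of o' a u v] assms ab by blast
  then have 1: "h a v + t \<le> h o' v + \<delta>" using ab assms by linarith
  have "h a b + h o' v \<le> max (h a v + h o' b) (h v b + h o' a) + \<delta>"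
    using four_point[of o' a v b] assms ab by blast
  then show ?thesis using 1 ab assms d_sym[of b v] by linarith
qed

text \<open>Unless \<open>p\<close> lies in \<open>Side\<close>, the walk avoids \<open>p\<close>
  and gives a circuit of bounded length through \<open>p\<close>. If the circuit has an edge inside
  \<open>Side\<close>, one end of that edge is the group element sought. Otherwise its walk uses
  exceptional edges only. These are fewer than \<open>2 * T\<close>, yet they would have to join two
  points of the geodesic on either side of \<open>p\<close>, each at distance at least
  \<open>T\<close> from \<open>p\<close>.\<close>

lemma detour:
  assumes X: "x \<in> X" "y \<in> X" and p: "p \<in> V" "geod x y \<gamma>" "\<gamma> t = p" "l < t" "t < r" "r \<le> h x y"
    and Bad: "finite Bad" "card Bad < 2 * T" "0 < T"
      "\<And>u v. (u, v) \<in> Bad \<Longrightarrow> E u v \<and> T \<le> h p u \<and> T \<le> h p v"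
    and walk: "(\<gamma> l, \<gamma> r) \<in> ({(u, v). E u v \<and> u \<in> Side \<and> v \<in> Side} \<union> Bad) ^^ N"
    and D: "\<And>c p q. circuit E c \<Longrightarrow> length c \<le> r - l + 1 + N \<Longrightarrow> p \<in> set c \<inter> V \<Longrightarrow>
       q \<in> set c \<inter> V \<Longrightarrow> S.h p q \<le> D"
  shows "\<exists>q\<in>V \<inter> Side. S.h p q \<le> D"
proof (cases "p \<in> Side")
  case True
  then show ?thesis using p by (intro bexI[of _ p]) auto
next
  case False
  let ?Good = "{(u, v). E u v \<and> u \<in> Side \<and> v \<in> Side}"
  let ?R = "?Good \<union> Bad"
  let ?Ls = "map \<gamma> [l..<t]" and ?Rs = "map \<gamma> [Suc t..<Suc r]"
  have R: "E u v \<and> u \<noteq> p \<and> v \<noteq> p" if "(u, v) \<in> ?R" for u v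
    using that
  proof
    assume "(u, v) \<in> ?Good"
    then show ?thesis using False by auto
  next
    assume "(u, v) \<in> Bad"
    from Bad(4)[OF this] Bad(3) have "E u v" "0 < h p u" "0 < h p v" by auto
    then show ?thesis by fastforce
  qed
  have "[l..<Suc r] = [l..<t] @ t # [Suc t..<Suc r]"
    using p(4,5) upt_add_eq_append[of l t "Suc r - t"] upt_conv_Cons[of t "Suc r"] by simp
  then have eq: "?Ls @ p # ?Rs = map \<gamma> [l..<Suc r]" using p(3) by simp
  have "successively E (map \<gamma> [l..<Suc r])" "distinct (map \<gamma> [l..<Suc r])"
    using geod_list[OF X p(2), of l "Suc r"] p by auto
  then have A: "successively E (?Ls @ p # ?Rs)" "distinct (?Ls @ p # ?Rs)" unfolding eq by auto
  have "\<gamma> l \<in> set ?Ls" "\<gamma> r \<in> set ?Rs" using p by auto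
  from circuit_through[of E ?Ls p ?Rs ?R "\<gamma> l" "\<gamma> r" N, OF E_sym A R this walk]
  obtain ys c where ys: "distinct ys" "successively (\<lambda>u v. (u, v) \<in> ?R) ys" "2 \<le> length ys"
    "hd ys \<in> set ?Ls" "last ys \<in> set ?Rs" and c: "circuit E c" "p \<in> set c" "set ys \<subseteq> set c"
    "length c \<le> length ?Ls + length ?Rs + 1 + N" by blast
  have Dc: "S.h p q \<le> D" if "q \<in> set c" "q \<in> V" for q
    using D[of c p q] c p that by simp
  have sE: "successively E ys" using successively_mono[OF ys(2)] R by blast
  show ?thesis
  proof (cases "\<exists>i. Suc i < length ys \<and> (ys ! i, ys ! Suc i) \<in> ?Good")
    case True
    then obtain i where i: "Suc i < length ys" "E (ys ! i) (ys ! Suc i)"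
      "ys ! i \<in> Side" "ys ! Suc i \<in> Side" by auto
    have "ys ! i \<in> set c" "ys ! Suc i \<in> set c" using c(3) i(1) by auto
    then show ?thesis using edge_V[OF i(2)] i Dc by blast
  next
    case False
    then have B: "successively (\<lambda>u v. (u, v) \<in> Bad) ys"
      using ys(2) unfolding successively_conv_nth by blast
    have len: "length ys \<le> Suc (card Bad)"
      using successively_all_in_length[OF B ys(1) Bad(1)] .
    have ne: "ys \<noteq> []" using ys(3) by auto
    have first: "(ys ! 0, ys ! 1) \<in> Bad"
      using B ys(3) unfolding successively_conv_nth by auto
    have "Suc (length ys - 2) < length ys" "Suc (length ys - 2) = length ys - 1" using ys(3) by auto
    then have last: "(ys ! (length ys - 2), ys ! (length ys - 1)) \<in> Bad"
      using B unfolding successively_conv_nth by metis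
    have hd: "T \<le> h p (hd ys)" using Bad(4)[OF first] ne by (simp add: hd_conv_nth)
    have lt: "T \<le> h p (last ys)" using Bad(4)[OF last] ne by (simp add: last_conv_nth)
    obtain i where i: "hd ys = \<gamma> i" "l \<le> i" "i < t" using ys(4) by auto
    obtain j where j: "last ys = \<gamma> j" "t < j" "j \<le> r" using ys(5) by auto
    have ij: "h (\<gamma> i) (\<gamma> j) = j - i" "h (\<gamma> i) p = t - i" "h p (\<gamma> j) = j - t"
      using geod_dist[OF X p(2)] p i j by auto
    have "\<gamma> i \<in> X" "p \<in> X" using p i V_sub by (auto simp: geod_def)
    then have "h p (\<gamma> i) = t - i" using ij d_sym by metis
    then have "2 * T \<le> h (hd ys) (last ys)" using hd lt ij i j by simp
    moreover have "set ys \<subseteq> X"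
    proof
      fix q assume "q \<in> set ys"
      then obtain k where k: "k < length ys" "q = ys ! k" by (auto simp: in_set_conv_nth)
      show "q \<in> X"
      proof (cases "Suc k < length ys")
        case True
        then show ?thesis using sE k E_in unfolding successively_conv_nth by blast
      next
        case False
        then have "k = length ys - 1" using k by linarith
        then have "q = last ys" using k ne by (simp add: last_conv_nth)
        moreover have "\<gamma> j \<in> X" using p j by (auto simp: geod_def)
        ultimately show ?thesis using j by simp
      qed
    qed
    then have "h (hd ys) (last ys) \<le> length ys - 1" using h_successively sE ne by blast
    ultimately show ?thesis using len Bad(2) by linarith
  qed
qed

text \<open>The last premise places \<open>p\<close> on the part of \<open>[x, y]\<close> that runs
  close to \<open>[x, z]\<close>. A window of the geodesic around \<open>p\<close> is bypassed along
  the other two sides, with at most three short crossings between sides; these are the exceptional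
  edges of \<open>detour\<close>. A crossing either has an end far from \<open>p\<close> or is
  empty, at a corner of the triangle.\<close>

lemma triangle_half:
  "\<exists>K. \<forall>x\<in>X. \<forall>y\<in>X. \<forall>z\<in>X. \<forall>p\<in>V. btw x p y \<longrightarrow> 2 * h x p + h y z \<le> h x y + h x z \<longrightarrow>
     (\<exists>p'\<in>V. (btw x p' z \<or> btw z p' y) \<and> S.h p p' \<le> K)"
proof -
  \<comment> \<open>Crossings have length at most \<open>2 * \<delta>\<close>; the summand 1 makes
    \<Delta> positive. With \<open>T = 4 * \<Delta>\<close>, a crossing with an end at distance
    \<open>T\<close> from \<open>p\<close> stays at distance \<open>3 * \<Delta>\<close>, and three
    crossings have at most \<open>3 * \<Delta>\<close> edges, fewer than the
    \<open>2 * (3 * \<Delta>)\<close> that \<open>detour\<close> forbids.\<close>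
  define \<Delta> where "\<Delta> = 2 * \<delta> + 1"
  define T where "T = 4 * \<Delta>"
  obtain D where D: "\<And>c p q. circuit E c \<Longrightarrow> length c \<le> 2 * T + 1 + (6 * T + 3 * \<Delta>) \<Longrightarrow> p \<in> set c \<inter> V \<Longrightarrow>
       q \<in> set c \<inter> V \<Longrightarrow> S.h p q \<le> D"
    using circuits_bounded[of "2 * T + 1 + (6 * T + 3 * \<Delta>)"] by blast
  have "\<exists>p'\<in>V. (btw x p' z \<or> btw z p' y) \<and> S.h p p' \<le> D"
    if X: "x \<in> X" "y \<in> X" "z \<in> X" and p: "p \<in> V" "btw x p y"
      and half: "2 * h x p + h y z \<le> h x y + h x z" for x y z p
  proof -
    define t where "t = h x p"
    have pX: "p \<in> X" using p V_sub by auto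
    have t: "t + h p y = h x y" using p by (simp add: btw_def t_def)
    have tri: "h x y \<le> h x z + h y z" "h x z \<le> h x y + h y z" "h y z \<le> h x y + h x z"
      using d_tri X d_sym by metis+
    consider "t = 0" | "h p y = 0" | "0 < t" "0 < h p y" by linarith
    then show ?thesis
    proof cases
      case 1
      then have "p = x" using d_eq_0[of x p] X pX t_def by simp
      then show ?thesis using p X by (intro bexI[of _ p]) (auto simp: btw_def)
    next
      case 2
      then have "p = y" using d_eq_0[of p y] X pX by simp
      then show ?thesis using p X by (intro bexI[of _ p]) (auto simp: btw_def)
    next
      case 3
      obtain \<alpha> where \<alpha>: "geod x y \<alpha>" "\<alpha> t = p" using geod_through X p t_def by metis
      obtain \<beta> where \<beta>: "geod x z \<beta>" using geod_ex X by metis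
      obtain \<gamma> where \<gamma>: "geod y z \<gamma>" using geod_ex X by metis
      \<comment> \<open>Truncated subtraction: for \<open>t \<le> T\<close> the window begins at the
        corner \<open>x\<close>.\<close>
      define l where "l = t - T"
      define r where "r = min (t + T) (h x y)"
      have T0: "0 < T" "0 < \<Delta>" by (auto simp: T_def \<Delta>_def)
      have lr: "l < t" "t < r" "r \<le> h x y" "r - l \<le> 2 * T" using 3 t T0 by (auto simp: l_def r_def)
      define Side where "Side = {q. btw x q z \<or> btw z q y}"
      let ?Good = "{(u, v). E u v \<and> u \<in> Side \<and> v \<in> Side}"
      have segB: "(\<beta> i, \<beta> j) \<in> ?Good ^^ (j - i)" if "i \<le> j" "j \<le> h x z" for i j
      proof (rule relpow_seg)
        fix m assume "i \<le> m" "m < j"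
        then have "m < h x z" "m \<le> h x z" "Suc m \<le> h x z" using that by auto
        then show "(\<beta> m, \<beta> (Suc m)) \<in> ?Good"
          using \<beta> geod_btw[OF \<beta>] unfolding Side_def geod_def by blast
      qed fact
      have segC: "(\<gamma> j, \<gamma> i) \<in> ?Good ^^ (j - i)" if "i \<le> j" "j \<le> h y z" for i j
      proof -
        have "(\<gamma> (j - 0), \<gamma> (j - (j - i))) \<in> ?Good ^^ (j - i - 0)"
        proof (rule relpow_seg)
          fix m assume "0 \<le> m" "m < j - i"
          then have m: "j - Suc m < h y z" "j - Suc m \<le> h y z" "j - m \<le> h y z" "Suc (j - Suc m) = j - m"
            using that by auto
          then have "E (\<gamma> (j - m)) (\<gamma> (j - Suc m))" using \<gamma> E_sym unfolding geod_def by metis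
          moreover have "btw z (\<gamma> (j - m)) y" "btw z (\<gamma> (j - Suc m)) y"
            using geod_btw[OF \<gamma>] m btw_sym X by blast+
          ultimately show "(\<gamma> (j - m), \<gamma> (j - Suc m)) \<in> ?Good" unfolding Side_def by blast
        qed simp
        then show ?thesis using that by simp
      qed
      have a: "\<alpha> i \<in> X" "btw x (\<alpha> i) y" "h x (\<alpha> i) = i" "h y (\<alpha> i) = h x y - i" if "i \<le> h x y" for i
        using \<alpha> geod_btw[OF \<alpha>(1)] that X d_sym[of y] by (auto simp: geod_def)
      have b: "\<beta> i \<in> X" "btw x (\<beta> i) z" "h x (\<beta> i) = i" "h z (\<beta> i) = h x z - i" if "i \<le> h x z" for i
        using \<beta> geod_btw[OF \<beta>] that X d_sym[of z] by (auto simp: geod_def)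
      have c: "\<gamma> i \<in> X" "btw y (\<gamma> i) z" "h y (\<gamma> i) = i" "h z (\<gamma> i) = h y z - i" if "i \<le> h y z" for i
        using \<gamma> geod_btw[OF \<gamma>] that X d_sym[of z] by (auto simp: geod_def)
      have hp: "h p (\<alpha> i) = (if i \<le> t then t - i else i - t)" if "i \<le> h x y" for i
        using geod_dist[OF X(1,2) \<alpha>(1), of i t] geod_dist[OF X(1,2) \<alpha>(1), of t i] that \<alpha>(2)
          d_sym[OF pX a(1)[OF that]] t by auto
      have txz: "t \<le> h x z" using half tri t_def by linarith
      have l_xz: "l \<le> h x z" "l \<le> h x y" using txz t by (auto simp: l_def)
      have "2 * l + h y z \<le> h x y + h x z" using half by (simp add: l_def t_def)
      then have "h (\<alpha> l) (\<beta> l) \<le> 2 * \<delta>"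
        using thin[of x y z "\<alpha> l" "\<beta> l" l] X a b l_xz by blast
      then have "h (\<alpha> l) (\<beta> l) \<le> \<Delta>" by (simp add: \<Delta>_def)
      moreover have "\<alpha> l = \<beta> l \<or> 3 * \<Delta> + \<Delta> \<le> h p (\<alpha> l)"
      proof (cases "t \<le> T")
        case True
        then show ?thesis using \<alpha> \<beta> by (simp add: l_def geod_def)
      next
        case False
        then show ?thesis using hp[of l] l_xz by (simp add: l_def T_def)
      qed
      ultimately obtain B1 where B1: "finite B1" "card B1 \<le> \<Delta>" "(\<alpha> l, \<beta> l) \<in> B1 ^^ h (\<alpha> l) (\<beta> l)"
        "\<forall>u v. (u, v) \<in> B1 \<longrightarrow> E u v \<and> 3 * \<Delta> \<le> h p u \<and> 3 * \<Delta> \<le> h p v" and B1l: "h (\<alpha> l) (\<beta> l) \<le> \<Delta>"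
        using geod_rel'[of "\<alpha> l" "\<beta> l" p \<Delta> "3 * \<Delta>"] a b l_xz pX by metis
      have far_r: "3 * \<Delta> + \<Delta> \<le> h p (\<alpha> r)" if "r \<noteq> h x y"
        using that hp[of r] lr by (auto simp: r_def T_def min_def split: if_splits)
      have "\<exists>Bad N. finite Bad \<and> card Bad \<le> 3 * \<Delta> \<and>
         (\<forall>u v. (u, v) \<in> Bad \<longrightarrow> E u v \<and> 3 * \<Delta> \<le> h p u \<and> 3 * \<Delta> \<le> h p v) \<and>
         N \<le> 6 * T + 3 * \<Delta> \<and> (\<alpha> l, \<alpha> r) \<in> (?Good \<union> Bad) ^^ N"
      \<comment> \<open>If the far end of the window is still below the Gromov product at
        \<open>x\<close>, the bypass returns directly from \<open>[x, z]\<close>; otherwise it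
        continues along \<open>[y, z]\<close>.\<close>
      proof (cases "2 * (t + T) + h y z \<le> h x y + h x z")
        case True
        then have r: "r = t + T" "r \<le> h x z" "l \<le> r" using tri by (auto simp: r_def l_def)
        have "h (\<alpha> r) (\<beta> r) \<le> 2 * \<delta>"
          using thin[of x y z "\<alpha> r" "\<beta> r" r] X a b r lr True by simp
        then have B2l: "h (\<beta> r) (\<alpha> r) \<le> \<Delta>" using d_sym a(1)[of r] b(1)[of r] r lr by (simp add: \<Delta>_def)
        have "3 * \<Delta> + \<Delta> \<le> h p (\<alpha> r)"
          using hp[of r] lr r by (simp add: T_def)
        then obtain B2 where B2: "finite B2" "card B2 \<le> \<Delta>" "(\<beta> r, \<alpha> r) \<in> B2 ^^ h (\<beta> r) (\<alpha> r)"
          "\<forall>u v. (u, v) \<in> B2 \<longrightarrow> E u v \<and> 3 * \<Delta> \<le> h p u \<and> 3 * \<Delta> \<le> h p v"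
          using geod_rel'[of "\<beta> r" "\<alpha> r" p \<Delta> "3 * \<Delta>"] a(1)[of r] b(1)[of r] r lr pX B2l by metis
        let ?Bad = "B1 \<union> B2"
        have w1: "(\<alpha> l, \<beta> l) \<in> (?Good \<union> ?Bad) ^^ h (\<alpha> l) (\<beta> l)"
          by (rule relpow_sub[OF _ B1(3)]) blast
        have w2: "(\<beta> l, \<beta> r) \<in> (?Good \<union> ?Bad) ^^ (r - l)"
          by (rule relpow_sub[OF _ segB[OF r(3,2)]]) blast
        have w3: "(\<beta> r, \<alpha> r) \<in> (?Good \<union> ?Bad) ^^ h (\<beta> r) (\<alpha> r)"
          by (rule relpow_sub[OF _ B2(3)]) blast
        note walk = relpow_trans[OF relpow_trans[OF w1 w2] w3]
        have "card ?Bad \<le> 3 * \<Delta>" using card_Un_le[of B1 B2] B1(2) B2(2) by linarith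
        moreover have "h (\<alpha> l) (\<beta> l) + (r - l) + h (\<beta> r) (\<alpha> r) \<le> 6 * T + 3 * \<Delta>"
          using B1l B2l lr by linarith
        ultimately show ?thesis using walk B1(1,4) B2(1,4)
          by (intro exI[of _ ?Bad] exI[of _ "h (\<alpha> l) (\<beta> l) + (r - l) + h (\<beta> r) (\<alpha> r)"]) blast
      next
        case False
        \<comment> \<open>The change from \<open>[x, z]\<close> to \<open>[y, z]\<close> takes place
          at equal distance from \<open>z\<close> on both sides, not before the Gromov product at
          \<open>x\<close> is reached. The index \<open>k\<close> is the position of the far end of
          the window counted from \<open>y\<close>.\<close>
        define jB where "jB = min (t + 2 * T) (h x z)"
        define jC where "jC = h y z - (h x z - jB)"
        define k where "k = h x y - r"
        have jB: "jB \<le> h x z" "l \<le> jB" "jB - l \<le> 3 * T" using txz by (auto simp: jB_def l_def)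
        have jB2: "2 * (h x z - jB) + h x y \<le> h x z + h y z"
          using False tri by (auto simp: jB_def min_def)
        have xj: "h x z - jB \<le> h y z" using jB2 tri by linarith
        have jC: "jC \<le> h y z" "h y z - jC = h x z - jB" using xj by (auto simp: jC_def)
        have k2: "2 * k + h x z \<le> h x y + h y z"
          using False tri by (auto simp: k_def r_def min_def)
        have kyz: "k \<le> h y z" using k2 tri by linarith
        have jr: "h x y + h x z \<le> 2 * r + h y z" "h x y + h x z \<le> 2 * jB + h y z"
          using False tri by (auto simp: r_def jB_def min_def)
        have kjC: "k \<le> jC" "jC - k \<le> 3 * T"
        proof -
          have "r + k = h x y" using lr(3) by (simp add: k_def)
          moreover have "jC + h x z = h y z + jB" using jC jB xj by linarith
          moreover have "jB \<le> t + 2 * T" "r \<le> t + T" by (auto simp: jB_def r_def)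
          ultimately show "k \<le> jC" "jC - k \<le> 3 * T" using jr half t_def by linarith+
        qed
        have "h (\<beta> jB) (\<gamma> jC) \<le> 2 * \<delta>"
        proof (rule thin)
          show "btw z (\<beta> jB) x" "btw z (\<gamma> jC) y"
            using btw_sym[OF X(1,3) b(2)[OF jB(1)]] btw_sym[OF X(2,3) c(2)[OF jC(1)]] by blast+
          show "h z (\<beta> jB) = h x z - jB" "h z (\<gamma> jC) = h x z - jB" using b(4)[OF jB(1)] c(4)[OF jC(1)] jC(2) by simp_all
          show "2 * (h x z - jB) + h x y \<le> h z x + h z y"
            using jB2 d_sym[OF X(1,3)] d_sym[OF X(2,3)] by linarith
        qed (use X in auto)
        then have JL: "h (\<beta> jB) (\<gamma> jC) \<le> \<Delta>" by (simp add: \<Delta>_def)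
        have "\<beta> jB = \<gamma> jC \<or> 3 * \<Delta> + \<Delta> \<le> h p (\<beta> jB)"
        proof (cases "jB = h x z")
          case True
          then have "jC = h y z" using jC by linarith
          then show ?thesis using True \<beta> \<gamma> by (simp add: geod_def)
        next
          case False
          then have "jB = t + 2 * T" by (auto simp: jB_def min_def split: if_splits)
          moreover have "h x (\<beta> jB) \<le> h x p + h p (\<beta> jB)" using d_tri X pX b(1)[OF jB(1)] by blast
          ultimately have "2 * T \<le> h p (\<beta> jB)" using b(3)[OF jB(1)] t_def by linarith
          then show ?thesis by (simp add: T_def)
        qed
        then obtain B2 where B2: "finite B2" "card B2 \<le> \<Delta>" "(\<beta> jB, \<gamma> jC) \<in> B2 ^^ h (\<beta> jB) (\<gamma> jC)"
          "\<forall>u v. (u, v) \<in> B2 \<longrightarrow> E u v \<and> 3 * \<Delta> \<le> h p u \<and> 3 * \<Delta> \<le> h p v"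
          using geod_rel'[of "\<beta> jB" "\<gamma> jC" p \<Delta> "3 * \<Delta>"] b(1)[OF jB(1)] c(1)[OF jC(1)] pX JL by metis
        have "h (\<gamma> k) (\<alpha> r) \<le> 2 * \<delta>"
        proof (rule thin)
          show "btw y (\<gamma> k) z" "btw y (\<alpha> r) x"
            using c(2)[OF kyz] btw_sym[OF X(1,2) a(2)[OF lr(3)]] by blast+
          show "h y (\<gamma> k) = k" "h y (\<alpha> r) = k"
            using c(3)[OF kyz] a(4)[OF lr(3)] by (simp_all add: k_def)
          show "2 * k + h z x \<le> h y z + h y x"
            using k2 d_sym[OF X(1,3)] d_sym[OF X(1,2)] by linarith
        qed (use X in auto)
        then have CL: "h (\<gamma> k) (\<alpha> r) \<le> \<Delta>" by (simp add: \<Delta>_def)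
        have "\<gamma> k = \<alpha> r \<or> 3 * \<Delta> + \<Delta> \<le> h p (\<alpha> r)"
        proof (cases "r = h x y")
          case True
          then show ?thesis using \<alpha> \<gamma> by (simp add: geod_def k_def)
        qed (use far_r in simp)
        then obtain B3 where B3: "finite B3" "card B3 \<le> \<Delta>" "(\<gamma> k, \<alpha> r) \<in> B3 ^^ h (\<gamma> k) (\<alpha> r)"
          "\<forall>u v. (u, v) \<in> B3 \<longrightarrow> E u v \<and> 3 * \<Delta> \<le> h p u \<and> 3 * \<Delta> \<le> h p v"
          using geod_rel'[of "\<gamma> k" "\<alpha> r" p \<Delta> "3 * \<Delta>"] a(1)[OF lr(3)] c(1)[OF kyz] pX CL by metis
        let ?Bad = "B1 \<union> (B2 \<union> B3)"
        have w1: "(\<alpha> l, \<beta> l) \<in> (?Good \<union> ?Bad) ^^ h (\<alpha> l) (\<beta> l)"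
          by (rule relpow_sub[OF _ B1(3)]) blast
        have w2: "(\<beta> l, \<beta> jB) \<in> (?Good \<union> ?Bad) ^^ (jB - l)"
          by (rule relpow_sub[OF _ segB[OF jB(2,1)]]) blast
        have w3: "(\<beta> jB, \<gamma> jC) \<in> (?Good \<union> ?Bad) ^^ h (\<beta> jB) (\<gamma> jC)"
          by (rule relpow_sub[OF _ B2(3)]) blast
        have w4: "(\<gamma> jC, \<gamma> k) \<in> (?Good \<union> ?Bad) ^^ (jC - k)"
          by (rule relpow_sub[OF _ segC[OF kjC(1) jC(1)]]) blast
        have w5: "(\<gamma> k, \<alpha> r) \<in> (?Good \<union> ?Bad) ^^ h (\<gamma> k) (\<alpha> r)"
          by (rule relpow_sub[OF _ B3(3)]) blast
        note walk = relpow_trans[OF relpow_trans[OF relpow_trans[OF relpow_trans[OF w1 w2] w3] w4] w5]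
        have "card ?Bad \<le> 3 * \<Delta>"
          using card_Un_le[of B1 "B2 \<union> B3"] card_Un_le[of B2 B3] B1(2) B2(2) B3(2) by linarith
        moreover have "h (\<alpha> l) (\<beta> l) + (jB - l) + h (\<beta> jB) (\<gamma> jC) + (jC - k) + h (\<gamma> k) (\<alpha> r)
            \<le> 6 * T + 3 * \<Delta>"
          using B1l JL CL jB kjC by linarith
        ultimately show ?thesis using walk B1(1,4) B2(1,4) B3(1,4)
          by (intro exI[of _ ?Bad] exI[of _ "h (\<alpha> l) (\<beta> l) + (jB - l) + h (\<beta> jB) (\<gamma> jC) + (jC - k) + h (\<gamma> k) (\<alpha> r)"])
            blast
      qed
      then obtain Bad N where Bad: "finite Bad" "card Bad \<le> 3 * \<Delta>"
         "\<And>u v. (u, v) \<in> Bad \<Longrightarrow> E u v \<and> 3 * \<Delta> \<le> h p u \<and> 3 * \<Delta> \<le> h p v"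
         "N \<le> 6 * T + 3 * \<Delta>" "(\<alpha> l, \<alpha> r) \<in> (?Good \<union> Bad) ^^ N" by blast
      have card: "card Bad < 2 * (3 * \<Delta>)" "0 < 3 * \<Delta>" using Bad(2) T0 by linarith+
      have "\<exists>q\<in>V \<inter> Side. S.h p q \<le> D"
      proof (rule detour[OF X(1,2) p(1) \<alpha> lr(1-3) Bad(1) card Bad(3) Bad(5)])
        fix c p q assume "circuit E c" "length c \<le> r - l + 1 + N" "p \<in> set c \<inter> V" "q \<in> set c \<inter> V"
        then show "S.h p q \<le> D" using D[of c p q] lr(4) Bad(4) by linarith
      qed
      then show ?thesis unfolding Side_def by blast
    qed
  qed
  then show ?thesis by blast
qed

text \<open>The Gromov products at \<open>x\<close> and at \<open>y\<close> add up to
  \<open>h x y\<close>, so \<open>triangle_half\<close> applies to \<open>p\<close> from one of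
  these two corners.\<close>

lemma triangle:
  "\<exists>K. \<forall>x\<in>X. \<forall>y\<in>X. \<forall>z\<in>X. \<forall>p\<in>V. btw x p y \<longrightarrow>
     (\<exists>p'\<in>V. (btw x p' z \<or> btw z p' y) \<and> S.h p p' \<le> K)"
proof -
  obtain K where K: "\<And>x y z p. \<lbrakk>x \<in> X; y \<in> X; z \<in> X; p \<in> V; btw x p y; 2 * h x p + h y z \<le> h x y + h x z\<rbrakk> \<Longrightarrow>
     \<exists>p'\<in>V. (btw x p' z \<or> btw z p' y) \<and> S.h p p' \<le> K" using triangle_half by blast
  have "\<exists>p'\<in>V. (btw x p' z \<or> btw z p' y) \<and> S.h p p' \<le> K"
    if X: "x \<in> X" "y \<in> X" "z \<in> X" and p: "p \<in> V" "btw x p y" for x y z p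
  proof (cases "2 * h x p + h y z \<le> h x y + h x z")
    case True
    then show ?thesis using K X p by blast
  next
    case False
    have "h x p + h p y = h x y" "p \<in> X" using p by (auto simp: btw_def)
    moreover from this have "h y p = h p y" "h y x = h x y" using d_sym X by blast+
    ultimately have "2 * h y p + h x z \<le> h y x + h y z" using False by linarith
    then obtain p' where "p' \<in> V" "btw y p' z \<or> btw z p' x" "S.h p p' \<le> K"
      using K[of y x z p] X p btw_sym[OF X(1,2) p(2)] by blast
    then show ?thesis using btw_sym[of y z p'] btw_sym[of z x p'] X by blast
  qed
  then show ?thesis by blast
qed

end

section \<open>The weighted metric\<close>

lemma glue_lists:
  assumes "successively P xs" "successively P ys" "xs \<noteq> []" "ys \<noteq> []" "last xs = hd ys"
  shows "successively P (xs @ tl ys)" "hd (xs @ tl ys) = hd xs" "last (xs @ tl ys) = last ys"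
    "set (xs @ tl ys) = set xs \<union> set ys" "length (xs @ tl ys) = length xs + length ys - 1"
    "xs @ tl ys \<noteq> []"
proof -
  obtain y zs where ys: "ys = y # zs" using assms(4) by (cases ys) auto
  have "y \<in> set xs" using assms ys last_in_set[of xs] by auto
  then show "set (xs @ tl ys) = set xs \<union> set ys" using ys by auto
  show "successively P (xs @ tl ys)" "hd (xs @ tl ys) = hd xs" "last (xs @ tl ys) = last ys"
    "length (xs @ tl ys) = length xs + length ys - 1" "xs @ tl ys \<noteq> []"
    using assms by (auto simp: ys successively_append_iff successively_Cons)
qed

lemma successively_slice:
  assumes "successively P xs" "i \<le> j" "j < length xs"
  shows "\<exists>ys. ys \<noteq> [] \<and> successively P ys \<and> hd ys = xs ! i \<and> last ys = xs ! j \<and> set ys \<subseteq> set xs \<and>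
     length ys = Suc (j - i)"
proof -
  let ?ys = "take (Suc (j - i)) (drop i xs)"
  have len: "length ?ys = Suc (j - i)" using assms by auto
  have "successively P ?ys"
    using assms(1) by (metis append_take_drop_id successively_append_iff)
  moreover have "hd ?ys = xs ! i" using len assms by (simp add: hd_conv_nth)
  moreover have "?ys \<noteq> []" using len by fastforce
  moreover have "last ?ys = xs ! j"
  proof -
    have "?ys ! (length ?ys - 1) = xs ! j" unfolding len using assms by simp
    then show ?thesis using last_conv_nth[OF \<open>?ys \<noteq> []\<close>] by simp
  qed
  moreover have "set ?ys \<subseteq> set xs" by (meson set_drop_subset set_take_subset subset_trans)
  ultimately show ?thesis using len by blast
qed

text \<open>The source of all comparisons between the word metric, the coned-off metric and the
  weighted metric.\<close>

lemma wreach_bound: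
  assumes "wreach E \<omega> u v k" "\<And>a b. E a b \<Longrightarrow> F a b \<and> \<omega>' a b \<le> m * \<omega> a b"
  shows "\<exists>k'. k' \<le> m * k \<and> wreach F \<omega>' u v k'"
  using assms(1)
proof (induction rule: wreach.induct)
  case (wreach_refl u)
  then show ?case using wreach.wreach_refl by fastforce
next
  case (wreach_step u v w k)
  then obtain k' where k': "k' \<le> m * k" "wreach F \<omega>' v w k'" by blast
  have "wreach F \<omega>' u w (\<omega>' u v + k')"
    using assms(2)[OF wreach_step.hyps(1)] k' by (intro wreach.wreach_step) auto
  moreover have "\<omega>' u v + k' \<le> m * (\<omega> u v + k)"
    using assms(2)[OF wreach_step.hyps(1)] k' by (simp add: distrib_left add_mono)
  ultimately show ?case by blast
qed

context relhyp_graph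
begin

definition thin_const :: "nat \<Rightarrow> bool" where
  "thin_const K \<longleftrightarrow> (\<forall>x\<in>X. \<forall>y\<in>X. \<forall>z\<in>X. \<forall>p\<in>V. btw x p y \<longrightarrow>
     (\<exists>p'\<in>V. (btw x p' z \<or> btw z p' y) \<and> S.h p p' \<le> K))"

lemma h_le_S: "a \<in> V \<Longrightarrow> b \<in> V \<Longrightarrow> h a b \<le> S.h a b"
  using wreach_bound[OF S.wreach_d[of a b], of E unit_weight 1] d_le by fastforce

text \<open>Thinness replaces \<open>p\<close>, at the cost \<open>K\<close>, by a group element in
  the interval of one half of the path. After \<open>k\<close> halvings at most one edge is left,
  and the interval of its ends contains nothing else. So the distance to a path is logarithmic in
  its length, here even in the word metric.\<close>

lemma bisect:
  assumes "thin_const K"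
  shows "\<lbrakk>successively E xs; set xs \<subseteq> X; xs \<noteq> []; length xs \<le> 2 ^ k + 1; p \<in> V; btw (hd xs) p (last xs)\<rbrakk>
    \<Longrightarrow> \<exists>q\<in>set xs \<inter> V. S.h p q \<le> K * k"
proof (induction k arbitrary: xs p)
  case 0
  have X: "hd xs \<in> X" "last xs \<in> X" "p \<in> X" using 0 V_sub by auto
  have "h (hd xs) (last xs) \<le> length xs - 1" using h_successively 0 by blast
  then have "h (hd xs) p = 0 \<or> h p (last xs) = 0" using 0 by (auto simp: btw_def)
  then have "p = hd xs \<or> p = last xs" using d_eq_0 X by blast
  then have "p \<in> set xs" using 0 by auto
  then show ?case using 0 by (intro bexI[of _ p]) auto
next
  case (Suc k)
  show ?case
  proof (cases "length xs \<le> 2 ^ k + 1")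
    case True
    then obtain q where "q \<in> set xs \<inter> V" "S.h p q \<le> K * k"
      using Suc.IH Suc.prems by blast
    then show ?thesis by (intro bexI[of _ q]) auto
  next
    case False
    let ?m = "2 ^ k"
    let ?ys = "take (Suc ?m) xs" and ?zs = "drop ?m xs"
    have len: "Suc ?m < length xs" using False by simp
    have ys: "successively E ?ys" "set ?ys \<subseteq> X" "?ys \<noteq> []" "length ?ys \<le> 2 ^ k + 1"
      using Suc.prems set_take_subset[of "Suc ?m" xs]
        successively_append_iff[of E ?ys "drop (Suc ?m) xs"] by auto
    have zs: "successively E ?zs" "set ?zs \<subseteq> X" "?zs \<noteq> []" "length ?zs \<le> 2 ^ k + 1"
      using Suc.prems set_drop_subset[of ?m xs] len
        successively_append_iff[of E "take ?m xs" ?zs] by auto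
    let ?z = "xs ! ?m"
    have ends: "hd ?ys = hd xs" "last ?ys = ?z" "hd ?zs = ?z" "last ?zs = last xs"
      using len Suc.prems(3)
      by (simp_all add: hd_drop_conv_nth last_conv_nth)
    have "?z \<in> X" "hd xs \<in> X" "last xs \<in> X"
      using Suc.prems len nth_mem[of ?m xs] hd_in_set[of xs] last_in_set[of xs] by auto
    then obtain p' where p': "p' \<in> V" "btw (hd xs) p' ?z \<or> btw ?z p' (last xs)" "S.h p p' \<le> K"
      using assms Suc.prems unfolding thin_const_def by blast
    from p'(2) obtain q where q: "q \<in> set xs \<inter> V" "S.h p' q \<le> K * k"
    proof
      assume "btw (hd xs) p' ?z"
      then obtain q where "q \<in> set ?ys \<inter> V" "S.h p' q \<le> K * k"
        using Suc.IH[OF ys p'(1)] ends by auto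
      then show ?thesis using that[of q] in_set_takeD[of q] by blast
    next
      assume "btw ?z p' (last xs)"
      then obtain q where "q \<in> set ?zs \<inter> V" "S.h p' q \<le> K * k"
        using Suc.IH[OF zs p'(1)] ends by auto
      then show ?thesis using that[of q] in_set_dropD[of q] by blast
    qed
    then have "S.h p q \<le> K * Suc k"
      using S.d_tri[of p p' q] p' Suc.prems by auto
    then show ?thesis using q by blast
  qed
qed

end

section \<open>Weights at cone points and the Morse property\<close>

definition cone_weight :: "'v set \<Rightarrow> nat \<Rightarrow> 'v \<Rightarrow> 'v \<Rightarrow> nat" where
  "cone_weight V \<tau> u v = (if u \<in> V \<and> v \<in> V then 1 else \<tau>)"

text \<open>The condition on \<open>M\<close> is what lets the Morse argument close: for
  \<open>D > M\<close> the detour constructed there has at most \<open>2 ^ k\<close> edges, and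
  \<open>bisect\<close> then finds a point of it closer than \<open>D\<close>.\<close>

locale relhyp_weighted = relhyp_graph +
  fixes \<tau> K M :: nat
  assumes thin_const: "thin_const K" and \<tau>_pos: "1 \<le> \<tau>"
    and M: "M < D \<Longrightarrow> \<exists>k. 2 * D + \<tau> * (6 * D + 6) \<le> 2 ^ k \<and> K * k < D"
begin

sublocale W: wgraph X E "cone_weight V \<tau>"
proof
  fix u v assume "u \<in> X" "v \<in> X"
  then show "\<exists>k. wreach E (cone_weight V \<tau>) u v k"
    using wreach_bound[OF wreach_d[of u v], of E "cone_weight V \<tau>" \<tau>] \<tau>_pos
    by (fastforce simp: cone_weight_def unit_weight_def)
qed (use E_sym E_in \<tau>_pos in \<open>auto simp: cone_weight_def\<close>)

lemma W_le_h: "a \<in> X \<Longrightarrow> b \<in> X \<Longrightarrow> W.d a b \<le> \<tau> * h a b"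
  using wreach_bound[OF wreach_d[of a b], of E "cone_weight V \<tau>" \<tau>] \<tau>_pos W.d_le[of a b]
  by (fastforce simp: cone_weight_def unit_weight_def)

lemma h_le_W: "a \<in> X \<Longrightarrow> b \<in> X \<Longrightarrow> h a b \<le> W.d a b"
  using wreach_bound[OF W.wreach_d[of a b], of E unit_weight 1] \<tau>_pos d_le[of a b]
  by (fastforce simp: cone_weight_def unit_weight_def)

lemma W_le_S: "a \<in> V \<Longrightarrow> b \<in> V \<Longrightarrow> W.d a b \<le> S.h a b"
  using wreach_bound[OF S.wreach_d[of a b], of E "cone_weight V \<tau>" 1] W.d_le[of a b]
  by (fastforce simp: cone_weight_def unit_weight_def)

text \<open>The Morse property: the length of a \<open>W.d\<close>-geodesic between two of its points is at most
  \<open>\<tau>\<close> times their \<open>h\<close>-distance, whereas a detour at distance \<open>D\<close> has length exponential in \<open>D\<close>.\<close>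

lemma morse:
  assumes X: "x \<in> X" "y \<in> X" and p0: "p \<in> V" "btw x p y"
  shows "\<exists>q\<in>V. W.d x q + W.d q y = W.d x y \<and> S.h p q \<le> M"
proof -
  obtain bs where bs: "bs \<noteq> []" "successively E bs" "hd bs = x" "last bs = y" "set bs \<subseteq> X"
     "\<forall>q. q \<in> set bs \<longrightarrow> W.d x q + W.d q y = W.d x y"
     "\<forall>i j. i \<le> j \<longrightarrow> j < length bs \<longrightarrow> j - i \<le> W.d (bs ! i) (bs ! j)"
    using W.geodesic_list_sep[OF X] by blast
  let ?B = "set bs \<inter> V"
  let ?good = "\<lambda>D. \<forall>p\<in>V. btw x p y \<longrightarrow> (\<exists>q\<in>?B. S.h p q \<le> D)"
  \<comment> \<open>A crude bound, used only to know that some \<open>D\<close> exists.\<close>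
  have "\<exists>q\<in>?B. S.h p q \<le> K * length bs" if "p \<in> V" "btw x p y" for p
    using bisect[OF thin_const bs(2,5,1), of "length bs" p] that bs(3,4) less_exp[of "length bs"] by simp
  then have ex: "\<exists>D. ?good D" by blast
  \<comment> \<open>By minimality, if \<open>D\<close> is positive, some group element of the
    interval has word distance at least \<open>D\<close> from every group element of the weighted
    geodesic.\<close>
  define D where "D = (LEAST D. ?good D)"
  have good: "?good D" unfolding D_def using LeastI_ex[OF ex] .
  have "D \<le> M"
  proof (rule ccontr)
    assume "\<not> D \<le> M"
    then obtain k where k: "2 * D + \<tau> * (6 * D + 6) \<le> 2 ^ k" "K * k < D" using M[of D] by auto
    have "\<not> ?good (D - 1)" unfolding D_def
      by (rule not_less_Least) (use k D_def in auto)
    then obtain p where p: "p \<in> V" "btw x p y" "\<And>q. q \<in> ?B \<Longrightarrow> \<not> S.h p q \<le> D - 1" by blast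
    then have p: "p \<in> V" "btw x p y" "\<And>q. q \<in> ?B \<Longrightarrow> D \<le> S.h p q"
      using k(2) by (blast, blast, fastforce)
    have pX: "p \<in> X" using p V_sub by auto
    \<comment> \<open>A path from a vertex \<open>z\<close> between \<open>e\<close> and
      \<open>p\<close>, about \<open>2 * D\<close> away from \<open>p\<close>, to the weighted
      geodesic: a word path of length at most \<open>D\<close>, hence far from \<open>p\<close>. The
      two values \<open>2 * D + 2\<close> and \<open>2 * D + 3\<close> arise because only one of two
      consecutive vertices need be a group element. If \<open>e\<close> itself is this close to
      \<open>p\<close>, the path is the single vertex \<open>e\<close>.\<close>
    have left: "\<exists>zs. zs \<noteq> [] \<and> successively E zs \<and> set zs \<subseteq> X \<and> length zs \<le> D + 1 \<and>
        btw e (hd zs) p \<and> h (hd zs) p \<le> 2 * D + 3 \<and> last zs \<in> set bs \<and>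
        (\<forall>q\<in>set zs \<inter> V. D \<le> S.h p q)"
      if e: "e \<in> X" "e \<in> set bs" "\<And>q. btw e q p \<Longrightarrow> btw x q y" for e
    proof (cases "h e p \<le> 2 * D + 2")
      case True
      then show ?thesis using e p(3) by (intro exI[of _ "[e]"]) (auto simp: btw_def)
    next
      case False
      obtain \<gamma> where \<gamma>: "geod e p \<gamma>" using geod_ex e pX by blast
      define t where "t = h e p - (2 * D + 3)"
      have t: "t < h e p" "t \<le> h e p" "Suc t \<le> h e p" "h e p - t = 2 * D + 3" "h e p - Suc t = 2 * D + 2"
        using False by (auto simp: t_def)
      have "E (\<gamma> t) (\<gamma> (Suc t))" "h (\<gamma> t) p = 2 * D + 3" "h (\<gamma> (Suc t)) p = 2 * D + 2"
        using \<gamma> t unfolding geod_def by metis+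
      moreover have "btw e (\<gamma> t) p" "btw e (\<gamma> (Suc t)) p" using geod_btw[OF \<gamma>] t by blast+
      ultimately obtain z where z: "z \<in> V" "btw e z p" "2 * D + 2 \<le> h z p" "h z p \<le> 2 * D + 3"
        using edge_V[of "\<gamma> t" "\<gamma> (Suc t)"] by (metis add_le_cancel_left le_refl numeral_le_iff semiring_norm(69,71,72))
      then obtain z' where z': "z' \<in> ?B" "S.h z z' \<le> D" using good e by blast
      then have "z' \<in> V" by simp
      obtain zs where zs: "zs \<noteq> []" "successively (\<lambda>u v. E u v \<and> u \<in> V \<and> v \<in> V) zs"
        "hd zs = z" "last zs = z'" "set zs \<subseteq> V"
        "\<forall>q. q \<in> set zs \<longrightarrow> S.h z q + S.h q z' = S.h z z'"
        "\<forall>i j. i \<le> j \<longrightarrow> j < length zs \<longrightarrow> j - i \<le> S.h (zs ! i) (zs ! j)"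
        using S.geodesic_list_sep[OF z(1) \<open>z' \<in> V\<close>] by blast
      have "length zs - 1 \<le> D"
        using zs(7)[rule_format, of 0 "length zs - 1"] zs(1,3,4) z'(2) by (simp add: hd_conv_nth last_conv_nth)
      then have len: "length zs \<le> D + 1" by linarith
      have far: "D \<le> S.h p q" if "q \<in> set zs \<inter> V" for q
      proof -
        have q: "q \<in> V" "S.h z q \<le> D" using that zs(6) z'(2) by fastforce+
        have "h z p \<le> S.h z p" using h_le_S z p by blast
        moreover have "S.h z p \<le> S.h z q + S.h q p" using S.d_tri z p q by blast
        moreover have "S.h q p = S.h p q" using S.d_sym q p by blast
        ultimately show ?thesis using q z(3) by linarith
      qed
      have "successively E zs" using zs(2) by (rule successively_mono) simp
      then show ?thesis using zs z z' len far V_sub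
        by (intro exI[of _ zs] conjI ballI) auto
    qed
    have "x \<in> set bs" "y \<in> set bs" using bs by auto
    moreover have "btw x q y" if "btw x q p" for q using btw_trans'(1) X p that by blast
    moreover have "btw x q y" if "btw y q p" for q
      using btw_trans(1)[OF X p(2)] btw_sym[OF X(2) pX that] by blast
    ultimately obtain zs ws where
      zs: "zs \<noteq> []" "successively E zs" "set zs \<subseteq> X" "length zs \<le> D + 1" "btw x (hd zs) p"
        "h (hd zs) p \<le> 2 * D + 3" "last zs \<in> set bs" "\<forall>q\<in>set zs \<inter> V. D \<le> S.h p q" and
      ws: "ws \<noteq> []" "successively E ws" "set ws \<subseteq> X" "length ws \<le> D + 1" "btw y (hd ws) p"
        "h (hd ws) p \<le> 2 * D + 3" "last ws \<in> set bs" "\<forall>q\<in>set ws \<inter> V. D \<le> S.h p q"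
      using left[of x] left[of y] X by blast
    have memX: "hd zs \<in> X" "last zs \<in> X" "hd ws \<in> X" "last ws \<in> X"
      using zs(1,3) ws(1,3) by auto
    have "\<exists>ms. ms \<noteq> [] \<and> successively E ms \<and> hd ms = last zs \<and> last ms = last ws \<and> set ms \<subseteq> set bs \<and>
       length ms \<le> Suc (W.d (last zs) (last ws))"
    proof -
      obtain i j where ij: "i < length bs" "bs ! i = last zs" "j < length bs" "bs ! j = last ws"
        using zs(7) ws(7) by (metis in_set_conv_nth)
      show ?thesis
      proof (cases "i \<le> j")
        case True
        obtain ms where "ms \<noteq> []" "successively E ms" "hd ms = bs ! i" "last ms = bs ! j"
          "set ms \<subseteq> set bs" "length ms = Suc (j - i)"
          using successively_slice[OF bs(2) True ij(3)] by blast
        then show ?thesis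
          using bs(7)[rule_format, OF True ij(3)] ij by (intro exI[of _ ms]) simp
      next
        case False
        then have ji: "j \<le> i" by simp
        obtain ms where ms: "ms \<noteq> []" "successively E ms" "hd ms = bs ! j" "last ms = bs ! i"
          "set ms \<subseteq> set bs" "length ms = Suc (i - j)"
          using successively_slice[OF bs(2) ji ij(1)] by blast
        have "i - j \<le> W.d (last zs) (last ws)"
          using bs(7)[rule_format, OF ji ij(1)] W.d_sym memX ij by metis
        moreover have "successively E (rev ms)" using ms(2) E_sym
          by (auto intro: successively_mono)
        ultimately show ?thesis using ms ij
          by (intro exI[of _ "rev ms"]) (auto simp: hd_rev last_rev)
      qed
    qed
    then obtain ms where ms: "ms \<noteq> []" "successively E ms" "hd ms = last zs" "last ms = last ws"
       "set ms \<subseteq> set bs" "length ms \<le> Suc (W.d (last zs) (last ws))" by blast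
    have rw: "successively E (rev ws)" using ws(2) E_sym by (auto intro: successively_mono)
    note g1 = glue_lists[OF zs(2) ms(2) zs(1) ms(1) ms(3)[symmetric]]
    let ?l = "zs @ tl ms"
    have "last ?l = hd (rev ws)" using g1(3) ms(4) ws(1) by (simp add: hd_rev)
    note g2 = glue_lists[OF g1(1) rw g1(6) _ this]
    let ?f = "?l @ tl (rev ws)"
    have f: "successively E ?f" "hd ?f = hd zs" "last ?f = hd ws"
      "set ?f = set zs \<union> set ms \<union> set ws" "length ?f = length zs + length ms - 1 + length ws - 1" "?f \<noteq> []"
      using g2 g1 ws(1) by (auto simp: last_rev)
    have "btw (hd zs) p y" using btw_trans'(2) X p zs(5) by blast
    moreover have "btw p (hd ws) y" using btw_sym X pX ws(5) by blast
    ultimately have btw: "btw (hd zs) p (hd ws)" using btw_trans(2) memX X by blast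
    have "h (last zs) (hd zs) \<le> D" "h (hd ws) (last ws) \<le> D"
      using h_successively[OF zs(2,1,3)] h_successively[OF ws(2,1,3)] zs(4) ws(4) d_sym[OF memX(1,2)] by auto
    moreover have "h (hd zs) (hd ws) \<le> 4 * D + 6"
      using d_tri[OF memX(1) pX memX(3)] zs(6) ws(6) d_sym[OF pX memX(3)] by linarith
    ultimately have "h (last zs) (last ws) \<le> 6 * D + 6"
      using d_tri[OF memX(2,1,4)] d_tri[OF memX(1,3,4)] by linarith
    then have "W.d (last zs) (last ws) \<le> \<tau> * (6 * D + 6)"
      using W_le_h[OF memX(2,4)] by (meson le_trans mult_le_mono2)
    \<comment> \<open>At most \<open>D + 1\<close> vertices at each end and
      \<open>\<tau> * (6 * D + 6) + 1\<close> in the middle, the two junctions being counted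
      twice.\<close>
    then have "length ?f \<le> 2 ^ k + 1" using f(5) zs(4) ws(4) ms(6) k(1) by linarith
    moreover have "set ?f \<subseteq> X" using f(4) zs(3) ws(3) ms(5) bs(5) by blast
    ultimately obtain q where q: "q \<in> set ?f \<inter> V" "S.h p q \<le> K * k"
      using bisect[OF thin_const f(1) _ f(6) _ p(1)] btw unfolding f(2,3) by blast
    then have "D \<le> S.h p q" using f(4) zs(8) ws(8) ms(5) p(3) by blast
    then show False using q k by linarith
  qed
  then show ?thesis using good p0 bs(6) by fastforce
qed

text \<open>Thinness brings \<open>p\<close> within \<open>K\<close> of one of the other two sides,
  and the Morse property within a further \<open>M\<close> of a weighted geodesic there. The error
  \<open>K + M\<close> is paid once for each of the two legs at \<open>p\<close>.\<close>

lemma four_point_W: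
  assumes X: "u \<in> X" "c \<in> X" "x \<in> X" and p: "p \<in> V" "btw u p c"
  shows "W.d u p + W.d p x \<le> W.d u x + 2 * (K + M) \<or> W.d c p + W.d p x \<le> W.d c x + 2 * (K + M)"
proof -
  obtain p' where p': "p' \<in> V" "btw u p' x \<or> btw x p' c" "S.h p p' \<le> K"
    using thin_const X p unfolding thin_const_def by blast
  have main: "W.d e p + W.d p x \<le> W.d e x + 2 * (K + M)" if e: "e \<in> X" "btw e p' x" for e
  proof -
    obtain q where q: "q \<in> V" "W.d e q + W.d q x = W.d e x" "S.h p' q \<le> M"
      using morse[OF e(1) X(3) p'(1) e(2)] by blast
    have V: "p \<in> X" "q \<in> X" using p q V_sub by auto
    have "W.d p q \<le> K + M" using W_le_S[OF p(1) q(1)] S.d_tri[OF p(1) p'(1) q(1)] p' q by linarith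
    moreover have "W.d e p \<le> W.d e q + W.d p q"
      using W.d_tri[OF e(1) V(2,1)] W.d_sym V by simp
    moreover have "W.d p x \<le> W.d p q + W.d q x" using W.d_tri V X by blast
    ultimately have "W.d e p + W.d p x \<le> (W.d e q + W.d q x) + 2 * W.d p q" by linarith
    also have "\<dots> \<le> W.d e x + 2 * (K + M)" using q(2) \<open>W.d p q \<le> K + M\<close> by simp
    finally show ?thesis .
  qed
  from p'(2) show ?thesis
  proof
    assume "btw u p' x" then show ?thesis using main X by blast
  next
    assume "btw x p' c" then have "btw c p' x" using btw_sym X by blast
    then show ?thesis using main X by blast
  qed
qed

section \<open>Heights and the push towards a vertex\<close>

definition ht :: "'a \<Rightarrow> nat" where
  "ht u = (if u \<in> V then 0 else \<tau>)"

lemma W_edge_cone: "E u v \<Longrightarrow> u \<notin> V \<Longrightarrow> v \<in> V \<and> cone_weight V \<tau> u v = \<tau>"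
  using edge_V[of u v] by (auto simp: cone_weight_def)

text \<open>The edge by which a weighted geodesic leaves a cone point costs \<tau>, and every
  further edge costs at least 1.\<close>

lemma W_ge_ht:
  assumes "u \<in> X" "v \<in> X" "u \<noteq> v"
  shows "ht u + h u v \<le> W.d u v + 1" "ht u \<le> W.d u v"
proof -
  have "ht u + h u v \<le> W.d u v + 1 \<and> ht u \<le> W.d u v"
  proof (cases "u \<in> V")
    case True
    then show ?thesis using h_le_W[of u v] assms by (simp add: ht_def)
  next
    case False
    from W.d_step[OF assms] obtain a where a: "E u a" "a \<in> X" "W.d u v = cone_weight V \<tau> u a + W.d a v"
      by blast
    have "h u v \<le> 1 + h a v" using d_tri[OF assms(1) a(2) assms(2)] h_edge[OF a(1)] by linarith
    then show ?thesis using h_le_W[OF a(2) assms(2)] a(3) W_edge_cone[OF a(1) False] False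
      by (simp add: ht_def)
  qed
  then show "ht u + h u v \<le> W.d u v + 1" "ht u \<le> W.d u v" by auto
qed

text \<open>With \<open>s u v = W.d u v - ht u - ht v\<close>, a point \<open>u\<close> with \<open>s u c > n\<close> is pushed towards \<open>c\<close>
  along a geodesic: either a bounded distance, or, if the geodesic makes a long jump at a cone
  point \<open>w\<close> before, to \<open>w\<close>.\<close>

lemma push:
  fixes n :: nat
  defines "C \<equiv> 2 * (K + M)"
  assumes n: "(C + 1) * (C + 3) + 6 * C \<le> n"
    and X: "u \<in> X" "c \<in> X" and far: "n + ht u + ht c < W.d u c"
  shows "\<exists>p\<in>X. p \<noteq> u \<and> W.d u p \<le> n + ht u + ht p \<and>
    (\<forall>x\<in>X. x \<noteq> p \<longrightarrow> W.d c x + ht u \<le> W.d c u + ht x \<longrightarrow>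
       W.d p x \<le> n + ht p + ht x \<or> W.d p x + ht u < W.d u x + ht p)"
proof -
  \<comment> \<open>\<open>L\<close> is the speed at which the weighted distance may grow along the
    interval. After \<open>m\<close> steps the weighted distance from \<open>u\<close> exceeds
    \<open>ht u + C\<close>, which outweighs the error in \<open>four_point_W\<close>. The bound on
    \<open>n\<close> contains \<open>L * (m + 1)\<close> in the form
    \<open>(C + 1) * (C + 3)\<close>.\<close>
  define L where "L = C + 1"
  define m where "m = C + 2"
  have n': "L * (m + 1) + 6 * C \<le> n" using n by (simp add: L_def m_def algebra_simps)
  have Lm: "L * m + L + 6 * C \<le> n" using n' by (simp add: algebra_simps)
  have four: "W.d e p + W.d p x \<le> W.d e x + C \<or> W.d f p + W.d p x \<le> W.d f x + C"
    if "e \<in> X" "f \<in> X" "x \<in> X" "p \<in> V" "btw e p f" for e f x p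
    using four_point_W[OF that] by (simp add: C_def)
  have uc: "u \<noteq> c" using far by auto
  \<comment> \<open>Group elements of the interval reached at speed at most \<open>L\<close>. The
    bound \<open>m + 1\<close> leaves room for two more steps beyond a \<open>v\<close> with
    \<open>h u v < m\<close>.\<close>
  let ?Q = "\<lambda>v. v \<in> V \<and> btw u v c \<and> h u v \<le> m + 1 \<and> W.d u v \<le> ht u + L * h u v"
  have ex: "\<exists>v. ?Q v"
  proof (cases "u \<in> V")
    case True
    then show ?thesis using X by (intro exI[of _ u]) (auto simp: btw_def)
  next
    case False
    obtain a where a: "E u a" "a \<in> X" "h u c = 1 + h a c" using h_step[OF X uc] .
    have "a \<in> V" "W.d u a \<le> \<tau>" using W_edge_cone[OF a(1) False] W.d_edge[OF a(1)] by auto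
    moreover have "h u a = 1" using geo_edge[OF a(1)] False \<open>a \<in> V\<close> by auto
    ultimately show ?thesis using a False by (intro exI[of _ a]) (auto simp: btw_def ht_def m_def)
  qed
  from ex obtain v0 where "?Q v0" by blast
  then have "\<exists>v. ?Q v \<and> (\<forall>v'. ?Q v' \<longrightarrow> h u v' \<le> h u v)"
    by (rule ex_has_greatest_nat[where b = "m + 2"]) simp
  then obtain v where v: "v \<in> V" "btw u v c" "h u v \<le> m + 1" "W.d u v \<le> ht u + L * h u v"
    and vmax: "\<And>v'. ?Q v' \<Longrightarrow> h u v' \<le> h u v" by blast
  have vX: "v \<in> X" using v V_sub by auto
  have Wsym: "\<And>a b. a \<in> X \<Longrightarrow> b \<in> X \<Longrightarrow> W.d a b = W.d b a" using W.d_sym by blast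
  have htv: "ht v = 0" using v by (simp add: ht_def)
  have "L * h u v \<le> L * (m + 1)" using v(3) by (rule mult_le_mono2)
  then have duv: "W.d u v + C \<le> ht u + n" using v(4) n' by linarith
  show ?thesis
  proof (cases "m \<le> h u v")
    \<comment> \<open>No long jump, so \<open>v\<close> itself is the new position. If the way from
      \<open>u\<close> to \<open>x\<close> passes close to \<open>v\<close>, the distance to
      \<open>x\<close> drops by more than the error. If the way from \<open>c\<close> to
      \<open>x\<close> does, \<open>v\<close> and \<open>x\<close> are adjacent, because
      \<open>x\<close> is no further from \<open>c\<close> than \<open>u\<close> up to
      heights.\<close>
    case True
    have "u \<noteq> v" using True by (auto simp: m_def)
    have close: "W.d u v \<le> n + ht u + ht v" using duv by linarith
    have gt: "ht u + C < W.d u v"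
      using W_ge_ht(1)[OF X(1) vX \<open>u \<noteq> v\<close>] True by (simp add: m_def)
    have "W.d v x \<le> n + ht v + ht x \<or> W.d v x + ht u < W.d u x + ht v"
      if x: "x \<in> X" "W.d c x + ht u \<le> W.d c u + ht x" for x
    proof -
      have "W.d c u \<le> W.d c v + W.d u v" using W.d_tri[OF X(2) vX X(1)] Wsym vX X by simp
      then show ?thesis using four[OF X x(1) v(1,2)] gt duv x(2) htv by linarith
    qed
    then show ?thesis using close \<open>u \<noteq> v\<close> vX by (intro bexI[of _ v]) auto
  next
    case False
    have huv: "h u v + h v c = h u c" using v by (simp add: btw_def)
    have vc: "v \<noteq> c"
    proof
      assume "v = c"
      then show False using far duv by simp
    qed
    obtain g where g: "E v g" "g \<in> X" "h v c = 1 + h g c" using h_step[OF vX X(2) vc] .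
    have "v \<noteq> g" using g by auto
    then have hvg: "h v g = 1" using geo_edge[OF g(1)] by simp
    have "btw v g c" using g hvg by (simp add: btw_def)
    then have ug: "btw u g c" "btw u v g" using btw_trans[OF X v(2)] by auto
    then have hug: "h u g = h u v + 1" using hvg by (simp add: btw_def)
    \<comment> \<open>An edge between group elements has weight 1 and would extend \<open>v\<close>
      to \<open>g\<close>, against maximality.\<close>
    have gV: "g \<notin> V"
    proof
      assume "g \<in> V"
      then have "W.d v g \<le> 1" using W.d_edge[OF g(1)] v by (simp add: cone_weight_def)
      then have "W.d u g \<le> ht u + L * h u g"
        using W.d_tri[OF X(1) vX g(2)] v(4) hug by (simp add: L_def)
      then show False using vmax[of g] \<open>g \<in> V\<close> ug hug False by simp
    qed
    have htg: "ht g = \<tau>" using gV by (simp add: ht_def)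
    have dvg: "W.d v g \<le> \<tau>" using W.d_edge[OF g(1)] gV by (simp add: cone_weight_def)
    have gc: "g \<noteq> c"
    proof
      assume "g = c"
      then have "n + ht u + ht g < W.d u g" using far by simp
      then show False using duv htg dvg W.d_tri[OF X(1) vX g(2)] by linarith
    qed
    obtain v' where v': "E g v'" "v' \<in> X" "h g c = 1 + h v' c" using h_step[OF g(2) X(2) gc] .
    have v'V: "v' \<in> V" using W_edge_cone[OF v'(1) gV] by simp
    then have "v' \<noteq> g" using gV by auto
    then have hgv': "h g v' = 1" using geo_edge[OF v'(1)] by simp
    have "btw g v' c" using v' hgv' by (simp add: btw_def)
    then have uv': "btw u v' c" "btw u g v'" using btw_trans[OF X ug(1)] by auto
    then have huv': "h u v' = h u v + 2" using hgv' hug by (simp add: btw_def)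
    have uvv': "btw u v v'"
      using btw_trans'(1)[OF X(1) v'(2) uv'(2) ug(2)] .
    \<comment> \<open>The jump at the cone point \<open>g\<close> exceeds the allowance
      \<open>2 * L\<close> for two steps, since otherwise \<open>v'\<close> would contradict the
      maximality of \<open>v\<close>.\<close>
    define j where "j = W.d v v'"
    have jump: "2 * L < j"
    proof (rule ccontr)
      assume "\<not> 2 * L < j"
      then have "W.d u v' \<le> ht u + L * h u v'"
        using W.d_tri[OF X(1) vX v'(2)] v(4) huv' by (simp add: j_def algebra_simps)
      then show False using vmax[of v'] v'V uv' huv' False by simp
    qed
    have duv': "W.d u v + j \<le> W.d u v' + C"
      using four[OF X(1) v'(2) v'(2) v(1) uvv'] Wsym[OF vX v'(2)] jump by (auto simp: j_def L_def)
    have ug_ne: "u \<noteq> g" using hug by auto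
    have close: "W.d u g \<le> n + ht u + ht g"
      using W.d_tri[OF X(1) vX g(2)] dvg duv htg by linarith
    have htu: "ht u \<le> W.d u v"
    proof (cases "u = v")
      case True then show ?thesis using v by (simp add: ht_def)
    next
      case False then show ?thesis using W_ge_ht(2)[OF X(1) vX] by blast
    qed
    have dgv': "W.d g v' \<le> \<tau>" using W.d_edge[OF v'(1)] gV by (simp add: cone_weight_def)
    have dgv: "W.d g v \<le> \<tau>" using dvg Wsym vX g(2) by simp
    have "W.d g x \<le> n + ht g + ht x \<or> W.d g x + ht u < W.d u x + ht g"
      if x: "x \<in> X" "x \<noteq> g" "W.d c x + ht u \<le> W.d c u + ht x" for x
    proof -
      have cu: "W.d c u \<le> W.d c v + W.d u v" using W.d_tri[OF X(2) vX X(1)] Wsym vX X by simp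
      have cv: "W.d c v \<le> W.d c v' + j"
        using W.d_tri[OF X(2) v'(2) vX] Wsym vX v'(2) by (simp add: j_def)
      have gx: "W.d g x \<le> \<tau> + W.d a x" if "a \<in> V" "W.d g a \<le> \<tau>" for a
        using W.d_tri[of g a x] that g(2) x(1) V_sub by fastforce
      \<comment> \<open>\<open>b\<close> is the exit from \<open>g\<close> towards \<open>x\<close>.
        Its position relative to the points \<open>v\<close> and \<open>v'\<close> decides the case
        that \<open>four_point_W\<close> at these two points leaves open.\<close>
      obtain b where b: "E g b" "b \<in> X" "h g x = 1 + h b x"
        using h_step[OF g(2) x(1)] x(2) by metis
      have bV: "b \<in> V" using W_edge_cone[OF b(1) gV] by simp
      then have "b \<noteq> g" using gV by auto
      then have "h g b = 1" using geo_edge[OF b(1)] by simp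
      then have btwb: "btw g b x" using b by (simp add: btw_def)
      have dgb: "W.d g b \<le> \<tau>" using W.d_edge[OF b(1)] gV by (simp add: cone_weight_def)
      have via_b: "W.d a b + W.d b x \<le> W.d a x + 2 * C" if a: "a \<in> V" "W.d g a \<le> \<tau>" for a
      proof -
        have aX: "a \<in> X" using a V_sub by auto
        have "\<tau> \<le> W.d g b" using W_ge_ht(2)[OF g(2) b(2)] \<open>b \<noteq> g\<close> htg by simp
        then show ?thesis
          using four[OF g(2) x(1) aX bV btwb] a(2) Wsym[OF aX b(2)] W.d_tri[OF b(2) aX x(1)]
            Wsym[OF x(1) aX] Wsym[OF x(1) b(2)] by linarith
      qed
      show ?thesis
      proof (cases "W.d u v' + W.d v' x \<le> W.d u x + C")
        case True
        then show ?thesis using gx[OF v'V dgv'] duv' jump htu htg by (simp add: L_def)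
      next
        case notu: False
        then have cx: "W.d c v' + W.d v' x \<le> W.d c x + C"
          using four[OF X x(1) v'V uv'(1)] by blast
        show ?thesis
        proof (cases "W.d c v + W.d v x \<le> W.d c x + C")
          case True
          then show ?thesis using gx[OF v(1) dgv] cu x(3) duv htg by linarith
        next
          case False
          then have ux: "W.d u v + W.d v x \<le> W.d u x + C"
            using four[OF X x(1) v(1,2)] by blast
          have vb: "W.d v b + W.d b x \<le> W.d v x + 2 * C" "W.d v' b + W.d b x \<le> W.d v' x + 2 * C"
            using via_b v(1) v'V dgv dgv' by blast+
          \<comment> \<open>If \<open>b\<close> is far from \<open>v\<close>, moving from
            \<open>u\<close> to \<open>g\<close> saves more than all errors. If it is close to
            \<open>v\<close>, then up to an error it is \<open>j\<close> away from
            \<open>v'\<close>, which cancels the jump in the estimate from \<open>c\<close>; the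
            errors then amount to \<open>6 * C\<close>, whence this summand in the bound on
            \<open>n\<close>.\<close>
          show ?thesis
          proof (cases "3 * C < W.d v b")
            case True
            then show ?thesis using gx[OF bV dgb] ux vb htu htg by linarith
          next
            case False
            have "j \<le> W.d v b + W.d v' b"
              using W.d_tri[OF vX b(2) v'(2)] Wsym[OF b(2) v'(2)] by (simp add: j_def)
            moreover have "L * h u v \<le> L * m" using \<open>\<not> m \<le> h u v\<close> by (intro mult_le_mono2) simp
            ultimately show ?thesis
              using False gx[OF bV dgb] vb cx cu cv x(3) v(4) Lm htg by linarith
          qed
        qed
      qed
    qed
    then show ?thesis using close ug_ne g(2) by (intro bexI[of _ g]) auto
  qed
qed

end

section \<open>Exits from cone points, and adjacency in the weighted metric\<close>

lemma relpow_converse: "(a :: 'a, b :: 'a) \<in> R ^^ n \<Longrightarrow> (b, a) \<in> (R\<inverse>) ^^ n"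
proof (induction n arbitrary: b)
  case (Suc n)
  from Suc.prems obtain c where "(a, c) \<in> R ^^ n" "(c, b) \<in> R" by (rule relpow_Suc_E)
  then show ?case using Suc.IH by (intro relpow_Suc_I2[of b c]) auto
qed simp

context relhyp_graph
begin

definition near :: "'v \<Rightarrow> 'v set" where
  "near u = (if u \<in> V then {u} else {a. E u a})"

lemma near_sub: "u \<in> X \<Longrightarrow> near u \<subseteq> V"
  using edge_V by (auto simp: near_def)

text \<open>Geodesics from the two exits to \<open>b\<close> consist of vertices nearer to
  \<open>b\<close> than \<open>w\<close>, so they avoid \<open>w\<close> and complete the path from
  \<open>v\<close> through \<open>w\<close> to \<open>v'\<close> to a circuit of length bounded in
  \<open>m\<close>. That the bound depends on \<open>m\<close> is harmless: it is applied to a fixed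
  pair of vertices.\<close>

lemma exits_close:
  "\<exists>D. \<forall>w\<in>X - V. \<forall>b\<in>X. \<forall>v v'. w \<noteq> b \<longrightarrow> h w b = m \<longrightarrow> E w v \<longrightarrow> E w v' \<longrightarrow>
     Suc (h v b) = m \<longrightarrow> Suc (h v' b) = m \<longrightarrow> S.h v v' \<le> D"
proof -
  obtain D where D: "\<And>c p q. circuit E c \<Longrightarrow> length c \<le> 3 + (m + m) \<Longrightarrow> p \<in> set c \<inter> V \<Longrightarrow>
       q \<in> set c \<inter> V \<Longrightarrow> S.h p q \<le> D"
    using circuits_bounded[of "3 + (m + m)"] by blast
  have "S.h v v' \<le> D"
    if w: "w \<in> X" "w \<notin> V" "b \<in> X" "w \<noteq> b" "h w b = m" "E w v" "E w v'" "Suc (h v b) = m" "Suc (h v' b) = m"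
    for w b v v'
  proof (cases "v = v'")
    case False
    let ?R = "{(a, c). E a c \<and> a \<noteq> w \<and> c \<noteq> w}"
    have V: "v \<in> V" "v' \<in> V" "v \<in> X" "v' \<in> X" using w edge_V E_in2 by blast+
    have walk: "(a, b) \<in> ?R ^^ (m - 1) \<and> (b, a) \<in> ?R ^^ (m - 1)" if a: "a \<in> X" "Suc (h a b) = m" for a
    proof -
      obtain B where B: "(a, b) \<in> B ^^ h a b" "\<forall>u v. (u, v) \<in> B \<longrightarrow> E u v \<and> h a u \<le> h a b \<and>
          h a v \<le> h a b \<and> h u b \<le> h a b \<and> h v b \<le> h a b"
        using geod_rel[OF a(1) w(3)] by metis
      have ne: "c \<noteq> w" if "h c b \<le> h a b" for c using that a w by auto
      have "B \<subseteq> ?R" using B(2) ne by auto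
      moreover from this have "B\<inverse> \<subseteq> ?R" using E_sym by auto
      moreover have "(b, a) \<in> (B\<inverse>) ^^ h a b" using B(1) by (rule relpow_converse)
      moreover have "h a b = m - 1" using a by simp
      ultimately have B': "B \<subseteq> ?R" "(a, b) \<in> B ^^ (m - 1)" "B\<inverse> \<subseteq> ?R" "(b, a) \<in> (B\<inverse>) ^^ (m - 1)"
        using B(1) by simp_all
      show ?thesis by (intro conjI relpow_sub[OF B'(1,2)] relpow_sub[OF B'(3,4)])
    qed
    have vv: "(v, v') \<in> ?R ^^ ((m - 1) + (m - 1))"
      by (rule relpow_trans[of v b]) (use walk[of v] walk[of v'] V w in auto)
    have A: "successively E ([v] @ w # [v'])" "distinct ([v] @ w # [v'])"
      using w E_sym V False by (auto simp: successively_Cons)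
    have R: "E a c \<and> a \<noteq> w \<and> c \<noteq> w" if "(a, c) \<in> ?R" for a c using that by simp
    have mem: "v \<in> set [v]" "v' \<in> set [v']" by auto
    from circuit_through[of E "[v]" w "[v']" ?R v v' "(m - 1) + (m - 1)", OF E_sym A R mem vv]
    obtain ys c where ys: "2 \<le> length ys" "hd ys \<in> set [v]" "last ys \<in> set [v']" and
      c: "circuit E c" "set ys \<subseteq> set c" "length c \<le> length [v] + length [v'] + 1 + (m - 1 + (m - 1))" by blast
    have "ys \<noteq> []" using ys(1) by auto
    then have "v \<in> set c" "v' \<in> set c" using ys c(2) hd_in_set[of ys] last_in_set[of ys] by auto
    then show ?thesis using D[OF c(1), of v v'] c(3) V by simp
  qed (use edge_V in \<open>simp\<close>)
  then show ?thesis by blast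
qed

end

context relhyp_weighted
begin

lemma W_to_near: "a \<in> near u \<Longrightarrow> u \<in> X \<Longrightarrow> W.d u a \<le> ht u"
  using W.d_edge[of u a] by (auto simp: near_def ht_def cone_weight_def split: if_splits)

text \<open>Follow a weighted geodesic: entering and leaving a cone point other than its ends costs
  \<open>2 * \<tau>\<close>. Without such a crossing, what remains between the heights of the ends
  is a path of group elements.\<close>

lemma W_cases:
  "u \<in> X \<Longrightarrow> v \<in> X \<Longrightarrow> u = v \<or> 2 * \<tau> + ht u + ht v \<le> W.d u v \<or>
     (\<exists>a\<in>near u. \<exists>b\<in>near v. S.h a b + ht u + ht v \<le> W.d u v)"
proof (induction "W.d u v" arbitrary: u rule: less_induct)
  case less
  show ?case
  proof (cases "u = v")
    case False
    from W.d_step[OF less.prems this] obtain u' where u': "E u u'" "u' \<in> X"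
      "W.d u v = cone_weight V \<tau> u u' + W.d u' v" by blast
    then have "W.d u' v < W.d u v" using W.\<omega>_pos[OF u'(1)] by simp
    note IH = less.hyps[OF this u'(2) less.prems(2)]
    consider "u \<in> V" "u' \<in> V" | "u \<in> V" "u' \<notin> V" | "u \<notin> V" "u' \<in> V" using edge_V[OF u'(1)] by blast
    then show ?thesis
    proof cases
      case 1
      have uu': "S.h u u' \<le> 1" using S.h_edge[of u u'] u' 1 by blast
      have w: "W.d u v = 1 + W.d u' v" using u' 1 by (simp add: cone_weight_def)
      have hts: "ht u = 0" "ht u' = 0" using 1 by (auto simp: ht_def)
      from IH consider "u' = v" | "2 * \<tau> + ht u' + ht v \<le> W.d u' v" |
        b where "b \<in> near v" "S.h u' b + ht u' + ht v \<le> W.d u' v" using 1 by (auto simp: near_def)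
      then show ?thesis
      proof cases
        case 1
        then show ?thesis using \<open>u \<in> V\<close> \<open>u' \<in> V\<close> uu' w hts by (auto simp: near_def)
      next
        case 3
        have "b \<in> V" using near_sub less.prems 3 by blast
        then have "S.h u b \<le> 1 + S.h u' b" using S.d_tri[of u u' b] \<open>u \<in> V\<close> \<open>u' \<in> V\<close> uu' by linarith
        then have "S.h u b + ht u + ht v \<le> W.d u v" using 3 w hts by linarith
        then show ?thesis using 3(1) \<open>u \<in> V\<close> by (auto simp: near_def)
      qed (use w hts in linarith)
    next
      case 2
      have w: "W.d u v = \<tau> + W.d u' v" using u' 2 by (simp add: cone_weight_def)
      have hts: "ht u = 0" "ht u' = \<tau>" using 2 by (auto simp: ht_def)
      from IH consider "u' = v" | "\<tau> + ht v \<le> W.d u' v" using hts by fastforce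
      then show ?thesis
      proof cases
        case 1
        then have "u \<in> near v" using E_sym u' 2 by (auto simp: near_def)
        moreover have "S.h u u + ht u + ht v \<le> W.d u v" using w hts 1 by simp
        ultimately show ?thesis using 2 by (auto simp: near_def)
      qed (use w hts in linarith)
    next
      case 3
      have w: "W.d u v = \<tau> + W.d u' v" using u' 3 by (simp add: cone_weight_def)
      have hts: "ht u = \<tau>" "ht u' = 0" using 3 by (auto simp: ht_def)
      have un: "u' \<in> near u" using u' 3 by (simp add: near_def)
      from IH consider "u' = v" | "2 * \<tau> + ht u' + ht v \<le> W.d u' v" |
        b where "b \<in> near v" "S.h u' b + ht u' + ht v \<le> W.d u' v" using 3 by (auto simp: near_def)
      then show ?thesis
      proof cases
        case 1
        moreover have "S.h u' u' + ht u + ht v \<le> W.d u v" using w hts 1 by simp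
        ultimately show ?thesis using un 3 by (auto simp: near_def)
      next
        case 3
        then have "S.h u' b + ht u + ht v \<le> W.d u v" using w hts by linarith
        then show ?thesis using un 3(1) by blast
      qed (use w hts in linarith)
    qed
  qed simp
qed

text \<open>The bound \<open>n < 2 * \<tau>\<close> excludes the alternative of
  \<open>W_cases\<close> in which a further cone point is crossed.\<close>

lemma near_adjacent:
  assumes "u \<in> X" "v \<in> X" "u \<noteq> v" "n < 2 * \<tau>"
  shows "(\<exists>a\<in>near u. \<exists>b\<in>near v. S.h a b \<le> n) \<longleftrightarrow> W.d u v \<le> n + ht u + ht v"
proof
  assume "\<exists>a\<in>near u. \<exists>b\<in>near v. S.h a b \<le> n"
  then obtain a b where ab: "a \<in> near u" "b \<in> near v" "S.h a b \<le> n" by blast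
  have V: "a \<in> V" "b \<in> V" "a \<in> X" "b \<in> X" using ab near_sub assms V_sub by blast+
  have "W.d u v \<le> W.d u a + (W.d a b + W.d v b)"
    using W.d_tri[OF assms(1) V(3) assms(2)] W.d_tri[OF V(3,4) assms(2)] W.d_sym[OF assms(2) V(4)]
    by linarith
  then show "W.d u v \<le> n + ht u + ht v"
    using W_to_near[OF ab(1) assms(1)] W_to_near[OF ab(2) assms(2)] W_le_S[OF V(1,2)] ab(3) by linarith
next
  assume "W.d u v \<le> n + ht u + ht v"
  then have "\<not> 2 * \<tau> + ht u + ht v \<le> W.d u v" using assms(4) by linarith
  then obtain a b where "a \<in> near u" "b \<in> near v" "S.h a b + ht u + ht v \<le> W.d u v"
    using W_cases[OF assms(1,2)] assms(3) by blast
  then show "\<exists>a\<in>near u. \<exists>b\<in>near v. S.h a b \<le> n"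
    using \<open>W.d u v \<le> n + ht u + ht v\<close> by (intro bexI[of _ a] bexI[of _ b]) auto
qed

end

text \<open>\<open>M\<close> is the integer cube root of \<open>n\<close>. The first inequality is
  quadratic in \<open>M\<close>. In the second, \<open>D > M\<close> gives
  \<open>n \<le> D ^ 3\<close>, so the left side is at most \<open>14 * D ^ 4\<close>, whereas
  \<open>k\<close> can be taken proportional to \<open>D\<close>.\<close>

lemma scale_exists:
  "\<exists>N. \<forall>n\<ge>N. 1 \<le> n \<and> (\<exists>M. (2 * (K + M) + 1) * (2 * (K + M) + 3) + 6 * (2 * (K + M)) \<le> n \<and>
     (\<forall>D>M. \<exists>k. 2 * D + n * (6 * D + 6) \<le> 2 ^ k \<and> K * k < (D::nat)))"
proof -
  have "\<forall>\<^sub>F q in sequentially. (real q + 1) ^ 5 \<le> 2 ^ q" by real_asymp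
  then obtain q0 where q0: "\<And>q. q \<ge> q0 \<Longrightarrow> (real q + 1) ^ 5 \<le> 2 ^ q"
    by (auto simp: eventually_sequentially)
  \<comment> \<open>The quotient \<open>q\<close> below satisfies \<open>c \<le> q + 1\<close>, so
    the factor \<open>14 * (K + 1) ^ 4\<close> is absorbed by one more power of
    \<open>q + 1\<close>; this is why the fifth power is compared with \<open>2 ^ q\<close>. The 59
    in \<open>M0\<close> is the sum \<open>16 + 40 + 3\<close> of coefficients in the quadratic
    estimate.\<close>
  define c where "c = 14 * (K + 1) ^ 4"
  define M0 where "M0 = (K + 1) * (q0 + c + 1) + K + 59"
  have "1 \<le> n \<and> (\<exists>M. (2 * (K + M) + 1) * (2 * (K + M) + 3) + 6 * (2 * (K + M)) \<le> n \<and>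
     (\<forall>D>M. \<exists>k. 2 * D + n * (6 * D + 6) \<le> 2 ^ k \<and> K * k < (D::nat)))"
    if n: "n \<ge> M0 ^ 3" for n
  proof -
    have "\<exists>M. M ^ 3 \<le> n \<and> (\<forall>M'. M' ^ 3 \<le> n \<longrightarrow> M' \<le> M)"
    proof (rule ex_has_greatest_nat[of "\<lambda>M. M ^ 3 \<le> n" M0 id "Suc n", simplified])
      show "\<forall>M'. M' ^ 3 \<le> n \<longrightarrow> M' < Suc n"
      proof (intro allI impI)
        fix M' :: nat assume "M' ^ 3 \<le> n"
        moreover have "M' \<le> M' ^ 3" by (cases "M' = 0") (auto simp: self_le_power)
        ultimately show "M' < Suc n" by linarith
      qed
    qed (use n in simp)
    then obtain M where M: "M ^ 3 \<le> n" "\<And>M'. M' ^ 3 \<le> n \<Longrightarrow> M' \<le> M" by blast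
    have M0: "M0 \<le> M" using M(2) n by blast
    then have MK: "K \<le> M" "59 \<le> M" by (auto simp: M0_def)
    have "(2 * (K + M) + 1) * (2 * (K + M) + 3) + 6 * (2 * (K + M)) \<le>
        (4 * M + 1) * (4 * M + 3) + 24 * M"
      (is "?a * ?b + ?c \<le> ?d * ?e + ?f")
    proof -
      have "?a * ?b \<le> ?d * ?e" using MK by (intro mult_le_mono) auto
      moreover have "?c \<le> ?f" using MK by simp
      ultimately show ?thesis by (rule add_mono)
    qed
    also have "(4 * M + 1) * (4 * M + 3) + 24 * M = 16 * (M * M) + 40 * M + 3"
      by (simp add: algebra_simps)
    also have "\<dots> \<le> 59 * (M * M)"
    proof -
      have "M \<le> M * M" using MK by simp
      then show ?thesis using MK by linarith
    qed
    also have "\<dots> \<le> M * (M * M)" using MK by (intro mult_right_mono) auto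
    also have "\<dots> \<le> n" using M(1) by (simp add: power3_eq_cube)
    finally have 1: "(2 * (K + M) + 1) * (2 * (K + M) + 3) + 6 * (2 * (K + M)) \<le> n" .
    have "\<exists>k. 2 * D + n * (6 * D + 6) \<le> 2 ^ k \<and> K * k < D" if D: "M < D" for D
    proof -
      define q where "q = (D - 1) div (K + 1)"
      have qD: "(K + 1) * q \<le> D - 1" unfolding q_def by (rule times_div_less_eq_dividend)
      have Dq: "D \<le> (K + 1) * (q + 1)"
        using dividend_less_times_div[of "K + 1" "D - 1"] D unfolding q_def by (simp add: algebra_simps)
      have "(K + 1) * (q0 + c + 1) \<le> D - 1" using D M0 by (simp add: M0_def)
      then have "q0 + c + 1 \<le> q" unfolding q_def using div_le_mono[of _ _ "K + 1"]
        by (metis nonzero_mult_div_cancel_left add_is_0 one_neq_zero)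
      then have q: "q0 \<le> q" "c \<le> q + 1" by auto
      have "\<not> D ^ 3 \<le> n" using M(2)[of D] D by auto
      then have nD: "n \<le> D ^ 3" by simp
      have D1: "1 \<le> D" using D by simp
      have "2 * D + n * (6 * D + 6) \<le> 2 * D ^ 4 + D ^ 3 * (12 * D)"
        using nD D1 self_le_power[of D 4] by (intro add_mono mult_mono) auto
      also have "\<dots> = 14 * D ^ 4" using power_Suc2[of D 3] by simp
      also have "\<dots> \<le> 14 * ((K + 1) * (q + 1)) ^ 4" using Dq by (intro mult_left_mono power_mono) auto
      also have "\<dots> = c * (q + 1) ^ 4" by (simp only: c_def power_mult_distrib mult.assoc)
      also have "\<dots> \<le> (q + 1) * (q + 1) ^ 4" using q(2) by (intro mult_right_mono) auto
      also have "\<dots> = (q + 1) ^ 5" using power_Suc[of "q + 1" 4] by simp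
      also have "\<dots> \<le> 2 ^ q"
      proof -
        have "real ((q + 1) ^ 5) \<le> real (2 ^ q)" using q0[OF q(1)] by (simp add: add.commute)
        then show ?thesis by (simp only: of_nat_le_iff)
      qed
      finally have "2 * D + n * (6 * D + 6) \<le> 2 ^ q" .
      moreover have "K * q < D" using qD D by (simp add: algebra_simps)
      ultimately show ?thesis by blast
    qed
    moreover have "1 \<le> n" using add_leD2[OF 1] MK by simp
    ultimately show ?thesis using 1 by blast
  qed
  then show ?thesis by blast
qed

section \<open>Contractibility in the weak topology\<close>

lemma openin_realization:
  "openin (realization K) U \<longleftrightarrow> U \<subseteq> real_points K \<and>
     (\<forall>\<sigma>\<in>K. openin (subtopology (powertop_real UNIV) (csimplex \<sigma>)) (U \<inter> csimplex \<sigma>))"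
proof -
  let ?P = "\<lambda>U. U \<subseteq> real_points K \<and>
     (\<forall>\<sigma>\<in>K. openin (subtopology (powertop_real UNIV) (csimplex \<sigma>)) (U \<inter> csimplex \<sigma>))"
  have "istopology ?P"
    unfolding istopology_def
  proof (intro conjI allI impI)
    fix S T assume S: "?P S" and T: "?P T"
    show "S \<inter> T \<subseteq> real_points K" using S by blast
    have "S \<inter> T \<inter> c = (S \<inter> c) \<inter> (T \<inter> c)" for c by blast
    then show "\<forall>\<sigma>\<in>K. openin (subtopology (powertop_real UNIV) (csimplex \<sigma>)) (S \<inter> T \<inter> csimplex \<sigma>)"
      using S T by (simp add: openin_Int)
  next
    fix \<U> assume U: "\<forall>U\<in>\<U>. ?P U"
    show "\<Union>\<U> \<subseteq> real_points K" using U by blast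
    show "\<forall>\<sigma>\<in>K. openin (subtopology (powertop_real UNIV) (csimplex \<sigma>)) (\<Union>\<U> \<inter> csimplex \<sigma>)"
    proof
      fix \<sigma> assume "\<sigma> \<in> K"
      then have "openin (subtopology (powertop_real UNIV) (csimplex \<sigma>)) (\<Union>((\<lambda>U. U \<inter> csimplex \<sigma>) ` \<U>))"
        using U by (intro openin_Union) blast
      moreover have "\<Union>\<U> \<inter> csimplex \<sigma> = \<Union>((\<lambda>U. U \<inter> csimplex \<sigma>) ` \<U>)" by blast
      ultimately show "openin (subtopology (powertop_real UNIV) (csimplex \<sigma>)) (\<Union>\<U> \<inter> csimplex \<sigma>)"
        by (simp only:)
    qed
  qed
  from topology_inverse'[OF this] show ?thesis unfolding realization_def by (rule fun_cong)
qed

lemma topspace_realization [simp]: "topspace (realization K) = real_points K"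
proof
  show "topspace (realization K) \<subseteq> real_points K"
    using openin_topspace[of "realization K"] unfolding openin_realization by blast
  have "real_points K \<inter> csimplex \<sigma> = csimplex \<sigma>" if "\<sigma> \<in> K" for \<sigma>
    using that by (auto simp: real_points_def)
  then have "openin (realization K) (real_points K)"
    unfolding openin_realization by (simp add: openin_subtopology_refl)
  then show "real_points K \<subseteq> topspace (realization K)" by (rule openin_subset)
qed

lemma closedin_realizationD:
  assumes "closedin (realization K) Z" "\<sigma> \<in> K"
  shows "closedin (subtopology (powertop_real UNIV) (csimplex \<sigma>)) (Z \<inter> csimplex \<sigma>)"
proof -
  have "openin (realization K) (real_points K - Z)"
    using assms(1) by (simp add: closedin_def)
  then have "openin (subtopology (powertop_real UNIV) (csimplex \<sigma>)) ((real_points K - Z) \<inter> csimplex \<sigma>)"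
    using assms(2) unfolding openin_realization by blast
  moreover have "csimplex \<sigma> - Z \<inter> csimplex \<sigma> = (real_points K - Z) \<inter> csimplex \<sigma>"
    using assms(2) by (auto simp: real_points_def)
  ultimately show ?thesis by (simp add: closedin_def)
qed

lemma closedin_csimplex:
  assumes "finite \<sigma>"
  shows "closedin (powertop_real UNIV) (csimplex \<sigma>)"
proof -
  have coord: "continuous_map (powertop_real UNIV) euclideanreal (\<lambda>x. x u)" for u :: 'a
    by (rule continuous_map_product_projection) simp
  have pos: "closedin (powertop_real UNIV) {x. 0 \<le> x u}" for u :: 'a
    using closedin_continuous_map_preimage[OF coord[of u], of "{0..}"] by simp
  have zero: "closedin (powertop_real UNIV) {x. x u = 0}" for u :: 'a
    using closedin_continuous_map_preimage[OF coord[of u], of "{0}"] by simp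
  have "continuous_map (powertop_real UNIV) euclideanreal (\<lambda>x. sum x \<sigma>)"
    using assms coord by (rule continuous_map_sum)
  then have one: "closedin (powertop_real UNIV) {x. sum x \<sigma> = 1}"
    using closedin_continuous_map_preimage[of "powertop_real UNIV" euclideanreal "\<lambda>x. sum x \<sigma>" "{1}"]
    by simp
  have "closedin (powertop_real UNIV) (\<Inter>(range (\<lambda>u. {x. 0 \<le> x u}) \<union> (\<lambda>u. {x. x u = 0}) ` (- \<sigma>) \<union> {{x. sum x \<sigma> = 1}}))"
    using pos zero one by (intro closedin_Inter) auto
  moreover have "csimplex \<sigma> = \<Inter>(range (\<lambda>u. {x. 0 \<le> x u}) \<union> (\<lambda>u. {x. x u = 0}) ` (- \<sigma>) \<union> {{x. sum x \<sigma> = 1}})"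
    by (auto simp: csimplex_def)
  ultimately show ?thesis by simp
qed

text \<open>A point lies in the simplex on its support. A finite set that contains all supports
  therefore confines a family of points to finitely many simplices.\<close>

lemma csimplex_face:
  assumes "x \<in> csimplex \<sigma>" "finite \<sigma>"
  shows "{u. x u \<noteq> 0} \<subseteq> \<sigma>" "{u. x u \<noteq> 0} \<noteq> {}" "x \<in> csimplex {u. x u \<noteq> 0}"
proof -
  show sub: "{u. x u \<noteq> 0} \<subseteq> \<sigma>" using assms by (auto simp: csimplex_def)
  then have s: "sum x {u. x u \<noteq> 0} = sum x \<sigma>"
    using assms(2) by (intro sum.mono_neutral_left) auto
  moreover have "sum x \<sigma> = 1" using assms(1) by (simp add: csimplex_def)
  ultimately show "{u. x u \<noteq> 0} \<noteq> {}" by (metis sum.empty zero_neq_one)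
  show "x \<in> csimplex {u. x u \<noteq> 0}" using assms(1) s by (auto simp: csimplex_def)
qed

text \<open>Continuity of a homotopy for the weak topology can be tested on the simplices, because
  \<open>{0..1}\<close> is compact.\<close>

lemma contractible_realizationI:
  fixes K :: "'v set set"
  assumes fin: "\<And>\<sigma>. \<sigma> \<in> K \<Longrightarrow> finite \<sigma>"
    and face: "\<And>\<sigma> \<tau>. \<lbrakk>\<sigma> \<in> K; \<tau> \<subseteq> \<sigma>; \<tau> \<noteq> {}\<rbrakk> \<Longrightarrow> \<tau> \<in> K"
    and YK: "Y \<subseteq> real_points K"
    and Y_closed: "\<And>\<sigma>. \<sigma> \<in> K \<Longrightarrow> closedin (powertop_real UNIV) (Y \<inter> csimplex \<sigma>)"
    and F_in: "\<And>t x. \<lbrakk>x \<in> Y; t \<in> {0..1}\<rbrakk> \<Longrightarrow> F t x \<in> Y"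
    and F0: "\<And>x. x \<in> Y \<Longrightarrow> F 0 x = x" and F1: "\<And>x. x \<in> Y \<Longrightarrow> F (1::real) x = \<kappa>"
    and F_fin: "\<And>\<sigma>. \<sigma> \<in> K \<Longrightarrow> \<exists>S. finite S \<and> (\<forall>x\<in>Y \<inter> csimplex \<sigma>. \<forall>t\<in>{0..1}. {u. F t x u \<noteq> 0} \<subseteq> S)"
    and F_cont: "\<And>\<sigma> u. \<sigma> \<in> K \<Longrightarrow> continuous_map
       (prod_topology (top_of_set {0..1}) (subtopology (powertop_real UNIV) (Y \<inter> csimplex \<sigma>)))
       euclideanreal (\<lambda>z. F (fst z) (snd z) u)"
  shows "contractible_space (subtopology (realization K) Y)"
proof -
  let ?I = "top_of_set {0..1::real}"
  let ?T = "\<lambda>\<sigma>. subtopology (powertop_real UNIV) (Y \<inter> csimplex \<sigma>)"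
  let ?F = "\<lambda>z. F (fst z) (snd z)"
  have Tspace: "topspace (prod_topology ?I (?T \<sigma>)) = {0..1} \<times> (Y \<inter> csimplex \<sigma>)" for \<sigma> :: "'v set"
    by simp
  have A: "continuous_map (prod_topology ?I (?T \<sigma>)) (realization K) ?F" if \<sigma>: "\<sigma> \<in> K" for \<sigma>
    unfolding continuous_map_closedin
  proof (intro conjI allI impI)
    show "?F \<in> topspace (prod_topology ?I (?T \<sigma>)) \<rightarrow> topspace (realization K)"
      using F_in YK unfolding Tspace by auto
    fix Z assume Z: "closedin (realization K) Z"
    obtain S where S: "finite S" "\<And>x t. \<lbrakk>x \<in> Y \<inter> csimplex \<sigma>; t \<in> {0..1}\<rbrakk> \<Longrightarrow> {u. F t x u \<noteq> 0} \<subseteq> S"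
      using F_fin[OF \<sigma>] by blast
    \<comment> \<open>Over one simplex the homotopy takes its values in the finitely many simplices
      with vertices in \<open>S\<close>. A weakly closed set meets their union in a set that is
      closed for the product topology.\<close>
    let ?D = "\<Union>\<tau>\<in>{\<tau> \<in> K. \<tau> \<subseteq> S}. Z \<inter> csimplex \<tau>"
    have "finite {\<tau> \<in> K. \<tau> \<subseteq> S}" using S(1) by (auto intro: finite_subset[of _ "Pow S"])
    moreover have "closedin (powertop_real UNIV) (Z \<inter> csimplex \<tau>)" if "\<tau> \<in> K" for \<tau>
      using closedin_realizationD[OF Z that] closedin_csimplex[OF fin[OF that]]
      by (meson closedin_trans_full)
    ultimately have D: "closedin (powertop_real UNIV) ?D" by (intro closedin_Union) auto
    have "continuous_map (prod_topology ?I (?T \<sigma>)) (powertop_real UNIV) ?F"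
      using F_cont[OF \<sigma>] by (simp add: continuous_map_componentwise_UNIV)
    from closedin_continuous_map_preimage[OF this D]
    have "closedin (prod_topology ?I (?T \<sigma>)) {z \<in> topspace (prod_topology ?I (?T \<sigma>)). ?F z \<in> ?D}" .
    moreover have "?F z \<in> ?D \<longleftrightarrow> ?F z \<in> Z" if z: "z \<in> {0..1} \<times> (Y \<inter> csimplex \<sigma>)" for z
    proof
      assume FZ: "?F z \<in> Z"
      have "?F z \<in> real_points K" using F_in YK z by auto
      then obtain \<rho> where \<rho>: "\<rho> \<in> K" "?F z \<in> csimplex \<rho>" by (auto simp: real_points_def)
      let ?s = "{u. ?F z u \<noteq> 0}"
      note f = csimplex_face[OF \<rho>(2) fin[OF \<rho>(1)]]
      have "?s \<in> K" using face[OF \<rho>(1) f(1,2)] .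
      moreover have "?s \<subseteq> S" using S(2)[of "snd z" "fst z"] z by (simp add: mem_Times_iff)
      ultimately show "?F z \<in> ?D" using f(3) FZ by blast
    qed auto
    ultimately show "closedin (prod_topology ?I (?T \<sigma>)) {z \<in> topspace (prod_topology ?I (?T \<sigma>)). ?F z \<in> Z}"
      unfolding Tspace by (smt (verit, best) Collect_cong)
  qed
  let ?R = "subtopology (realization K) Y"
  have Rspace: "topspace ?R = Y" using YK by auto
  have B: "continuous_map (prod_topology ?I ?R) (realization K) ?F"
    unfolding continuous_map_def
  proof (intro conjI allI impI)
    show "?F \<in> topspace (prod_topology ?I ?R) \<rightarrow> topspace (realization K)"
      using F_in YK by auto
    fix U assume U: "openin (realization K) U"
    show "openin (prod_topology ?I ?R) {z \<in> topspace (prod_topology ?I ?R). ?F z \<in> U}"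
      unfolding openin_prod_topology_alt
    proof (intro allI impI)
      fix t0 x0 assume "(t0, x0) \<in> {z \<in> topspace (prod_topology ?I ?R). ?F z \<in> U}"
      then have t0: "t0 \<in> {0..1}" and x0: "x0 \<in> Y" and FU: "F t0 x0 \<in> U" using Rspace by auto
      obtain \<sigma> where \<sigma>: "\<sigma> \<in> K" "x0 \<in> csimplex \<sigma>" using x0 YK by (auto simp: real_points_def)
      have "continuous_map ?I (prod_topology ?I (?T \<sigma>)) (\<lambda>t. (t, x0))"
        using x0 \<sigma> by (intro continuous_map_pairedI) auto
      from continuous_map_compose[OF this A[OF \<sigma>(1)]]
      have "continuous_map ?I (realization K) (\<lambda>t. F t x0)" by (simp add: o_def)
      then have "openin ?I {t \<in> {0..1}. F t x0 \<in> U}"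
        using U openin_continuous_map_preimage[of ?I "realization K" "\<lambda>t. F t x0" U] by simp
      then obtain e where e: "e > 0" "\<And>t. \<lbrakk>t \<in> {0..1}; dist t t0 < e\<rbrakk> \<Longrightarrow> F t x0 \<in> U"
        using t0 FU unfolding openin_euclidean_subtopology_iff by blast
      \<comment> \<open>Half the radius, so that the closed interval still lies where
        \<open>F t x0\<close> is in \<open>U\<close>.\<close>
      define J where "J = {0..1} \<inter> cball t0 (e / 2)"
      have J: "compact J" "J \<subseteq> {0..1}" by (auto simp: J_def compact_Int_closed)
      have J0: "F t x0 \<in> U" if "t \<in> J" for t
        using that e by (auto simp: J_def dist_commute)
      define B where "B = {x \<in> Y. \<forall>t\<in>J. F t x \<in> U}"
      \<comment> \<open>Tube lemma on each simplex: the complement is the projection, along the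
        compact \<open>J\<close>, of a closed set. Adding \<open>real_points K - Y\<close> makes
        this a question about the whole complex, where openness is tested on simplices; the trace on
        \<open>Y\<close> is \<open>B\<close>.\<close>
      have "openin (realization K) (B \<union> (real_points K - Y))"
        unfolding openin_realization
      proof (intro conjI ballI)
        show "B \<union> (real_points K - Y) \<subseteq> real_points K" using YK by (auto simp: B_def)
        fix \<tau> assume \<tau>: "\<tau> \<in> K"
        have eq: "prod_topology (top_of_set J) (?T \<tau>) =
            subtopology (prod_topology ?I (?T \<tau>)) (J \<times> topspace (?T \<tau>))"
          using prod_topology_subtopology(1)[of ?I J "?T \<tau>"] J(2)
          by (simp add: subtopology_subtopology inf.absorb2)
        have "continuous_map (prod_topology (top_of_set J) (?T \<tau>)) (realization K) ?F"
          unfolding eq by (rule continuous_map_from_subtopology[OF A[OF \<tau>]])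
        moreover have "closedin (realization K) (real_points K - U)"
          using U by (simp add: closedin_def openin_realization double_diff)
        ultimately have "closedin (prod_topology (top_of_set J) (?T \<tau>))
            {z \<in> topspace (prod_topology (top_of_set J) (?T \<tau>)). ?F z \<in> real_points K - U}" (is "closedin _ ?Z")
          by (rule closedin_continuous_map_preimage)
        moreover have "compact_space (top_of_set J)"
          using J(1) by (simp add: compact_space_subtopology)
        ultimately have "closedin (?T \<tau>) (snd ` ?Z)"
          using Abstract_Topological_Spaces.closed_map_snd unfolding closed_map_def by blast
        then have "closedin (powertop_real UNIV) (snd ` ?Z)"
          using Y_closed[OF \<tau>] by (meson closedin_trans_full)
        moreover have "snd ` ?Z = csimplex \<tau> - (B \<union> (real_points K - Y))"
        proof (rule equalityI; rule subsetI)
          fix x assume "x \<in> snd ` ?Z"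
          then show "x \<in> csimplex \<tau> - (B \<union> (real_points K - Y))"
            by (auto simp: B_def)
        next
          fix x assume x: "x \<in> csimplex \<tau> - (B \<union> (real_points K - Y))"
          then have "x \<in> Y" using \<tau> by (auto simp: real_points_def)
          moreover from this obtain t where "t \<in> J" "F t x \<notin> U" using x by (auto simp: B_def)
          moreover have "F t x \<in> real_points K" using F_in[of x t] calculation J YK by blast
          ultimately have "(t, x) \<in> ?Z" using x by auto
          then show "x \<in> snd ` ?Z" by force
        qed
        ultimately have "closedin (powertop_real UNIV) (csimplex \<tau> - (B \<union> (real_points K - Y)))" by simp
        then have "closedin (subtopology (powertop_real UNIV) (csimplex \<tau>)) (csimplex \<tau> - (B \<union> (real_points K - Y)))"
          by (rule closedin_subset_topspace) blast
        then show "openin (subtopology (powertop_real UNIV) (csimplex \<tau>)) ((B \<union> (real_points K - Y)) \<inter> csimplex \<tau>)"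
          by (simp add: openin_closedin_eq Diff_Int_distrib2) (metis Diff_Int2 Diff_Int_distrib2 Int_commute Int_absorb)
      qed
      moreover have "B = Y \<inter> (B \<union> (real_points K - Y))" by (auto simp: B_def)
      ultimately have B: "openin ?R B" by (metis openin_subtopology_Int2)
      have "openin ?I ({0..1} \<inter> ball t0 (e / 2))" by (simp add: openin_open_Int)
      moreover have "({0..1} \<inter> ball t0 (e / 2)) \<times> B \<subseteq> {z \<in> topspace (prod_topology ?I ?R). ?F z \<in> U}"
        using Rspace by (auto simp: B_def J_def)
      moreover have "t0 \<in> {0..1} \<inter> ball t0 (e / 2)" "x0 \<in> B" using t0 x0 J0 e by (auto simp: B_def)
      ultimately show "\<exists>A B. openin ?I A \<and> openin ?R B \<and> t0 \<in> A \<and> x0 \<in> B \<and>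
          A \<times> B \<subseteq> {z \<in> topspace (prod_topology ?I ?R). ?F z \<in> U}"
        using B by blast
    qed
  qed
  have "continuous_map (prod_topology ?I ?R) ?R ?F"
    using B F_in Rspace by (auto simp: continuous_map_in_subtopology)
  then have "homotopic_with (\<lambda>x. True) ?R ?R id (\<lambda>x. \<kappa>)"
    using F0 F1 Rspace by (subst homotopic_with) (auto intro!: exI[of _ ?F])
  then show ?thesis unfolding contractible_space_def by blast
qed

text \<open>Interpolation between \<open>x\<close> and its image under the linear map that sends
  each vertex \<open>u\<close> of level \<open>j\<close> to the barycentre of \<open>r u\<close> and
  fixes all others. The sum is over the support of \<open>x\<close>, which is finite for points of a
  complex with finite simplices.\<close>

definition push_level :: "('v \<Rightarrow> nat) \<Rightarrow> ('v \<Rightarrow> 'v set) \<Rightarrow> nat \<Rightarrow> real \<Rightarrow> ('v \<Rightarrow> real) \<Rightarrow> 'v \<Rightarrow> real" where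
  "push_level lev r j c x v = (1 - c) * x v + c * (\<Sum>u | x u \<noteq> 0. x u *
     (if lev u = j then (if v \<in> r u then 1 / card (r u) else 0) else if v = u then 1 else 0))"

text \<open>The factor \<open>k * (k + 1)\<close> is the reciprocal of the length of the interval
  from \<open>1 / (k + 1)\<close> to \<open>1 / k\<close>.\<close>

definition ramp :: "nat \<Rightarrow> real \<Rightarrow> real" where
  "ramp k t = max 0 (min 1 ((t - 1 / (real k + 1)) * (real k * (real k + 1))))"

text \<open>The mass at level \<open>k\<close> is moved during the time interval from \<open>1 / (k + 1)\<close> to \<open>1 / k\<close>,
  so high levels move first and each point is moved by finitely many stages only.\<close>

primrec flow :: "('v \<Rightarrow> nat) \<Rightarrow> ('v \<Rightarrow> 'v set) \<Rightarrow> nat \<Rightarrow> real \<Rightarrow> ('v \<Rightarrow> real) \<Rightarrow> 'v \<Rightarrow> real" where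
  "flow lev r 0 t x = x"
| "flow lev r (Suc k) t x = flow lev r k t (push_level lev r (Suc k) (ramp (Suc k) t) x)"

lemma ramp_in: "0 \<le> ramp k t" "ramp k t \<le> 1"
  by (auto simp: ramp_def)

lemma ramp_0:
  assumes "t \<le> 1 / (real k + 1)"
  shows "ramp k t = 0"
proof -
  have "(t - 1 / (real k + 1)) * (real k * (real k + 1)) \<le> 0"
    using assms by (intro mult_nonpos_nonneg) auto
  then show ?thesis unfolding ramp_def by linarith
qed

lemma ramp_1:
  assumes "1 \<le> k" "1 / k \<le> t"
  shows "ramp k t = 1"
proof -
  have "1 / real k * (real k * (real k + 1)) = real k + 1"
    "1 / (real k + 1) * (real k * (real k + 1)) = real k"
    using assms by (simp_all add: divide_simps)
  then have "1 = (1 / real k - 1 / (real k + 1)) * (real k * (real k + 1))"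
    by (simp only: left_diff_distrib)
  also have "\<dots> \<le> (t - 1 / (real k + 1)) * (real k * (real k + 1))"
    using assms by (intro mult_right_mono) auto
  finally show ?thesis unfolding ramp_def by linarith
qed

lemma push_level_0 [simp]: "push_level lev r j 0 x = x"
  by (simp add: push_level_def fun_eq_iff)

lemma push_level_sum:
  assumes "finite S" "{u. x u \<noteq> 0} \<subseteq> S"
  shows "push_level lev r j c x v = (1 - c) * x v + c * (\<Sum>u\<in>S. x u *
     (if lev u = j then (if v \<in> r u then 1 / card (r u) else 0) else if v = u then 1 else 0))"
  unfolding push_level_def using assms by (auto intro!: sum.mono_neutral_left)

lemma push_level_support:
  assumes "push_level lev r j c x v \<noteq> 0"
  shows "x v \<noteq> 0 \<or> (\<exists>u. x u \<noteq> 0 \<and> lev u = j \<and> v \<in> r u)"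
proof (rule ccontr)
  assume neg: "\<not> ?thesis"
  then have "push_level lev r j c x v = (1 - c) * x v + c * (\<Sum>u | x u \<noteq> 0. 0)"
    unfolding push_level_def by (intro arg_cong2[where f = "(+)"] arg_cong2[where f = "(*)"] sum.cong) auto
  then show False using assms neg by simp
qed

lemma push_level_1_support:
  assumes "push_level lev r j 1 x v \<noteq> 0"
  shows "x v \<noteq> 0 \<and> lev v \<noteq> j \<or> (\<exists>u. x u \<noteq> 0 \<and> lev u = j \<and> v \<in> r u)"
proof (rule ccontr)
  assume neg: "\<not> ?thesis"
  then have "push_level lev r j 1 x v = 0"
    unfolding push_level_def by (auto intro!: sum.neutral)
  then show False using assms by simp
qed

lemma push_level_id:
  assumes "finite {u. x u \<noteq> 0}" "\<And>u. x u \<noteq> 0 \<Longrightarrow> lev u \<noteq> j"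
  shows "push_level lev r j c x = x"
proof
  fix v
  have "(\<Sum>u | x u \<noteq> 0. x u * (if lev u = j then (if v \<in> r u then 1 / card (r u) else 0) else if v = u then 1 else 0))
      = (\<Sum>u | x u \<noteq> 0. if v = u then x u else 0)"
    using assms(2) by (intro sum.cong) auto
  also have "\<dots> = x v" using assms(1) by simp
  finally show "push_level lev r j c x v = x v" by (simp add: push_level_def algebra_simps)
qed

lemma flow_early: "t \<le> 1 / (real k + 1) \<Longrightarrow> flow lev r k t x = x"
proof (induction k arbitrary: x)
  case (Suc k)
  have "1 / (real (Suc k) + 1) \<le> 1 / (real k + 1)" by (simp add: frac_le)
  then have "t \<le> 1 / (real k + 1)" using Suc.prems by linarith
  then show ?case using Suc ramp_0[of t "Suc k"] by simp
qed simp

text \<open>Stages above the top level of a point do nothing. So each point can use its own top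
  level in the homotopy, while a common bound serves for continuity on a simplex.\<close>

lemma flow_ge:
  assumes "finite {u. x u \<noteq> 0}" "\<And>u. x u \<noteq> 0 \<Longrightarrow> lev u \<le> k" "k \<le> m"
  shows "flow lev r m t x = flow lev r k t x"
  using assms(3)
proof (induction m rule: dec_induct)
  case (step m)
  have "push_level lev r (Suc m) (ramp (Suc m) t) x = x"
    using assms step by (intro push_level_id) fastforce+
  then show ?case using step by simp
qed simp

text \<open>Continuity and the finite bound on supports go together: the sum in
  \<open>push_level\<close> is visibly continuous only after it is rewritten over a fixed finite
  set.\<close>

lemma flow_continuous:
  assumes "continuous_map Z euclideanreal \<tau>" "\<And>u. finite (r u)"
  shows "\<lbrakk>finite S; \<And>z. z \<in> topspace Z \<Longrightarrow> {u. g z u \<noteq> 0} \<subseteq> S;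
      \<And>u. continuous_map Z euclideanreal (\<lambda>z. g z u)\<rbrakk> \<Longrightarrow>
    (\<forall>u. continuous_map Z euclideanreal (\<lambda>z. flow lev r k (\<tau> z) (g z) u)) \<and>
    (\<exists>S. finite S \<and> (\<forall>z\<in>topspace Z. {u. flow lev r k (\<tau> z) (g z) u \<noteq> 0} \<subseteq> S))"
proof (induction k arbitrary: g S)
  case 0
  then show ?case by auto
next
  case (Suc k)
  let ?g = "\<lambda>z. push_level lev r (Suc k) (ramp (Suc k) (\<tau> z)) (g z)"
  let ?S = "S \<union> (\<Union>u\<in>S. r u)"
  have S: "finite ?S" using Suc.prems(1) assms(2) by blast
  have sup: "{u. ?g z u \<noteq> 0} \<subseteq> ?S" if "z \<in> topspace Z" for z
  proof
    fix u assume "u \<in> {u. ?g z u \<noteq> 0}"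
    then have "g z u \<noteq> 0 \<or> (\<exists>w. g z w \<noteq> 0 \<and> lev w = Suc k \<and> u \<in> r w)"
      using push_level_support[of lev r "Suc k" "ramp (Suc k) (\<tau> z)" "g z" u] by simp
    then show "u \<in> ?S" using Suc.prems(2)[OF that] by blast
  qed
  have ramp: "continuous_map Z euclideanreal (\<lambda>z. ramp (Suc k) (\<tau> z))"
    unfolding ramp_def using assms(1)
    by (intro continuous_map_real_max continuous_map_real_min continuous_map_real_mult_right
        continuous_map_diff) simp_all
  have "continuous_map Z euclideanreal (\<lambda>z. ?g z v)" for v
  proof (rule continuous_map_eq)
    show "continuous_map Z euclideanreal (\<lambda>z. (1 - ramp (Suc k) (\<tau> z)) * g z v + ramp (Suc k) (\<tau> z) * (\<Sum>u\<in>S. g z u *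
     (if lev u = Suc k then (if v \<in> r u then 1 / card (r u) else 0) else if v = u then 1 else 0)))"
      using Suc.prems(1,3) ramp
      by (intro continuous_map_add continuous_map_real_mult continuous_map_diff continuous_map_sum
          continuous_map_real_mult_right) simp_all
    fix z assume "z \<in> topspace Z"
    then show "(1 - ramp (Suc k) (\<tau> z)) * g z v + ramp (Suc k) (\<tau> z) * (\<Sum>u\<in>S. g z u *
     (if lev u = Suc k then (if v \<in> r u then 1 / card (r u) else 0) else if v = u then 1 else 0)) = ?g z v"
      using push_level_sum[OF Suc.prems(1) Suc.prems(2)] by simp
  qed
  from Suc.IH[OF S sup this] show ?case by simp
qed

text \<open>While one stage is in progress the later ones, for lower levels, have not begun, and by
  the time they begin it is complete. So only the top level of the current point is ever pushed,
  which is the situation of \<open>push_in\<close>.\<close>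

theorem contractible_by_levels:
  fixes K :: "'v set set"
  assumes fin: "\<And>\<sigma>. \<sigma> \<in> K \<Longrightarrow> finite \<sigma>"
    and face: "\<And>\<sigma> \<tau>. \<lbrakk>\<sigma> \<in> K; \<tau> \<subseteq> \<sigma>; \<tau> \<noteq> {}\<rbrakk> \<Longrightarrow> \<tau> \<in> K"
    and YK: "Y \<subseteq> real_points K"
    and Y_closed: "\<And>\<sigma>. \<sigma> \<in> K \<Longrightarrow> closedin (powertop_real UNIV) (Y \<inter> csimplex \<sigma>)"
    and finr: "\<And>u. finite (r u)"
    and pos: "\<And>x u. \<lbrakk>x \<in> Y; x u \<noteq> 0\<rbrakk> \<Longrightarrow> 1 \<le> lev u"
    and push_in: "\<And>x j c. \<lbrakk>x \<in> Y; \<And>u. x u \<noteq> 0 \<Longrightarrow> lev u \<le> j; 0 \<le> c; c \<le> 1\<rbrakk> \<Longrightarrow> push_level lev r j c x \<in> Y"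
    and down: "\<And>x u v. \<lbrakk>x \<in> Y; x u \<noteq> 0; 2 \<le> lev u; v \<in> r u\<rbrakk> \<Longrightarrow> lev v < lev u"
    and base: "\<And>x u. \<lbrakk>x \<in> Y; x u \<noteq> 0; lev u = 1\<rbrakk> \<Longrightarrow> r u = C"
  shows "contractible_space (subtopology (realization K) Y)"
proof -
  have Yfin: "finite {u. x u \<noteq> 0}" "sum x {u. x u \<noteq> 0} = 1" if x: "x \<in> Y" for x
  proof -
    obtain \<sigma> where \<sigma>: "\<sigma> \<in> K" "x \<in> csimplex \<sigma>" using x YK by (auto simp: real_points_def)
    note f = csimplex_face[OF \<sigma>(2) fin[OF \<sigma>(1)]]
    show "finite {u. x u \<noteq> 0}" using f(1) fin[OF \<sigma>(1)] finite_subset by blast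
    show "sum x {u. x u \<noteq> 0} = 1" using f(3) by (simp add: csimplex_def)
  qed
  define top where "top x = Max (lev ` {u. x u \<noteq> 0})" for x :: "'v \<Rightarrow> real"
  have topD: "lev u \<le> top x" if "x \<in> Y" "x u \<noteq> 0" for x u
    using Yfin(1)[OF that(1)] that(2) unfolding top_def by (intro Max_ge) auto
  define F where "F t x = flow lev r (top x) t x" for t :: real and x
  have F_eq: "F t x = flow lev r k t x" if "x \<in> Y" "\<And>u. x u \<noteq> 0 \<Longrightarrow> lev u \<le> k" for x k t
  proof -
    have "{u. x u \<noteq> 0} \<noteq> {}" using Yfin(2)[OF that(1)] by (metis sum.empty zero_neq_one)
    then have "top x \<le> k" unfolding top_def using Yfin(1)[OF that(1)] that(2) by (subst Max_le_iff) auto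
    from flow_ge[OF Yfin(1)[OF that(1)] topD[OF that(1)] this] show ?thesis
      unfolding F_def by (rule sym)
  qed
  have down1: "push_level lev r (Suc k) 1 x \<in> Y"
       "push_level lev r (Suc k) 1 x u \<noteq> 0 \<Longrightarrow> 1 \<le> k \<Longrightarrow> lev u \<le> k"
    if x: "x \<in> Y" "\<And>u. x u \<noteq> 0 \<Longrightarrow> lev u \<le> Suc k" for x k u
  proof -
    show "push_level lev r (Suc k) 1 x \<in> Y" using push_in[OF x, of 1] by simp
    assume nz: "push_level lev r (Suc k) 1 x u \<noteq> 0" and k: "1 \<le> k"
    from push_level_1_support[OF nz] show "lev u \<le> k"
    proof
      assume "x u \<noteq> 0 \<and> lev u \<noteq> Suc k" then show ?thesis using x(2)[of u] by simp
    next
      assume "\<exists>w. x w \<noteq> 0 \<and> lev w = Suc k \<and> u \<in> r w"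
      then obtain w where "x w \<noteq> 0" "lev w = Suc k" "u \<in> r w" by blast
      then show ?thesis using down[OF x(1), of w u] k by simp
    qed
  qed
  have flow_in: "flow lev r k t x \<in> Y" if "x \<in> Y" "\<And>u. x u \<noteq> 0 \<Longrightarrow> lev u \<le> k" for k t x
    using that
  proof (induction k arbitrary: x)
    case (Suc k)
    let ?y = "push_level lev r (Suc k) (ramp (Suc k) t) x"
    have y: "?y \<in> Y" using push_in Suc.prems ramp_in by blast
    show ?case
    proof (cases "t \<le> 1 / (real k + 1)")
      case True
      then show ?thesis using y by (simp add: flow_early)
    next
      case False
      then have r1: "ramp (Suc k) t = 1" by (intro ramp_1) (auto simp: add.commute)
      show ?thesis
      \<comment> \<open>The stage for level 1 is the last one; \<open>down\<close> says nothing
        about the levels reached by it.\<close>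
      proof (cases "k = 0")
        case True then show ?thesis using y by simp
      next
        case False
        then show ?thesis using Suc.IH[of ?y] y down1(2)[OF Suc.prems] r1 by simp
      qed
    qed
  qed simp
  define \<kappa> where "\<kappa> v = (if v \<in> C then 1 / card C else 0 :: real)" for v
  have flow_1: "flow lev r (Suc k) 1 x = \<kappa>" if "x \<in> Y" "\<And>u. x u \<noteq> 0 \<Longrightarrow> lev u \<le> Suc k" for k x
    using that
  proof (induction k arbitrary: x)
    case 0
    have l1: "lev u = 1" if "x u \<noteq> 0" for u using pos[OF 0(1) that] 0(2)[OF that] by simp
    have "push_level lev r 1 1 x v = \<kappa> v" for v
    proof -
      have "push_level lev r 1 1 x v = (\<Sum>u | x u \<noteq> 0. x u * \<kappa> v)"
        unfolding push_level_def using l1 base[OF 0(1)] by (auto simp: \<kappa>_def intro!: sum.cong)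
      also have "\<dots> = \<kappa> v" using Yfin(2)[OF 0(1)] by (simp flip: sum_distrib_right)
      finally show ?thesis .
    qed
    moreover have "ramp 1 1 = 1" by (rule ramp_1) auto
    ultimately show ?case by (simp add: fun_eq_iff)
  next
    case (Suc k)
    have "ramp (Suc (Suc k)) 1 = 1" by (rule ramp_1) auto
    then have "flow lev r (Suc (Suc k)) 1 x = flow lev r (Suc k) 1 (push_level lev r (Suc (Suc k)) 1 x)" by simp
    also have "\<dots> = \<kappa>" by (rule Suc.IH) (use down1[OF Suc.prems] in auto)
    finally show ?case .
  qed
  have cont: "(\<forall>u. continuous_map (prod_topology (top_of_set {0..1}) (subtopology (powertop_real UNIV) (Y \<inter> csimplex \<sigma>)))
       euclideanreal (\<lambda>z. F (fst z) (snd z) u)) \<and>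
       (\<exists>S. finite S \<and> (\<forall>x\<in>Y \<inter> csimplex \<sigma>. \<forall>t\<in>{0..1}. {u. F t x u \<noteq> 0} \<subseteq> S))"
    if \<sigma>: "\<sigma> \<in> K" for \<sigma>
  proof -
    let ?Z = "prod_topology (top_of_set {0..1::real}) (subtopology (powertop_real UNIV) (Y \<inter> csimplex \<sigma>))"
    define k where "k = Max (insert 0 (lev ` \<sigma>))"
    have Zs: "topspace ?Z = {0..1} \<times> (Y \<inter> csimplex \<sigma>)" by simp
    have sup: "{u. x u \<noteq> 0} \<subseteq> \<sigma>" if "x \<in> csimplex \<sigma>" for x using that by (auto simp: csimplex_def)
    have Fk: "F t x = flow lev r k t x" if "x \<in> Y" "x \<in> csimplex \<sigma>" for t x
    proof (rule F_eq[OF that(1)])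
      fix u assume "x u \<noteq> 0"
      then have "u \<in> \<sigma>" using sup that by blast
      then show "lev u \<le> k" unfolding k_def using fin[OF \<sigma>] by (intro Max_ge) auto
    qed
    have c1: "continuous_map ?Z euclideanreal fst"
      by (rule continuous_map_into_fulltopology[OF continuous_map_fst])
    have c2: "continuous_map ?Z euclideanreal (\<lambda>z. snd z u)" for u
    proof -
      have "continuous_map ?Z (powertop_real UNIV) snd"
        by (rule continuous_map_into_fulltopology[OF continuous_map_snd])
      then show ?thesis by (simp add: continuous_map_componentwise_UNIV)
    qed
    have s2: "{u. snd z u \<noteq> 0} \<subseteq> \<sigma>" if "z \<in> topspace ?Z" for z
      using that sup[of "snd z"] unfolding Zs by (simp add: mem_Times_iff)
    have "(\<forall>u. continuous_map ?Z euclideanreal (\<lambda>z. flow lev r k (fst z) (snd z) u)) \<and>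
      (\<exists>S. finite S \<and> (\<forall>z\<in>topspace ?Z. {u. flow lev r k (fst z) (snd z) u \<noteq> 0} \<subseteq> S))"
      by (rule flow_continuous[OF c1 finr fin[OF \<sigma>]]) (use s2 c2 in auto)
    then have fc: "\<And>u. continuous_map ?Z euclideanreal (\<lambda>z. flow lev r k (fst z) (snd z) u)"
      and "\<exists>S. finite S \<and> (\<forall>z\<in>topspace ?Z. {u. flow lev r k (fst z) (snd z) u \<noteq> 0} \<subseteq> S)"
      by blast+
    then obtain S where S: "finite S" "\<And>z. z \<in> topspace ?Z \<Longrightarrow> {u. flow lev r k (fst z) (snd z) u \<noteq> 0} \<subseteq> S" by blast
    have "continuous_map ?Z euclideanreal (\<lambda>z. F (fst z) (snd z) u)" for u
    proof (rule continuous_map_eq[OF fc[of u]])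
      fix z assume "z \<in> topspace ?Z"
      then show "flow lev r k (fst z) (snd z) u = F (fst z) (snd z) u" unfolding Zs using Fk by auto
    qed
    moreover have "{u. F t x u \<noteq> 0} \<subseteq> S" if "x \<in> Y \<inter> csimplex \<sigma>" "t \<in> {0..1}" for t x
      using S(2)[of "(t, x)"] that Fk[of x t] unfolding Zs by simp
    ultimately show ?thesis using S(1) by blast
  qed
  show ?thesis
  proof (rule contractible_realizationI[OF fin face YK Y_closed, where F = F and \<kappa> = \<kappa>])
    show "F t x \<in> Y" if "x \<in> Y" "t \<in> {0..1}" for t x
      unfolding F_def using flow_in[OF that(1) topD[OF that(1)]] .
    show "F 0 x = x" if "x \<in> Y" for x unfolding F_def by (rule flow_early) simp
    show "F 1 x = \<kappa>" if "x \<in> Y" for x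
    proof -
      have "F 1 x = flow lev r (Suc (top x)) 1 x"
        using topD[OF that] by (intro F_eq[OF that]) (simp add: le_SucI)
      also have "\<dots> = \<kappa>" using topD[OF that] by (intro flow_1[OF that]) (simp add: le_SucI)
      finally show ?thesis .
    qed
  qed (use cont in blast)+
qed

section \<open>The coned-off Cayley graph\<close>

lemma walk_iff: "walk E xs \<longleftrightarrow> xs \<noteq> [] \<and> successively E xs"
  by (auto simp: walk_def successively_conv_nth)

text \<open>Translates the distance defined by vertex lists. As edges end in \<open>A\<close>, a
  walk that starts in \<open>A\<close> remains there, which gives the condition on
  \<open>set xs\<close>.\<close>

lemma walk_wreach:
  assumes "\<And>a b. E a b \<Longrightarrow> b \<in> A" "u \<in> A"
  shows "(\<exists>xs. walk E xs \<and> set xs \<subseteq> A \<and> hd xs = u \<and> last xs = v \<and> length xs = Suc n)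
    \<longleftrightarrow> wreach E unit_weight u v n"
proof
  assume "\<exists>xs. walk E xs \<and> set xs \<subseteq> A \<and> hd xs = u \<and> last xs = v \<and> length xs = Suc n"
  then obtain xs where "successively E xs" "hd xs = u" "last xs = v" "length xs = Suc n"
    by (auto simp: walk_iff)
  then show "wreach E unit_weight u v n"
  proof (induction n arbitrary: xs u)
    case 0
    then show ?case by (cases xs) (auto intro: wreach.intros)
  next
    case (Suc n)
    then obtain ys where xs: "xs = u # ys" by (cases xs) auto
    moreover have "ys \<noteq> []" using Suc.prems(4) xs by auto
    ultimately have ys: "xs = u # ys" "ys \<noteq> []" by auto
    then have "wreach E unit_weight (hd ys) v n"
      using Suc.prems by (intro Suc.IH[of ys]) (auto simp: successively_Cons)
    then have "wreach E unit_weight u v (unit_weight u (hd ys) + n)"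
      using Suc.prems(1) ys by (intro wreach_step) (auto simp: successively_Cons)
    moreover have "unit_weight u (hd ys) + n = Suc n" by (simp add: unit_weight_def)
    ultimately show ?case by simp
  qed
next
  assume "wreach E unit_weight u v n"
  then show "\<exists>xs. walk E xs \<and> set xs \<subseteq> A \<and> hd xs = u \<and> last xs = v \<and> length xs = Suc n"
    using assms(2)
  proof (induction rule: wreach.induct)
    case (wreach_refl u)
    then show ?case by (intro exI[of _ "[u]"]) (auto simp: walk_iff)
  next
    case (wreach_step u v w k)
    then obtain xs where "walk E xs \<and> set xs \<subseteq> A \<and> hd xs = v \<and> last xs = w \<and> length xs = Suc k"
      using assms(1) by blast
    then show ?case using wreach_step
      by (intro exI[of _ "u # xs"]) (auto simp: walk_iff successively_Cons unit_weight_def)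
  qed
qed

lemma gdist_wdist:
  assumes "\<And>a b. E a b \<Longrightarrow> b \<in> A" "u \<in> A"
  shows "gdist A E u v = wdist E unit_weight u v"
  unfolding gdist_def wdist_def using walk_wreach[OF assms] by simp

lemma wreach_map:
  assumes "wreach E \<omega> u v k" "\<And>a b. E a b \<Longrightarrow> E' (f a) (f b) \<and> \<omega>' (f a) (f b) = \<omega> a b"
  shows "wreach E' \<omega>' (f u) (f v) k"
  using assms(1)
proof (induction rule: wreach.induct)
  case (wreach_step u v w k)
  then show ?case using wreach.wreach_step[of E' "f u" "f v" \<omega>' "f w" k] assms(2) by metis
qed (rule wreach_refl)

lemma finite_wreach_ball:
  assumes "\<And>u. finite {v. E u v}"
  shows "finite {w. wreach E unit_weight u w k}"
proof (induction k arbitrary: u)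
  case 0
  have "{w. wreach E unit_weight u w 0} \<subseteq> {u}"
    by (auto elim: wreach.cases simp: unit_weight_def)
  then show ?case using finite_subset by blast
next
  case (Suc k)
  have sub: "{w. wreach E unit_weight u w (Suc k)} \<subseteq> (\<Union>v\<in>{v. E u v}. {w. wreach E unit_weight v w k})"
  proof
    fix w assume "w \<in> {w. wreach E unit_weight u w (Suc k)}"
    then have "wreach E unit_weight u w (Suc k)" by simp
    then show "w \<in> (\<Union>v\<in>{v. E u v}. {w. wreach E unit_weight v w k})"
    proof (cases rule: wreach.cases)
      case (wreach_step v k')
      then have "k' = k" by (simp add: unit_weight_def)
      then show ?thesis using wreach_step by blast
    qed
  qed
  show ?case by (rule finite_subset[OF sub]) (intro finite_UN_I assms Suc.IH)
qed

locale cayley_pair = group G for G :: "('a, 'b) monoid_scheme" (structure) +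
  fixes S :: "'a set" and Ps :: "'a set set"
  assumes finS: "finite S" and S_sub: "S \<subseteq> carrier G" and gen: "generate G S = carrier G"
    and finP: "finite Ps" and subP: "\<forall>P\<in>Ps. subgroup P G"
begin

abbreviation "VV \<equiv> Inl ` carrier G :: ('a + 'a set) set"
abbreviation "XX \<equiv> cverts G Ps"
abbreviation "EE \<equiv> coned_edge G S Ps"
abbreviation "act \<equiv> vmap G"

lemma act_simps [simp]: "act g (Inl a) = Inl (g \<otimes> a)" "act g (Inr C) = Inr (g <# C)"
  by (simp_all add: vmap_def)

lemma coset_sub: "C \<in> coset_verts G Ps \<Longrightarrow> C \<subseteq> carrier G"
  using subP by (auto simp: coset_verts_def l_coset_def dest: subgroup.mem_carrier)

lemma coset_ne: "C \<in> coset_verts G Ps \<Longrightarrow> C \<noteq> {}"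
  using subP by (auto simp: coset_verts_def l_coset_def dest: subgroup.one_closed)

lemma coset_shift:
  assumes "g \<in> carrier G" "C \<in> coset_verts G Ps"
  shows "g <# C \<in> coset_verts G Ps"
proof -
  obtain a P where aP: "a \<in> carrier G" "P \<in> Ps" "C = a <# P" using assms(2) by (auto simp: coset_verts_def)
  then have "P \<subseteq> carrier G" using subP subgroup.subset by blast
  then have "g <# C = (g \<otimes> a) <# P" using aP assms(1) lcos_m_assoc by simp
  then show ?thesis unfolding coset_verts_def using aP assms(1) by blast
qed

lemma act_in: "g \<in> carrier G \<Longrightarrow> u \<in> XX \<Longrightarrow> act g u \<in> XX"
  by (auto simp: cverts_def coset_shift)

lemma act_mult: "\<lbrakk>g \<in> carrier G; h \<in> carrier G; u \<in> XX\<rbrakk> \<Longrightarrow> act (g \<otimes> h) u = act g (act h u)"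
  by (auto simp: cverts_def m_assoc lcos_m_assoc coset_sub)

lemma act_one: "u \<in> XX \<Longrightarrow> act \<one> u = u"
  by (auto simp: cverts_def lcos_mult_one coset_sub)

lemma act_inv:
  assumes "g \<in> carrier G" "u \<in> XX"
  shows "act (inv g) (act g u) = u" "act g (act (inv g) u) = u"
  using act_mult[of "inv g" g u] act_mult[of g "inv g" u] act_one assms by auto

lemma act_inj: "\<lbrakk>g \<in> carrier G; u \<in> XX; v \<in> XX\<rbrakk> \<Longrightarrow> act g u = act g v \<longleftrightarrow> u = v"
  using act_inv(1) by metis

lemma act_V: "g \<in> carrier G \<Longrightarrow> u \<in> XX \<Longrightarrow> act g u \<in> VV \<longleftrightarrow> u \<in> VV"
  by (auto simp: cverts_def)

lemma cay_sym: "cay_edge G S a b \<Longrightarrow> cay_edge G S b a"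
  by (auto simp: cay_edge_def)

lemma cay_act:
  assumes "g \<in> carrier G" "cay_edge G S a b"
  shows "cay_edge G S (g \<otimes> a) (g \<otimes> b)"
proof -
  from assms(2) obtain s where s: "s \<in> S" "b = a \<otimes> s \<or> a = b \<otimes> s"
    and ab: "a \<in> carrier G" "b \<in> carrier G" by (auto simp: cay_edge_def)
  have "s \<in> carrier G" using s S_sub by blast
  then have "g \<otimes> b = (g \<otimes> a) \<otimes> s \<or> g \<otimes> a = (g \<otimes> b) \<otimes> s" using s(2) ab assms(1) m_assoc by metis
  then show ?thesis using s(1) ab assms(1) by (auto simp: cay_edge_def)
qed

lemma EE_in: "EE u v \<Longrightarrow> u \<in> XX"
  by (auto simp: coned_edge_def cverts_def cay_edge_def)

lemma EE_sym: "EE u v \<Longrightarrow> EE v u"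
  using cay_sym by (auto simp: coned_edge_def)

lemma EE_V: "EE u v \<Longrightarrow> u \<in> VV \<or> v \<in> VV"
  by (auto simp: coned_edge_def cay_edge_def)

lemma EE_act:
  assumes g: "g \<in> carrier G" and "EE u v"
  shows "EE (act g u) (act g v)"
proof -
  have "g \<otimes> a \<in> g <# C" if "a \<in> C" for a C using that by (auto simp: l_coset_def)
  then show ?thesis using assms cay_act coset_shift unfolding coned_edge_def by fastforce
qed

lemma EE_Inl [simp]: "EE (Inl a) (Inl b) \<longleftrightarrow> cay_edge G S a b"
  by (auto simp: coned_edge_def)

lemma wreach_act:
  assumes g: "g \<in> carrier G" and \<omega>: "\<And>a b. a \<in> XX \<Longrightarrow> b \<in> XX \<Longrightarrow> \<omega> (act g a) (act g b) = \<omega> a b"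
    and "wreach EE \<omega> u v k"
  shows "wreach EE \<omega> (act g u) (act g v) k"
  using assms(3) by (rule wreach_map) (use EE_act[OF g] \<omega> EE_in EE_sym in blast)

lemma wdist_act:
  assumes g: "g \<in> carrier G" and uv: "u \<in> XX" "v \<in> XX"
    and \<omega>: "\<And>g a b. g \<in> carrier G \<Longrightarrow> a \<in> XX \<Longrightarrow> b \<in> XX \<Longrightarrow> \<omega> (act g a) (act g b) = \<omega> a b"
  shows "wdist EE \<omega> (act g u) (act g v) = wdist EE \<omega> u v"
proof -
  have imp: "wreach EE \<omega> (act g u) (act g v) k"
    if "g \<in> carrier G" "wreach EE \<omega> u v k" for g u v k
    by (rule wreach_act[OF that(1) _ that(2)]) (rule \<omega>[OF that(1)])
  have "wreach EE \<omega> (act g u) (act g v) k \<longleftrightarrow> wreach EE \<omega> u v k" for k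
    using imp[OF g, of u v k] imp[OF inv_closed[OF g], of "act g u" "act g v" k]
    by (auto simp: act_inv(1)[OF g] uv)
  then show ?thesis by (simp add: wdist_def)
qed

text \<open>Words act on the right, so the starting point \<open>a\<close> has to vary in the
  induction. An inverse generator is an edge read backwards.\<close>

lemma cay_step:
  assumes "g \<in> generate G S" "a \<in> carrier G"
  shows "\<exists>k. wreach (cay_edge G S) unit_weight a (a \<otimes> g) k"
  using assms
proof (induction arbitrary: a rule: generate.induct)
  case one
  then show ?case using wreach_refl by (metis r_one)
next
  case (incl s)
  then have "cay_edge G S a (a \<otimes> s)" using S_sub by (auto simp: cay_edge_def)
  then show ?case using wreach_edge by fast
next
  case (inv s)
  then have s: "s \<in> carrier G" using S_sub by auto
  then have "a = (a \<otimes> inv s) \<otimes> s" using inv.prems by (simp add: m_assoc)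
  then have "cay_edge G S a (a \<otimes> inv s)" using s inv by (auto simp: cay_edge_def)
  then show ?case using wreach_edge by fast
next
  case (eng h1 h2)
  have c: "h1 \<in> carrier G" "h2 \<in> carrier G" using eng gen by auto
  obtain j where "wreach (cay_edge G S) unit_weight a (a \<otimes> h1) j" using eng by blast
  moreover obtain k where "wreach (cay_edge G S) unit_weight (a \<otimes> h1) (a \<otimes> h1 \<otimes> h2) k"
    using eng c by blast
  ultimately show ?case using wreach_trans c eng.prems by (metis m_assoc)
qed

lemma cay_conn:
  assumes "a \<in> carrier G" "b \<in> carrier G"
  shows "\<exists>k. wreach (cay_edge G S) unit_weight a b k"
proof -
  have "a \<otimes> (inv a \<otimes> b) = b" using assms by (simp flip: m_assoc)
  then show ?thesis using cay_step[of "inv a \<otimes> b" a] gen assms by simp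
qed

abbreviation "EV \<equiv> \<lambda>u v. EE u v \<and> u \<in> VV \<and> v \<in> VV"

lemma EV_wreach: "wreach EV unit_weight (Inl a) (Inl b) k \<longleftrightarrow> wreach (cay_edge G S) unit_weight a b k"
proof
  assume "wreach EV unit_weight (Inl a) (Inl b) k"
  then have "wreach (cay_edge G S) unit_weight (projl (Inl a :: 'a + 'a set)) (projl (Inl b :: 'a + 'a set)) k"
    by (rule wreach_map[where f = projl and E = EV and \<omega> = unit_weight])
      (auto simp: unit_weight_def)
  then show "wreach (cay_edge G S) unit_weight a b k" by simp
next
  assume "wreach (cay_edge G S) unit_weight a b k"
  then show "wreach EV unit_weight (Inl a) (Inl b) k"
    by (rule wreach_map) (auto simp: unit_weight_def cay_edge_def)
qed

lemma word_dist_wdist: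
  "a \<in> carrier G \<Longrightarrow> word_dist G S a b = wdist EV unit_weight (Inl a) (Inl b)"
  unfolding word_dist_def
  by (subst gdist_wdist) (auto simp: cay_edge_def wdist_def EV_wreach)

lemma word_dist_act:
  assumes "g \<in> carrier G" "a \<in> carrier G" "b \<in> carrier G"
  shows "word_dist G S (g \<otimes> a) (g \<otimes> b) = word_dist G S a b"
proof -
  have *: "wreach (cay_edge G S) unit_weight (g \<otimes> a) (g \<otimes> b) k"
    if "wreach (cay_edge G S) unit_weight a b k" "g \<in> carrier G" for g a b k
    using that(1) by (rule wreach_map) (auto simp: unit_weight_def cay_act[OF that(2)])
  have "inv g \<otimes> (g \<otimes> a) = a" "inv g \<otimes> (g \<otimes> b) = b" using assms by (simp_all flip: m_assoc)
  then have "wreach (cay_edge G S) unit_weight (g \<otimes> a) (g \<otimes> b) k \<longleftrightarrow> wreach (cay_edge G S) unit_weight a b k" for k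
    using *[of "g \<otimes> a" "g \<otimes> b" k "inv g"] *[of a b k g] assms by auto
  then show ?thesis using assms by (simp add: word_dist_wdist wdist_def EV_wreach)
qed

lemma finite_cay_nbrs: "finite {b. cay_edge G S a b}"
proof -
  have "{b. cay_edge G S a b} \<subseteq> (\<lambda>s. a \<otimes> s) ` S \<union> (\<lambda>s. a \<otimes> inv s) ` S"
  proof
    fix b assume "b \<in> {b. cay_edge G S a b}"
    then obtain s where s: "s \<in> S" "b = a \<otimes> s \<or> a = b \<otimes> s" "a \<in> carrier G" "b \<in> carrier G"
      by (auto simp: cay_edge_def)
    then have "s \<in> carrier G" using S_sub by blast
    then have "b = a \<otimes> s \<or> b = a \<otimes> inv s" using s by (auto simp: m_assoc)
    then show "b \<in> (\<lambda>s. a \<otimes> s) ` S \<union> (\<lambda>s. a \<otimes> inv s) ` S" using s by blast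
  qed
  then show ?thesis using finS finite_subset by blast
qed

lemma finite_word_ball: "finite {b \<in> carrier G. word_dist G S a b \<le> D}" if a: "a \<in> carrier G"
proof -
  have "{b \<in> carrier G. word_dist G S a b \<le> D} \<subseteq> (\<Union>k\<le>D. {b. wreach (cay_edge G S) unit_weight a b k})"
  proof
    fix b assume b: "b \<in> {b \<in> carrier G. word_dist G S a b \<le> D}"
    have "word_dist G S a b = (LEAST k. wreach (cay_edge G S) unit_weight a b k)"
      using a by (simp add: word_dist_wdist wdist_def EV_wreach)
    moreover have "\<exists>k. wreach (cay_edge G S) unit_weight a b k" using cay_conn[OF a, of b] b by simp
    ultimately have "wreach (cay_edge G S) unit_weight a b (word_dist G S a b)"
      by (simp only: LeastI_ex)
    then show "b \<in> (\<Union>k\<le>D. {b. wreach (cay_edge G S) unit_weight a b k})" using b by blast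
  qed
  then show ?thesis by (rule finite_subset) (auto intro: finite_wreach_ball finite_cay_nbrs)
qed

text \<open>A left coset of \<open>P\<close> that contains the identity is \<open>P\<close> itself,
  so the cone points next to the identity correspond to members of the finite set
  \<open>Ps\<close>.\<close>

lemma finite_nbrs_one: "finite {u. EE (Inl \<one>) u}"
proof -
  have "C \<in> Ps" if C: "C \<in> coset_verts G Ps" "\<one> \<in> C" for C
  proof -
    obtain a P where aP: "a \<in> carrier G" "P \<in> Ps" "C = a <# P" using C by (auto simp: coset_verts_def)
    interpret P: subgroup P G using subP aP by blast
    obtain p where p: "p \<in> P" "\<one> = a \<otimes> p" using C aP by (auto simp: l_coset_def)
    then have "a = inv p" using aP(1) P.mem_carrier[OF p(1)] inv_equality[of a p] by simp
    then have "a \<in> P" using p by simp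
    then have "C = P" using aP coset_join3[OF aP(1) P.subgroup_axioms] by simp
    then show ?thesis using aP by simp
  qed
  then have "{u. EE (Inl \<one>) u} \<subseteq> Inl ` {b. cay_edge G S \<one> b} \<union> Inr ` Ps"
    by (auto simp: coned_edge_def)
  then show ?thesis using finite_cay_nbrs finP by (meson finite_Un finite_imageI finite_subset)
qed

lemma circuit_act:
  assumes "g \<in> carrier G" "circuit EE c" "set c \<subseteq> XX"
  shows "circuit EE (map (act g) c)"
proof -
  have "inj_on (act g) (set c)" using assms act_inj by (meson inj_onI subsetD)
  moreover have "map (act g) c ! ((i + 1) mod length c) = act g (c ! ((i + 1) mod length c))"
    if "i < length c" for i using that by (intro nth_map mod_less_divisor) linarith
  ultimately show ?thesis using assms EE_act[OF assms(1)]
    by (auto simp: circuit_def distinct_map)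
qed

lemma circuit_in: "circuit EE c \<Longrightarrow> set c \<subseteq> XX"
  using EE_in by (fastforce simp: circuit_def in_set_conv_nth)

text \<open>Translate a group element on the circuit to the identity. Finitely many edges start
  there, and by fineness each lies on finitely many circuits of every length up to \<open>n\<close>.
  So only finitely many vertices occur on such circuits, and their word distances from the identity
  have a maximum.\<close>

lemma circuits_bounded_of_fine:
  assumes "fine_graph XX EE"
  shows "\<exists>D. \<forall>c. circuit EE c \<and> length c \<le> n \<longrightarrow>
     (\<forall>p\<in>set c \<inter> VV. \<forall>q\<in>set c \<inter> VV. wdist EV unit_weight p q \<le> D)"
proof -
  let ?C = "\<lambda>u m. {c. circuit EE c \<and> set c \<subseteq> XX \<and> length c = m \<and> edge_in_circuit (Inl \<one>) u c}"
  let ?all = "\<Union>u\<in>{u. EE (Inl \<one>) u}. \<Union>m\<in>{..n}. \<Union>c\<in>?C u m. set c"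
  have "finite (?C u m)" if "EE (Inl \<one>) u" for u m
    using assms that EE_in EE_sym unfolding fine_graph_def by blast
  then have "finite ?all" using finite_nbrs_one by auto
  then have "finite (wdist EV unit_weight (Inl \<one>) ` ?all)" by simp
  then obtain D where D: "\<And>q. q \<in> ?all \<Longrightarrow> wdist EV unit_weight (Inl \<one>) q \<le> D"
    using finite_nat_set_iff_bounded_le by (meson imageI)
  have "wdist EV unit_weight p q \<le> D"
    if c: "circuit EE c" "length c \<le> n" and p: "p \<in> set c \<inter> VV" and q: "q \<in> set c \<inter> VV" for c p q
  proof -
    obtain g h where gh: "p = Inl g" "q = Inl h" "g \<in> carrier G" "h \<in> carrier G" using p q by blast
    let ?c = "map (act (inv g)) c"
    have c': "circuit EE ?c" "set ?c \<subseteq> XX"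
      using circuit_act[of "inv g" c] c gh circuit_in by blast+
    obtain i where i: "i < length c" "c ! i = p" using p by (auto simp: in_set_conv_nth)
    have one: "?c ! i = Inl \<one>" using i gh by simp
    let ?u = "?c ! ((i + 1) mod length ?c)"
    have edge: "EE (Inl \<one>) ?u" using c'(1) i one unfolding circuit_def by (metis length_map)
    moreover have "edge_in_circuit (Inl \<one>) ?u ?c"
      unfolding edge_in_circuit_def using i one by (metis length_map)
    ultimately have "?c \<in> ?C ?u (length c)" using c' by simp
    moreover have "length c \<in> {..n}" using c(2) by simp
    moreover have "?u \<in> {u. EE (Inl \<one>) u}" using edge by simp
    ultimately have "set ?c \<subseteq> ?all" by blast
    moreover have "Inl (inv g \<otimes> h) \<in> set ?c" using q gh by force
    ultimately have "wdist EV unit_weight (Inl \<one>) (Inl (inv g \<otimes> h)) \<le> D" using D by blast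
    moreover
    have "word_dist G S (inv g \<otimes> g) (inv g \<otimes> h) = word_dist G S g h"
      using word_dist_act[of "inv g" g h] gh by blast
    then have "word_dist G S \<one> (inv g \<otimes> h) = word_dist G S g h" using gh by simp
    ultimately show ?thesis using gh by (simp add: word_dist_wdist)
  qed
  then show ?thesis by blast
qed

text \<open>Clearing the denominators in the Gromov products doubles \<delta>; rounding up to a
  natural number only weakens the inequality.\<close>

lemma relhyp_graph_of_hyperbolic:
  assumes fine: "fine_graph XX EE" and hyp: "hyperbolic_graph XX EE \<delta>"
  shows "relhyp_graph XX EE VV (nat \<lceil>2 * \<delta>\<rceil>)"
proof -
  have VX: "VV \<subseteq> XX" by (auto simp: cverts_def)
  interpret A: ugraph XX EE
  proof
    fix u v assume uv: "u \<in> XX" "v \<in> XX"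
    then obtain xs where xs: "walk EE xs" "set xs \<subseteq> XX" "hd xs = u" "last xs = v"
      using hyp unfolding hyperbolic_graph_def graph_connected_def by blast
    then have "length xs = Suc (length xs - 1)" by (auto simp: walk_def)
    then have "wreach EE unit_weight u v (length xs - 1)"
      using xs uv walk_wreach[of EE XX u v "length xs - 1"] EE_in EE_sym by blast
    then show "\<exists>k. wreach EE unit_weight u v k" by blast
  qed (auto simp: unit_weight_def EE_in intro: EE_sym)
  interpret B: ugraph VV EV
  proof
    fix u v assume "u \<in> VV" "v \<in> VV"
    then show "\<exists>k. wreach EV unit_weight u v k" using cay_conn EV_wreach by fast
  qed (auto simp: unit_weight_def intro: EE_sym)
  have gd: "gdist XX EE u v = A.h u v" if "u \<in> XX" for u v
    using gdist_wdist[of EE XX u v] EE_in EE_sym that by blast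
  show ?thesis
  proof
    show "VV \<subseteq> XX" by fact
    show "EE u v \<Longrightarrow> u \<in> VV \<or> v \<in> VV" for u v by (rule EE_V)
    show "\<exists>D. \<forall>c. circuit EE c \<and> length c \<le> n \<longrightarrow>
       (\<forall>p\<in>set c \<inter> VV. \<forall>q\<in>set c \<inter> VV. B.h p q \<le> D)" for n
      using circuits_bounded_of_fine[OF fine] .
    fix w x y z assume X: "w \<in> XX" "x \<in> XX" "y \<in> XX" "z \<in> XX"
    have "gromov_prod (gdist XX EE) w x z \<ge>
          min (gromov_prod (gdist XX EE) w x y) (gromov_prod (gdist XX EE) w y z) - \<delta>"
      using hyp X unfolding hyperbolic_graph_def by blast
    then have "min ((real (A.h w x) + real (A.h w y) - real (A.h x y)) / 2)
        ((real (A.h w y) + real (A.h w z) - real (A.h y z)) / 2) - \<delta>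
        \<le> (real (A.h w x) + real (A.h w z) - real (A.h x z)) / 2"
      by (simp only: gromov_prod_def gd[OF X(1)] gd[OF X(2)] gd[OF X(3)])
    then have "(real (A.h w x) + real (A.h w y) - real (A.h x y)) / 2 - \<delta>
        \<le> (real (A.h w x) + real (A.h w z) - real (A.h x z)) / 2 \<or>
        (real (A.h w y) + real (A.h w z) - real (A.h y z)) / 2 - \<delta>
        \<le> (real (A.h w x) + real (A.h w z) - real (A.h x z)) / 2"
      by (simp add: min_def split: if_splits)
    then have "real (A.h x z) + real (A.h w y) \<le> real (A.h x y) + real (A.h w z) + 2 * \<delta> \<or>
        real (A.h x z) + real (A.h w y) \<le> real (A.h y z) + real (A.h w x) + 2 * \<delta>"
      by (auto simp: field_simps)
    then have "real (A.h x z) + real (A.h w y) \<le>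
        max (real (A.h x y) + real (A.h w z)) (real (A.h y z) + real (A.h w x)) + 2 * \<delta>"
      by linarith
    also have "\<dots> \<le> max (real (A.h x y) + real (A.h w z)) (real (A.h y z) + real (A.h w x)) + real (nat \<lceil>2 * \<delta>\<rceil>)"
      using real_nat_ceiling_ge[of "2 * \<delta>"] by linarith
    finally show "A.h x z + A.h w y \<le> max (A.h x y + A.h w z) (A.h y z + A.h w x) + nat \<lceil>2 * \<delta>\<rceil>"
      by (simp add: max_def split: if_splits)
  qed
qed

end

section \<open>Fixed points in the Rips complex\<close>

locale rips_setting = cayley_pair G S Ps +
  relhyp_weighted "cverts G Ps" "coned_edge G S Ps" "Inl ` carrier G" \<delta> n K M
  for G :: "('a, 'b) monoid_scheme" (structure) and S Ps \<delta> n K M +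
  assumes n_large: "(2 * (K + M) + 1) * (2 * (K + M) + 3) + 6 * (2 * (K + M)) \<le> n"
begin

definition adj :: "'a + 'a set \<Rightarrow> 'a + 'a set \<Rightarrow> bool" where
  "adj u v \<longleftrightarrow> W.d u v \<le> n + ht u + ht v"

lemma W_act: "\<lbrakk>g \<in> carrier G; u \<in> XX; v \<in> XX\<rbrakk> \<Longrightarrow> W.d (act g u) (act g v) = W.d u v"
  by (rule wdist_act) (auto simp: cone_weight_def act_V)

lemma h_act: "\<lbrakk>g \<in> carrier G; u \<in> XX; v \<in> XX\<rbrakk> \<Longrightarrow> h (act g u) (act g v) = h u v"
  by (rule wdist_act) (auto simp: unit_weight_def)

lemma ht_act: "\<lbrakk>g \<in> carrier G; u \<in> XX\<rbrakk> \<Longrightarrow> ht (act g u) = ht u"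
  by (simp add: ht_def act_V)

lemma adj_refl [simp]: "adj u u"
  by (simp add: adj_def)

lemma adj_sym: "u \<in> XX \<Longrightarrow> v \<in> XX \<Longrightarrow> adj u v \<longleftrightarrow> adj v u"
  using W.d_sym[of u v] by (auto simp: adj_def)

lemma near_elems: "u \<in> XX \<Longrightarrow> near u = Inl ` elems u"
  by (auto simp: near_def cverts_def coned_edge_def dest: subsetD[OF coset_sub])

lemma elems_ne: "u \<in> XX \<Longrightarrow> elems u \<noteq> {}"
  using coset_ne by (auto simp: cverts_def)

lemma elems_sub: "u \<in> XX \<Longrightarrow> elems u \<subseteq> carrier G"
  by (auto simp: cverts_def dest: subsetD[OF coset_sub])

text \<open>\<open>dS\<close> is a least value and hence attained, and \<open>near u\<close>
  consists of the copies of \<open>elems u\<close>. Then \<open>near_adjacent\<close> applies with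
  weight \<open>n\<close>, where \<open>n < 2 * n\<close> because \<open>n\<close> is
  positive.\<close>

lemma dS_adj:
  assumes "u \<in> XX" "v \<in> XX" "u \<noteq> v"
  shows "dS G S u v \<le> n \<longleftrightarrow> adj u v"
proof -
  let ?P = "\<lambda>k. \<exists>a\<in>elems u. \<exists>b\<in>elems v. word_dist G S a b = k"
  have ex: "\<exists>k. ?P k" using elems_ne assms by blast
  have "dS G S u v \<le> n \<longleftrightarrow> (\<exists>k\<le>n. ?P k)"
  proof
    assume "dS G S u v \<le> n"
    moreover have "?P (dS G S u v)" unfolding dS_def by (rule LeastI_ex[OF ex])
    ultimately show "\<exists>k\<le>n. ?P k" by blast
  next
    assume "\<exists>k\<le>n. ?P k"
    then obtain k where k: "k \<le> n" "?P k" by blast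
    have "dS G S u v \<le> k" unfolding dS_def by (rule Least_le[of ?P, OF k(2)])
    then show "dS G S u v \<le> n" using k(1) by simp
  qed
  also have "\<dots> \<longleftrightarrow> (\<exists>a\<in>elems u. \<exists>b\<in>elems v. S.h (Inl a) (Inl b) \<le> n)"
    using elems_sub[OF assms(1)] by (auto simp: word_dist_wdist subset_iff)
  also have "\<dots> \<longleftrightarrow> (\<exists>a\<in>near u. \<exists>b\<in>near v. S.h a b \<le> n)"
    using near_elems assms by simp
  also have "\<dots> \<longleftrightarrow> adj u v"
    unfolding adj_def using assms \<tau>_pos by (intro near_adjacent) auto
  finally show ?thesis .
qed

lemma rips_simplices_iff:
  "\<sigma> \<in> rips_simplices G S Ps n \<longleftrightarrow> finite \<sigma> \<and> \<sigma> \<noteq> {} \<and> \<sigma> \<subseteq> XX \<and> (\<forall>u\<in>\<sigma>. \<forall>v\<in>\<sigma>. adj u v)"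
  unfolding rips_simplices_def using dS_adj adj_refl by (smt (verit, best) mem_Collect_eq subsetD)

text \<open>An infinite subgroup cannot fix two vertices up to finite index: it would move the exit
  point of a geodesic from one of them to the other only a bounded distance.\<close>

lemma finite_of_finite_orbits:
  assumes H: "subgroup H G" and uc: "u \<in> XX" "c \<in> XX" "u \<noteq> c"
    and fin: "finite ((\<lambda>h. act h u) ` H)" "finite ((\<lambda>h. act h c) ` H)"
  shows "finite H"
proof -
  have Hc: "h \<in> carrier G" if "h \<in> H" for h using subgroup.mem_carrier[OF H that] .
  \<comment> \<open>The stabiliser of both vertices. The fibres of \<open>?f\<close> below are
    contained in left translates of \<open>Q\<close>, and \<open>?f\<close> has finitely many values
    on \<open>H\<close>.\<close>
  define Q where "Q = {k \<in> H. act k u = u \<and> act k c = c}"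
  have finQ: "finite Q"
  proof (cases "u \<in> VV")
    case True
    then obtain a where a: "u = Inl a" "a \<in> carrier G" by blast
    have "Q \<subseteq> {\<one>}"
    proof
      fix k assume k: "k \<in> Q"
      then have "k \<otimes> a = a" "k \<in> carrier G" using a Hc by (auto simp: Q_def)
      then show "k \<in> {\<one>}" using a r_cancel_one by simp
    qed
    then show ?thesis using finite_subset by blast
  next
    case False
    obtain v where v: "EE u v" "v \<in> XX" "h u c = 1 + h v c" using h_step[OF uc] .
    have vV: "v \<in> VV" using EE_V[OF v(1)] False by blast
    then obtain a where a: "v = Inl a" "a \<in> carrier G" by blast
    obtain D where D: "\<And>v'. \<lbrakk>EE u v'; Suc (h v' c) = h u c\<rbrakk> \<Longrightarrow> S.h v v' \<le> D"
    proof -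
      from exits_close[of "h u c"] obtain D where D: "\<forall>w\<in>XX - VV. \<forall>b\<in>XX. \<forall>v v'. w \<noteq> b \<longrightarrow>
        h w b = h u c \<longrightarrow> EE w v \<longrightarrow> EE w v' \<longrightarrow> Suc (h v b) = h u c \<longrightarrow> Suc (h v' b) = h u c \<longrightarrow> S.h v v' \<le> D" ..
      have "u \<in> XX - VV" "Suc (h v c) = h u c" using uc False v(3) by simp_all
      note D' = D[rule_format, OF this(1) uc(2,3) refl v(1) _ this(2)]
      show ?thesis by (rule that[of D], rule D')
    qed
    \<comment> \<open>An element of \<open>Q\<close> sends the exit \<open>v\<close> from
      \<open>u\<close> towards \<open>c\<close> to another such exit, and is determined by the image
      of \<open>v\<close>.\<close>
    have "k \<otimes> a \<in> {b \<in> carrier G. word_dist G S a b \<le> D}" if k: "k \<in> Q" for k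
    proof -
      have k': "k \<in> carrier G" "act k u = u" "act k c = c" using k Hc by (auto simp: Q_def)
      have "EE u (act k v)" using EE_act[OF k'(1) v(1)] k' by simp
      moreover have "h (act k v) c = h v c" using h_act[OF k'(1) v(2) uc(2)] k' by simp
      ultimately have "S.h v (act k v) \<le> D" using D v(3) by simp
      then show ?thesis using a k' by (simp add: word_dist_wdist)
    qed
    then have "(\<lambda>k. k \<otimes> a) ` Q \<subseteq> {b \<in> carrier G. word_dist G S a b \<le> D}" by blast
    then have "finite ((\<lambda>k. k \<otimes> a) ` Q)" using finite_word_ball[OF a(2)] finite_subset by blast
    moreover have "inj_on (\<lambda>k. k \<otimes> a) Q" using a Hc by (intro inj_onI) (auto simp: Q_def)
    ultimately show ?thesis using finite_imageD by blast
  qed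
  let ?f = "\<lambda>h. (act h u, act h c)"
  have "finite (?f ` H)"
    by (rule finite_subset[of _ "((\<lambda>h. act h u) ` H) \<times> ((\<lambda>h. act h c) ` H)"]) (use fin in auto)
  moreover have "finite {h \<in> H. ?f h = y}" if y: "y \<in> ?f ` H" for y
  proof -
    obtain h0 where h0: "h0 \<in> H" "y = ?f h0" using y by blast
    have "{h \<in> H. ?f h = y} \<subseteq> (\<lambda>k. h0 \<otimes> k) ` Q"
    proof
      fix h assume h: "h \<in> {h \<in> H. ?f h = y}"
      have "inv h0 \<otimes> h \<in> H" using H h h0 by (auto intro: subgroup.m_closed subgroup.m_inv_closed)
      moreover have "act (inv h0 \<otimes> h) w = w" if "w \<in> XX" "act h w = act h0 w" for w
        using act_mult[of "inv h0" h w] act_inv(1)[of h0 w] Hc h h0 that by auto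
      ultimately have "inv h0 \<otimes> h \<in> Q" using h h0 uc by (auto simp: Q_def)
      moreover have "h = h0 \<otimes> (inv h0 \<otimes> h)" using Hc h h0 by (simp flip: m_assoc)
      ultimately show "h \<in> (\<lambda>k. h0 \<otimes> k) ` Q" by blast
    qed
    then show ?thesis using finQ finite_subset by blast
  qed
  ultimately have "finite (\<Union>y\<in>?f ` H. {h \<in> H. ?f h = y})" by blast
  moreover have "H \<subseteq> (\<Union>y\<in>?f ` H. {h \<in> H. ?f h = y})" by blast
  ultimately show ?thesis by (rule rev_finite_subset)
qed

text \<open>What \<open>push\<close> provides, as a predicate on \<open>p\<close> so that a choice
  can be made and translated by the group. In terms of distances reduced by heights, every
  \<open>x\<close> no further from \<open>c\<close> than \<open>u\<close> becomes adjacent to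
  \<open>p\<close> or comes closer.\<close>

definition target :: "'a + 'a set \<Rightarrow> 'a + 'a set \<Rightarrow> 'a + 'a set \<Rightarrow> bool" where
  "target u c p \<longleftrightarrow> p \<in> XX \<and> adj u p \<and>
    (\<forall>x\<in>XX. x \<noteq> p \<longrightarrow> W.d c x + ht u \<le> W.d c u + ht x \<longrightarrow>
       adj p x \<or> W.d p x + ht u < W.d u x + ht p)"

lemma target_ex:
  assumes "u \<in> XX" "c \<in> XX" "n + ht u + ht c < W.d c u"
  shows "\<exists>p. target u c p"
proof -
  have "n + ht u + ht c < W.d u c" using assms W.d_sym by simp
  from push[OF n_large assms(1,2) this] show ?thesis unfolding target_def adj_def by blast
qed

lemma target_act:
  assumes g: "g \<in> carrier G" and uc: "u \<in> XX" "c \<in> XX" and t: "target u c p"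
  shows "target (act g u) (act g c) (act g p)"
proof -
  have p: "p \<in> XX" using t by (simp add: target_def)
  have "adj (act g p) x \<or> W.d (act g p) x + ht (act g u) < W.d (act g u) x + ht (act g p)"
    if x: "x \<in> XX" "x \<noteq> act g p" "W.d (act g c) x + ht (act g u) \<le> W.d (act g c) (act g u) + ht x" for x
  proof -
    let ?y = "act (inv g) x"
    have y: "?y \<in> XX" "act g ?y = x" using act_in act_inv(2) g x by auto
    have eq: "W.d (act g w) x = W.d w ?y" if "w \<in> XX" for w
      using W_act[OF g that y(1)] y(2) by simp
    have "ht x = ht ?y" using ht_act[OF g y(1)] y(2) by simp
    moreover have "?y \<noteq> p" using x y by auto
    ultimately show ?thesis
      using t y(1) x(3) eq uc p W_act[OF g] ht_act[OF g] unfolding target_def adj_def by simp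
  qed
  moreover have "adj (act g u) (act g p)"
    using t W_act[OF g uc(1) p] ht_act[OF g] uc p by (simp add: adj_def target_def)
  ultimately show ?thesis using act_in[OF g p] unfolding target_def by blast
qed

end

section \<open>Equivariant pushing towards an invariant clique\<close>

locale rips_fixed_setting = rips_setting +
  fixes H :: "'a set" and C :: "('a + 'a set) set"
  assumes H: "subgroup H G"
    and C: "finite C" "C \<noteq> {}" "C \<subseteq> XX" "\<And>u v. u \<in> C \<Longrightarrow> v \<in> C \<Longrightarrow> adj u v"
      "\<And>g u. g \<in> H \<Longrightarrow> u \<in> C \<Longrightarrow> act g u \<in> C"
begin

definition orb :: "'a + 'a set \<Rightarrow> ('a + 'a set) set" where
  "orb u = (\<lambda>g. act g u) ` H"

text \<open>The largest distance from a member of \<open>C\<close>, reduced by heights. Subtraction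
  is truncated, so \<open>rho u\<close> is known to be an exact difference only if it is
  positive.\<close>

definition rho :: "'a + 'a set \<Rightarrow> nat" where
  "rho u = Max ((\<lambda>c. W.d c u - (ht c + ht u)) ` C)"

text \<open>Truncation puts at level 1 exactly the vertices with \<open>rho u \<le> n\<close>, those
  adjacent to all of \<open>C\<close>.\<close>

definition lev :: "'a + 'a set \<Rightarrow> nat" where
  "lev u = rho u - n + 1"

text \<open>The choice takes the orbit as its argument, and is thereby the same for all members of
  an orbit.\<close>

definition sel :: "('a + 'a set) set \<Rightarrow> 'a + 'a set" where
  "sel O' = (SOME p. \<exists>u\<in>O'. \<exists>c\<in>C. W.d c u = rho u + (ht c + ht u) \<and> target u c p)"

text \<open>The stabiliser of \<open>u\<close> in \<open>H\<close> need not fix the selected target,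
  so mass goes to the whole orbit of the target. The empty set is a default that keeps
  \<open>nxt u\<close> finite for every \<open>u\<close>; on good sets \<open>sel_spec\<close>
  excludes it.\<close>

definition nxt :: "'a + 'a set \<Rightarrow> ('a + 'a set) set" where
  "nxt u = (if lev u = 1 then C else if finite (orb (sel (orb u))) then orb (sel (orb u)) else {})"

definition good :: "('a + 'a set) set \<Rightarrow> bool" where
  "good \<sigma> \<longleftrightarrow> finite \<sigma> \<and> \<sigma> \<subseteq> XX \<and> (\<forall>u\<in>\<sigma>. \<forall>v\<in>\<sigma>. adj u v) \<and> (\<forall>g\<in>H. \<forall>u\<in>\<sigma>. act g u \<in> \<sigma>)"

lemma Hc: "g \<in> H \<Longrightarrow> g \<in> carrier G"
  using subgroup.mem_carrier[OF H] .

lemma H_inv: "g \<in> H \<Longrightarrow> inv g \<in> H"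
  using subgroup.m_inv_closed[OF H] .

lemma orb_self: "u \<in> XX \<Longrightarrow> u \<in> orb u"
  unfolding orb_def using subgroup.one_closed[OF H] act_one by force

lemma orb_act:
  assumes g: "g \<in> H" and u: "u \<in> XX"
  shows "orb (act g u) = orb u"
proof -
  have sub: "orb (act g u) \<subseteq> orb u" if "g \<in> H" "u \<in> XX" for g u
  proof
    fix v assume "v \<in> orb (act g u)"
    then obtain k where k: "k \<in> H" "v = act k (act g u)" by (auto simp: orb_def)
    then have "v = act (k \<otimes> g) u" using act_mult that Hc by simp
    then show "v \<in> orb u" unfolding orb_def using subgroup.m_closed[OF H k(1) that(1)] by blast
  qed
  have "orb (act (inv g) (act g u)) \<subseteq> orb (act g u)"
    using sub[of "inv g" "act g u"] H_inv g act_in Hc u by simp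
  then show ?thesis using sub[OF g u] act_inv(1)[OF Hc[OF g] u] by simp
qed

lemma orb_sub: "good \<sigma> \<Longrightarrow> u \<in> \<sigma> \<Longrightarrow> orb u \<subseteq> \<sigma>"
  by (auto simp: good_def orb_def)

lemma good_C: "good C"
  using C by (auto simp: good_def)

lemma orb_in: "u \<in> XX \<Longrightarrow> orb u \<subseteq> XX"
  using act_in Hc by (auto simp: orb_def)

lemma rho_ge: "c \<in> C \<Longrightarrow> W.d c u \<le> rho u + (ht c + ht u)"
proof -
  assume "c \<in> C"
  then have "W.d c u - (ht c + ht u) \<le> rho u" unfolding rho_def using C(1) by (intro Max_ge) auto
  then show ?thesis by linarith
qed

lemma rho_le: "(\<And>c. c \<in> C \<Longrightarrow> W.d c u \<le> m + (ht c + ht u)) \<Longrightarrow> rho u \<le> m"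
  unfolding rho_def using C(1,2) by (subst Max_le_iff) (auto simp: le_diff_conv)

lemma rho_attained:
  assumes "0 < rho u"
  shows "\<exists>c\<in>C. W.d c u = rho u + (ht c + ht u)"
proof -
  have "rho u \<in> (\<lambda>c. W.d c u - (ht c + ht u)) ` C"
    unfolding rho_def using C(1,2) by (intro Max_in) auto
  then obtain c where c: "c \<in> C" "rho u = W.d c u - (ht c + ht u)" by blast
  then have "W.d c u = rho u + (ht c + ht u)" using assms by linarith
  then show ?thesis using c(1) by blast
qed

lemma rho_act:
  assumes g: "g \<in> H" and u: "u \<in> XX"
  shows "rho (act g u) = rho u"
proof -
  have le: "rho (act g u) \<le> rho u" if "g \<in> H" "u \<in> XX" for g u
  proof (rule rho_le)
    fix c assume c: "c \<in> C"
    let ?c = "act (inv g) c"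
    have c': "?c \<in> C" "?c \<in> XX" "act g ?c = c"
      using C(3,5) c H_inv that act_inv(2) Hc by auto
    have "W.d c (act g u) = W.d ?c u" "ht c = ht ?c" "ht (act g u) = ht u"
      using W_act[OF Hc[OF that(1)] c'(2) that(2)] ht_act[OF Hc[OF that(1)]] c' that(2) by metis+
    then show "W.d c (act g u) \<le> rho u + (ht c + ht (act g u))" using rho_ge[OF c'(1), of u] by simp
  qed
  have "rho (act (inv g) (act g u)) \<le> rho (act g u)"
    by (rule le) (use H_inv g act_in Hc u in auto)
  then show ?thesis using le[OF g u] act_inv(1)[OF Hc[OF g] u] by simp
qed

lemma lev_act: "g \<in> H \<Longrightarrow> u \<in> XX \<Longrightarrow> lev (act g u) = lev u"
  by (simp add: lev_def rho_act)

lemma nxt_act: "g \<in> H \<Longrightarrow> u \<in> XX \<Longrightarrow> nxt (act g u) = nxt u"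
  by (simp add: nxt_def lev_act orb_act)

lemma finite_nxt: "finite (nxt u)"
  using C(1) by (simp add: nxt_def)

lemma lev_1: "lev u = 1 \<longleftrightarrow> rho u \<le> n"
  by (auto simp: lev_def)

text \<open>For the finiteness: \<open>u1\<close> and \<open>c1\<close> are distinct vertices in
  finite invariant sets, so both have finite orbits and \<open>H\<close> itself is finite.\<close>

lemma sel_spec:
  assumes \<sigma>: "good \<sigma>" "u \<in> \<sigma>" and big: "n < rho u"
  shows "\<exists>u1\<in>orb u. \<exists>c1\<in>C. W.d c1 u1 = rho u + (ht c1 + ht u1) \<and> target u1 c1 (sel (orb u))"
    and "finite (orb (sel (orb u)))"
proof -
  have u: "u \<in> XX" using \<sigma> by (auto simp: good_def)
  let ?P = "\<lambda>p. \<exists>u'\<in>orb u. \<exists>c\<in>C. W.d c u' = rho u' + (ht c + ht u') \<and> target u' c p"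
  obtain c where c: "c \<in> C" "W.d c u = rho u + (ht c + ht u)" using rho_attained[of u] big by auto
  obtain p where "target u c p" using target_ex[of u c] u c big C(3) by auto
  then have "?P p" using orb_self[OF u] c by blast
  then have "?P (sel (orb u))" unfolding sel_def by (rule someI[of ?P])
  then obtain u1 c1 where 1: "u1 \<in> orb u" "c1 \<in> C" "W.d c1 u1 = rho u1 + (ht c1 + ht u1)"
     "target u1 c1 (sel (orb u))" by blast
  have r1: "rho u1 = rho u" using 1(1) rho_act u by (auto simp: orb_def)
  then show "\<exists>u1\<in>orb u. \<exists>c1\<in>C. W.d c1 u1 = rho u + (ht c1 + ht u1) \<and> target u1 c1 (sel (orb u))"
    using 1 by metis
  have "u1 \<noteq> c1" using 1(3) r1 big by auto
  moreover have "u1 \<in> \<sigma>" using orb_sub[OF \<sigma>] 1(1) by blast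
  moreover have "finite (orb u1)" using orb_sub[OF \<sigma>(1) calculation(2)] \<sigma>(1) finite_subset
    by (auto simp: good_def)
  moreover have "finite (orb c1)" using orb_sub[OF good_C 1(2)] C(1) finite_subset by blast
  ultimately have "finite H"
    using finite_of_finite_orbits[OF H, of u1 c1] \<sigma>(1) C(3) 1(2) by (auto simp: good_def orb_def)
  then show "finite (orb (sel (orb u)))" by (simp add: orb_def)
qed

text \<open>A translate of a target is a target for the translated pair, so each point of the orbit
  serves some member of \<open>orb u\<close>.\<close>

lemma nxt_spec:
  assumes \<sigma>: "good \<sigma>" "u \<in> \<sigma>" and big: "n < rho u"
  shows "nxt u = orb (sel (orb u))"
    and "q \<in> nxt u \<Longrightarrow> \<exists>u2\<in>orb u. \<exists>c2\<in>C. W.d c2 u2 = rho u + (ht c2 + ht u2) \<and> target u2 c2 q"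
proof -
  have l: "lev u \<noteq> 1" using big unfolding lev_1 by simp
  then show eq: "nxt u = orb (sel (orb u))" using sel_spec(2)[OF \<sigma> big] by (simp add: nxt_def)
  obtain u1 c1 where 1: "u1 \<in> orb u" "c1 \<in> C" "W.d c1 u1 = rho u + (ht c1 + ht u1)"
     "target u1 c1 (sel (orb u))" using sel_spec(1)[OF \<sigma> big] by blast
  have X: "u \<in> XX" "u1 \<in> XX" "c1 \<in> XX" using \<sigma> orb_in 1(1,2) C(3) by (auto simp: good_def)
  assume "q \<in> nxt u"
  then obtain g where g: "g \<in> H" "q = act g (sel (orb u))" unfolding eq by (auto simp: orb_def)
  note hc = Hc[OF g(1)]
  have "act g u1 \<in> orb u" using 1(1) orb_act[of _ u] X(1) g(1) unfolding orb_def
    using act_mult subgroup.m_closed[OF H g(1)] Hc by (auto simp: image_iff) (metis act_mult)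
  moreover have "act g c1 \<in> C" using C(5) g 1 by blast
  moreover have "W.d (act g c1) (act g u1) = rho u + (ht (act g c1) + ht (act g u1))"
    using W_act[OF hc X(3,2)] ht_act[OF hc] X 1(3) by simp
  moreover have "target (act g u1) (act g c1) q"
    unfolding g(2) by (rule target_act[OF hc X(2,3) 1(4)])
  ultimately show "\<exists>u2\<in>orb u. \<exists>c2\<in>C. W.d c2 u2 = rho u + (ht c2 + ht u2) \<and> target u2 c2 q" by blast
qed

lemma nxt_in:
  assumes \<sigma>: "good \<sigma>" "u \<in> \<sigma>"
  shows "nxt u \<subseteq> XX" "nxt u \<noteq> {}" "g \<in> H \<Longrightarrow> v \<in> nxt u \<Longrightarrow> act g v \<in> nxt u"
proof -
  have "nxt u \<subseteq> XX \<and> nxt u \<noteq> {} \<and> (\<forall>g\<in>H. \<forall>v\<in>nxt u. act g v \<in> nxt u)"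
  proof (cases "n < rho u")
    case False
    then have "lev u = 1" unfolding lev_1 by simp
    then have "nxt u = C" by (simp add: nxt_def)
    then show ?thesis using C by simp
  next
    case True
    obtain u1 c1 where "target u1 c1 (sel (orb u))" using sel_spec(1)[OF \<sigma> True] by blast
    then have p: "sel (orb u) \<in> XX" by (simp add: target_def)
    have "act g v \<in> orb (sel (orb u))" if "g \<in> H" "v \<in> orb (sel (orb u))" for g v
      using that orb_in[OF p] orb_self[of "act g v"] act_in[of g v] Hc orb_act[of g v] orb_act[of _ "sel (orb u)"] p
      by (auto simp: orb_def[of "sel (orb u)"] subset_iff)
    then show ?thesis using nxt_spec(1)[OF \<sigma> True] orb_in[OF p] orb_self[OF p] by auto
  qed
  then show "nxt u \<subseteq> XX" "nxt u \<noteq> {}" "g \<in> H \<Longrightarrow> v \<in> nxt u \<Longrightarrow> act g v \<in> nxt u" by auto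
qed

text \<open>As \<open>c2\<close> attains \<open>rho u\<close>, the bound on \<open>rho a\<close>
  becomes the premise in \<open>target\<close>. Both alternatives there end in adjacency, since
  \<open>u2\<close> is adjacent to \<open>a\<close>.\<close>

lemma nxt_adj:
  assumes \<sigma>: "good \<sigma>" "u \<in> \<sigma>" and big: "n < rho u" and q: "q \<in> nxt u"
    and a: "a \<in> XX" "\<And>u'. u' \<in> orb u \<Longrightarrow> adj u' a" "rho a \<le> rho u"
  shows "adj q a"
proof (cases "a = q")
  case False
  obtain u2 c2 where 2: "u2 \<in> orb u" "c2 \<in> C" "W.d c2 u2 = rho u + (ht c2 + ht u2)" "target u2 c2 q"
    using nxt_spec(2)[OF \<sigma> big q] by blast
  have "W.d c2 a + ht u2 \<le> W.d c2 u2 + ht a" using rho_ge[OF 2(2), of a] a(3) 2(3) by linarith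
  then have "adj q a \<or> W.d q a + ht u2 < W.d u2 a + ht q"
    using 2(4) a(1) False unfolding target_def by blast
  moreover have "adj u2 a" using a(2) 2(1) .
  ultimately show ?thesis by (auto simp: adj_def)
qed simp

text \<open>Members of \<open>C\<close> are adjacent to \<open>c2\<close> and \<open>u2\<close> is
  not, so \<open>target\<close> applies to every \<open>c\<close> in \<open>C\<close> other than
  \<open>q\<close>. Either \<open>q\<close> is adjacent to \<open>c\<close>, and the reduced
  distance is at most \<open>n < rho u\<close>, or it is strictly below that of
  \<open>u2\<close>.\<close>

lemma nxt_down:
  assumes \<sigma>: "good \<sigma>" "u \<in> \<sigma>" and big: "n < rho u" and q: "q \<in> nxt u"
  shows "rho q < rho u"
proof -
  obtain u2 c2 where 2: "u2 \<in> orb u" "c2 \<in> C" "W.d c2 u2 = rho u + (ht c2 + ht u2)" "target u2 c2 q"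
    using nxt_spec(2)[OF \<sigma> big q] by blast
  have X: "u \<in> XX" "q \<in> XX" using \<sigma> nxt_in(1)[OF \<sigma>] q by (auto simp: good_def)
  have ru2: "rho u2 = rho u" using 2(1) rho_act X by (auto simp: orb_def)
  have "rho q \<le> rho u - 1"
  proof (rule rho_le)
    fix c assume c: "c \<in> C"
    then have cX: "c \<in> XX" using C by blast
    show "W.d c q \<le> rho u - 1 + (ht c + ht q)"
    proof (cases "c = q")
      case False
      have "adj c2 c" using C(4) c 2(2) by blast
      then have "W.d c2 c + ht u2 \<le> W.d c2 u2 + ht c" using 2(3) big by (simp add: adj_def)
      then have "adj q c \<or> W.d q c + ht u2 < W.d u2 c + ht q"
        using 2(4) cX False unfolding target_def by blast
      moreover have "W.d u2 c \<le> rho u + (ht c + ht u2)"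
      proof -
        have "u2 \<in> XX" using orb_in[OF X(1)] 2(1) by blast
        then show ?thesis using rho_ge[OF c, of u2] ru2 W.d_sym[of u2 c] cX by simp
      qed
      moreover have "W.d c q = W.d q c" using W.d_sym X cX by blast
      ultimately show ?thesis using big by (auto simp: adj_def)
    qed simp
  qed
  then show ?thesis using big by linarith
qed

text \<open>All orbits of the top level move at once, so pushed vertices must also be adjacent to
  each other. Above level 1 this takes \<open>nxt_adj\<close> twice: first \<open>q'\<close> is
  adjacent to the orbit of \<open>u\<close>, and then, because \<open>rho q' < rho u\<close>, it can
  itself play the part of \<open>a\<close> for \<open>q\<close>.\<close>

lemma good_step:
  assumes \<sigma>: "good \<sigma>" and top: "\<And>u. u \<in> \<sigma> \<Longrightarrow> lev u \<le> j"
  shows "good (\<sigma> \<union> (\<Union>u\<in>{u \<in> \<sigma>. lev u = j}. nxt u))"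
proof -
  let ?N = "\<Union>u\<in>{u \<in> \<sigma>. lev u = j}. nxt u"
  have \<sigma>': "finite \<sigma>" "\<sigma> \<subseteq> XX" "\<And>u v. u \<in> \<sigma> \<Longrightarrow> v \<in> \<sigma> \<Longrightarrow> adj u v" "\<And>g u. g \<in> H \<Longrightarrow> u \<in> \<sigma> \<Longrightarrow> act g u \<in> \<sigma>"
    using \<sigma> by (auto simp: good_def)
  have NX: "?N \<subseteq> XX" using nxt_in(1)[OF \<sigma>] by blast
  have orb_adj: "adj u' a" if "u \<in> \<sigma>" "a \<in> \<sigma>" "u' \<in> orb u" for u a u'
    using \<sigma>'(3) orb_sub[OF \<sigma> that(1)] that by blast
  have NXI: "q \<in> XX" if "u \<in> \<sigma>" "q \<in> nxt u" for u q using nxt_in(1)[OF \<sigma> that(1)] that(2) by blast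
  have main: "adj q a \<and> adj q q'"
    if u: "u \<in> \<sigma>" "lev u = j" "q \<in> nxt u" and a: "a \<in> \<sigma>" and u': "u' \<in> \<sigma>" "lev u' = j" "q' \<in> nxt u'"
    for u q a u' q'
  proof (cases "n < rho u")
    case True
    have j: "j = rho u - n + 1" "j = rho u' - n + 1" using u u' by (auto simp: lev_def)
    then have r': "rho u' = rho u" "n < rho u'" using True by auto
    have ra: "rho b \<le> rho u" if "b \<in> \<sigma>" for b using top[OF that] j True by (simp add: lev_def)
    have "a \<in> XX" using a \<sigma>'(2) by blast
    then have 1: "adj q a"
      using nxt_adj[OF \<sigma> u(1) True u(3) _ orb_adj[OF u(1) a] ra[OF a]] by blast
    have q'X: "q' \<in> XX" by (rule NXI[OF u'(1,3)])
    have 2: "adj b q'" if b: "b \<in> orb u" for b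
    proof -
      have b': "b \<in> \<sigma>" using orb_sub[OF \<sigma> u(1)] b by blast
      then have bX: "b \<in> XX" using \<sigma>'(2) by blast
      have "rho b \<le> rho u'" using ra[OF b'] r'(1) by simp
      then have "adj q' b"
        using nxt_adj[OF \<sigma> u'(1) r'(2) u'(3) bX] orb_adj[OF u'(1) b'] by blast
      then show ?thesis using adj_sym[OF bX q'X] by blast
    qed
    have "rho q' < rho u" using nxt_down[OF \<sigma> u'(1) r'(2) u'(3)] r' by simp
    then have "adj q q'"
      using nxt_adj[OF \<sigma> u(1) True u(3) q'X 2] by linarith
    then show ?thesis using 1 by blast
  next
    case False
    then have j: "j = 1" using u by (simp add: lev_def)
    then have qC: "q \<in> C" "q' \<in> C" using u u' by (auto simp: nxt_def)
    have "rho a \<le> n" using top[OF a] j by (simp add: lev_def)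
    then have "adj q a" using rho_ge[OF qC(1), of a] by (simp add: adj_def)
    then show ?thesis using qC C(4) by blast
  qed
  have clique: "adj u v" if uv: "u \<in> \<sigma> \<union> ?N" "v \<in> \<sigma> \<union> ?N" for u v
  proof -
    have mixed: "adj u' v'" if "u' \<in> ?N" "v' \<in> \<sigma>" for u' v' using main that by blast
    consider "u \<in> \<sigma>" "v \<in> \<sigma>" | "u \<in> ?N" "v \<in> \<sigma>" | "u \<in> \<sigma>" "v \<in> ?N" | "u \<in> ?N" "v \<in> ?N"
      using uv by blast
    then show ?thesis
    proof cases
      case 1 then show ?thesis by (rule \<sigma>'(3))
    next
      case 2 then show ?thesis by (rule mixed)
    next
      case 3
      then have "adj v u" by (intro mixed)
      then show ?thesis using adj_sym[of u v] 3 \<sigma>'(2) NX by blast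
    next
      case 4 then show ?thesis using main by blast
    qed
  qed
  have inv: "act g v \<in> \<sigma> \<union> ?N" if g: "g \<in> H" and v: "v \<in> \<sigma> \<union> ?N" for g v
    using v
  proof
    assume "v \<in> \<sigma>" then show ?thesis using \<sigma>'(4)[OF g] by blast
  next
    assume "v \<in> ?N" then show ?thesis using nxt_in(3)[OF \<sigma> _ g] by blast
  qed
  show ?thesis unfolding good_def
    by (intro conjI ballI clique inv) (use \<sigma>'(1,2) finite_nxt NX in auto)
qed

end

section \<open>Fixed points as invariant functions, and closedness of the fixed-point set\<close>

context rips_setting
begin

lemma rips_fixedD:
  assumes H: "subgroup H G" and x: "x \<in> rips_fixed G S Ps n H"
  shows "finite {u. x u \<noteq> 0}" "{u. x u \<noteq> 0} \<noteq> {}" "{u. x u \<noteq> 0} \<subseteq> XX"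
    and "x u \<noteq> 0 \<Longrightarrow> x v \<noteq> 0 \<Longrightarrow> adj u v"
    and "0 \<le> x u" "sum x {u. x u \<noteq> 0} = 1"
    and "g \<in> H \<Longrightarrow> u \<in> XX \<Longrightarrow> x (act g u) = x u"
proof -
  from x obtain \<sigma> where \<sigma>: "\<sigma> \<in> rips_simplices G S Ps n" "x \<in> csimplex \<sigma>"
    and inv: "\<And>g. g \<in> H \<Longrightarrow> pact G Ps g x = x"
    unfolding rips_fixed_def real_points_def by blast
  have \<sigma>': "finite \<sigma>" "\<sigma> \<subseteq> XX" "\<forall>u\<in>\<sigma>. \<forall>v\<in>\<sigma>. adj u v" using \<sigma>(1) by (auto simp: rips_simplices_iff)
  note f = csimplex_face[OF \<sigma>(2) \<sigma>'(1)]
  show "finite {u. x u \<noteq> 0}" using f(1) \<sigma>'(1) by (rule finite_subset)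
  show "{u. x u \<noteq> 0} \<noteq> {}" by (rule f(2))
  show "{u. x u \<noteq> 0} \<subseteq> XX" using f(1) \<sigma>'(2) by (rule subset_trans)
  show "x u \<noteq> 0 \<Longrightarrow> x v \<noteq> 0 \<Longrightarrow> adj u v" using f(1) \<sigma>'(3) by blast
  show "0 \<le> x u" "sum x {u. x u \<noteq> 0} = 1" using f(3) by (auto simp: csimplex_def)
  assume g: "g \<in> H" and u: "u \<in> XX"
  have gc: "g \<in> carrier G" using subgroup.mem_carrier[OF H g] .
  have "x (act g u) = pact G Ps g x (act g u)" using inv[OF g] by simp
  also have "\<dots> = x u" using act_in[OF gc u] act_inv(1)[OF gc u] by (simp add: pact_def)
  finally show "x (act g u) = x u" .
qed

lemma rips_fixedI:
  assumes H: "subgroup H G"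
    and fin: "finite {u. x u \<noteq> 0}" and ne: "{u. x u \<noteq> 0} \<noteq> {}" and sub: "{u. x u \<noteq> 0} \<subseteq> XX"
    and "\<And>u v. x u \<noteq> 0 \<Longrightarrow> x v \<noteq> 0 \<Longrightarrow> adj u v" "\<And>u. 0 \<le> x u" "sum x {u. x u \<noteq> 0} = 1"
    and inv: "\<And>g u. g \<in> H \<Longrightarrow> u \<in> XX \<Longrightarrow> x (act g u) = x u"
  shows "x \<in> rips_fixed G S Ps n H"
proof -
  have "{u. x u \<noteq> 0} \<in> rips_simplices G S Ps n" using assms by (simp add: rips_simplices_iff)
  moreover have "x \<in> csimplex {u. x u \<noteq> 0}" using assms by (auto simp: csimplex_def)
  moreover have "pact G Ps g x = x" if "g \<in> H" for g
  proof
    fix u show "pact G Ps g x u = x u"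
      using inv[of "inv g" u] subgroup.m_inv_closed[OF H that] sub by (auto simp: pact_def)
  qed
  ultimately show ?thesis unfolding rips_fixed_def real_points_def by blast
qed

lemma closedin_rips_fixed:
  assumes "\<sigma> \<in> rips_simplices G S Ps n"
  shows "closedin (powertop_real UNIV) (rips_fixed G S Ps n H \<inter> csimplex \<sigma>)"
proof -
  have coord: "continuous_map (powertop_real UNIV) euclideanreal (\<lambda>x. x u)" for u :: "'a + 'a set"
    by (rule continuous_map_product_projection) simp
  have "closedin (powertop_real UNIV) {x. pact G Ps g x u = x u}" for g u
  proof -
    have "continuous_map (powertop_real UNIV) euclideanreal (\<lambda>x. pact G Ps g x u - x u)"
      unfolding pact_def by (cases "u \<in> XX") (auto intro!: continuous_map_diff coord)
    from closedin_continuous_map_preimage[OF this, of "{0}"] show ?thesis by simp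
  qed
  moreover have "closedin (powertop_real UNIV) (csimplex \<sigma>)"
    using assms by (intro closedin_csimplex) (simp add: rips_simplices_iff)
  ultimately have "closedin (powertop_real UNIV)
      (\<Inter>({csimplex \<sigma>} \<union> (\<lambda>(g, u). {x. pact G Ps g x u = x u}) ` (H \<times> UNIV)))"
    by (intro closedin_Inter) auto
  moreover have "rips_fixed G S Ps n H \<inter> csimplex \<sigma> =
      \<Inter>({csimplex \<sigma>} \<union> (\<lambda>(g, u). {x. pact G Ps g x u = x u}) ` (H \<times> UNIV))"
    using assms by (auto simp: rips_fixed_def real_points_def fun_eq_iff)
  ultimately show ?thesis by simp
qed

end

context rips_fixed_setting
begin

text \<open>The kernel \<pi> spreads the mass of each vertex of the support as a probability over
  the clique \<open>?T\<close> from \<open>good_step\<close>, so positivity and total mass persist.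
  It is equivariant because \<open>lev\<close> and \<open>nxt\<close> are constant on orbits and
  each \<open>nxt u\<close> is invariant; reindexing the sum by \<open>act g\<close> then gives
  invariance.\<close>

lemma push_level_fixed:
  assumes x: "x \<in> rips_fixed G S Ps n H" and top: "\<And>u. x u \<noteq> 0 \<Longrightarrow> lev u \<le> j"
    and c: "0 \<le> c" "c \<le> 1"
  shows "push_level lev nxt j c x \<in> rips_fixed G S Ps n H"
proof -
  note xD = rips_fixedD[OF H x]
  let ?s = "{u. x u \<noteq> 0}"
  let ?T = "?s \<union> (\<Union>u\<in>{u \<in> ?s. lev u = j}. nxt u)"
  define \<pi> where "\<pi> u v = (if lev u = j then (if v \<in> nxt u then 1 / card (nxt u) else 0)
    else if v = u then 1 else 0 :: real)" for u v
  define y where "y = push_level lev nxt j c x"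
  have y: "y v = (1 - c) * x v + c * (\<Sum>u\<in>?s. x u * \<pi> u v)" for v
    by (simp add: y_def push_level_def \<pi>_def)
  have good_s: "good ?s" unfolding good_def using xD by auto
  have T: "good ?T" by (rule good_step[OF good_s]) (use top in simp)
  then have T': "finite ?T" "?T \<subseteq> XX" "\<And>u v. u \<in> ?T \<Longrightarrow> v \<in> ?T \<Longrightarrow> adj u v"
    by (auto simp: good_def)
  have sy: "{u. y u \<noteq> 0} \<subseteq> ?T"
  proof
    fix v assume "v \<in> {u. y u \<noteq> 0}"
    then show "v \<in> ?T" using push_level_support[of lev nxt j c x v] by (auto simp: y_def)
  qed
  have pi0: "0 \<le> \<pi> u v" for u v by (simp add: \<pi>_def)
  have pi1: "(\<Sum>v\<in>?T. \<pi> u v) = 1" if u: "u \<in> ?s" for u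
  proof (cases "lev u = j")
    case True
    then have "nxt u \<subseteq> ?T" using u by blast
    then have "(\<Sum>v\<in>?T. \<pi> u v) = (\<Sum>v\<in>nxt u. 1 / card (nxt u))"
      using True T'(1) by (simp add: \<pi>_def sum.If_cases Int_absorb1)
    also have "\<dots> = 1" using nxt_in(2)[OF good_s u] finite_nxt by simp
    finally show ?thesis .
  next
    case False
    then show ?thesis using u T'(1) by (simp add: \<pi>_def)
  qed
  have y0: "0 \<le> y v" for v
    unfolding y using c xD(5) pi0 by (intro add_nonneg_nonneg mult_nonneg_nonneg sum_nonneg) auto
  have "(\<Sum>v\<in>?T. \<Sum>u\<in>?s. x u * \<pi> u v) = (\<Sum>u\<in>?s. x u * (\<Sum>v\<in>?T. \<pi> u v))"
    by (subst sum.swap) (simp add: sum_distrib_left)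
  also have "\<dots> = 1" using pi1 xD(6) by simp
  finally have "(\<Sum>v\<in>?T. \<Sum>u\<in>?s. x u * \<pi> u v) = 1" .
  moreover have "sum x ?T = 1"
    using xD(6) T'(1) by (subst sum.mono_neutral_right[of ?T ?s]) auto
  ultimately have "sum y ?T = 1"
    unfolding y by (simp add: sum.distrib flip: sum_distrib_left)
  then have sum1: "sum y {u. y u \<noteq> 0} = 1"
    using sy T'(1) by (subst sum.mono_neutral_left[of ?T]) auto
  have yinv: "y (act g v) = y v" if g: "g \<in> H" and v: "v \<in> XX" for g v
  proof -
    note gc = Hc[OF g]
    have "bij_betw (act g) ?s ?s"
    proof (rule bij_betwI[where g = "act (inv g)"])
      show "act g \<in> ?s \<rightarrow> ?s" using xD(3,7) g by auto
      show "act (inv g) \<in> ?s \<rightarrow> ?s" using xD(3,7) H_inv[OF g] by auto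
      show "act (inv g) (act g u) = u" "act g (act (inv g) u) = u" if "u \<in> ?s" for u
        using act_inv[OF gc] that xD(3) by blast+
    qed
    then have "(\<Sum>u\<in>?s. x u * \<pi> u (act g v)) = (\<Sum>u\<in>?s. x (act g u) * \<pi> (act g u) (act g v))"
      by (rule sum.reindex_bij_betw[symmetric])
    also have "\<dots> = (\<Sum>u\<in>?s. x u * \<pi> u v)"
    proof (rule sum.cong[OF refl])
      fix u assume u: "u \<in> ?s"
      then have uX: "u \<in> XX" using xD(3) by blast
      have "act g v \<in> nxt u \<longleftrightarrow> v \<in> nxt u"
        using nxt_in(3)[OF good_s u g, of v] nxt_in(3)[OF good_s u H_inv[OF g], of "act g v"]
          act_inv(1)[OF gc v] by auto
      then have "\<pi> (act g u) (act g v) = \<pi> u v"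
        using lev_act[OF g uX] nxt_act[OF g uX] act_inj[OF gc v uX] by (simp add: \<pi>_def)
      then show "x (act g u) * \<pi> (act g u) (act g v) = x u * \<pi> u v" using xD(7)[OF g uX] by simp
    qed
    finally show ?thesis unfolding y using xD(7)[OF g v] by simp
  qed
  have "y \<in> rips_fixed G S Ps n H"
  proof (rule rips_fixedI[OF H _ _ _ _ y0 sum1 yinv])
    show "finite {u. y u \<noteq> 0}" using sy T'(1) by (rule finite_subset)
    show "{u. y u \<noteq> 0} \<noteq> {}" using sum1 by (metis sum.empty zero_neq_one)
    show "{u. y u \<noteq> 0} \<subseteq> XX" using sy T'(2) by (rule subset_trans)
    show "adj u v" if "y u \<noteq> 0" "y v \<noteq> 0" for u v using that sy T'(3) by blast
  qed
  then show ?thesis by (simp add: y_def)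
qed

lemma contractible_fixed:
  "contractible_space (subtopology (realization (rips_simplices G S Ps n)) (rips_fixed G S Ps n H))"
proof (rule contractible_by_levels[where lev = lev and r = nxt and C = C])
  show "finite \<sigma>" if "\<sigma> \<in> rips_simplices G S Ps n" for \<sigma> using that by (simp add: rips_simplices_iff)
  show "\<tau> \<in> rips_simplices G S Ps n" if "\<sigma> \<in> rips_simplices G S Ps n" "\<tau> \<subseteq> \<sigma>" "\<tau> \<noteq> {}" for \<sigma> \<tau>
    using that finite_subset unfolding rips_simplices_iff by blast
  show "rips_fixed G S Ps n H \<subseteq> real_points (rips_simplices G S Ps n)" by (auto simp: rips_fixed_def)
  show "closedin (powertop_real UNIV) (rips_fixed G S Ps n H \<inter> csimplex \<sigma>)"
    if "\<sigma> \<in> rips_simplices G S Ps n" for \<sigma> using closedin_rips_fixed[OF that] .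
  show "finite (nxt u)" for u by (rule finite_nxt)
  show "1 \<le> lev u" for u by (simp add: lev_def)
  show "push_level lev nxt j c x \<in> rips_fixed G S Ps n H"
    if "x \<in> rips_fixed G S Ps n H" "\<And>u. x u \<noteq> 0 \<Longrightarrow> lev u \<le> j" "0 \<le> c" "c \<le> 1" for x j c
    using push_level_fixed[OF that] .
  show "lev v < lev u"
    if x: "x \<in> rips_fixed G S Ps n H" and u: "x u \<noteq> 0" "2 \<le> lev u" and v: "v \<in> nxt u" for x u v
  proof -
    have "good {u. x u \<noteq> 0}" unfolding good_def using rips_fixedD[OF H x] by auto
    moreover have "n < rho u" using u(2) by (simp add: lev_def)
    ultimately have "rho v < rho u" using nxt_down[of "{u. x u \<noteq> 0}" u v] u(1) v by simp
    then show ?thesis using \<open>n < rho u\<close> by (simp add: lev_def)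
  qed
  show "nxt u = C" if "lev u = 1" for u using that by (simp add: nxt_def)
qed

end

theorem theorem2p6:
  fixes G :: "('a, 'b) monoid_scheme" and S :: "'a set" and Ps :: "'a set set"
  assumes "group G"
    and "finite S" and "S \<subseteq> carrier G" and "generate G S = carrier G"
    and "finite Ps" and "\<forall>P\<in>Ps. subgroup P G"
    and "fine_graph (cverts G Ps) (coned_edge G S Ps)"
    and "\<exists>\<delta>. hyperbolic_graph (cverts G Ps) (coned_edge G S Ps) \<delta>"
  shows "\<exists>N. \<forall>n\<ge>N. \<forall>H. subgroup H G \<longrightarrow>
           rips_fixed G S Ps n H = {} \<or>
           contractible_space (subtopology (realization (rips_simplices G S Ps n)) (rips_fixed G S Ps n H))"
proof -
  interpret cayley_pair G S Ps
    using assms(1-6) by (simp add: cayley_pair_def cayley_pair_axioms_def)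
  obtain \<delta> where "hyperbolic_graph XX EE \<delta>" using assms(8) by blast
  then interpret relhyp_graph XX EE VV "nat \<lceil>2 * \<delta>\<rceil>"
    using relhyp_graph_of_hyperbolic[OF assms(7)] by blast
  \<comment> \<open>The order of choices matters: \<open>K\<close> is independent of
    \<open>n\<close> and determines \<open>N\<close>, whereas \<open>M\<close> is chosen afterwards
    for each \<open>n\<close>.\<close>
  obtain K where K: "thin_const K" using triangle unfolding thin_const_def by blast
  obtain N where N: "\<And>n. n \<ge> N \<Longrightarrow> 1 \<le> n \<and>
     (\<exists>M. (2 * (K + M) + 1) * (2 * (K + M) + 3) + 6 * (2 * (K + M)) \<le> n \<and>
     (\<forall>D>M. \<exists>k. 2 * D + n * (6 * D + 6) \<le> 2 ^ k \<and> K * k < D))"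
    using scale_exists[of K] by blast
  have "contractible_space (subtopology (realization (rips_simplices G S Ps n)) (rips_fixed G S Ps n H))"
    if n: "n \<ge> N" and H: "subgroup H G" and ne: "rips_fixed G S Ps n H \<noteq> {}" for n H
  proof -
    obtain M where M: "(2 * (K + M) + 1) * (2 * (K + M) + 3) + 6 * (2 * (K + M)) \<le> n"
      "\<And>D. M < D \<Longrightarrow> \<exists>k. 2 * D + n * (6 * D + 6) \<le> 2 ^ k \<and> K * k < D" using N[OF n] by blast
    interpret R: rips_setting G S Ps "nat \<lceil>2 * \<delta>\<rceil>" n K M
    proof unfold_locales
      show "thin_const K" by (rule K)
      show "1 \<le> n" using N[OF n] by blast
      show "\<exists>k. 2 * D + n * (6 * D + 6) \<le> 2 ^ k \<and> K * k < D" if "M < D" for D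
        by (rule M(2)[OF that])
    qed (rule M(1))
    obtain x where x: "x \<in> rips_fixed G S Ps n H" using ne by blast
    note xD = R.rips_fixedD[OF H x]
    interpret F: rips_fixed_setting G S Ps "nat \<lceil>2 * \<delta>\<rceil>" n K M H "{u. x u \<noteq> 0}"
    proof unfold_locales
      show "R.adj u v" if "u \<in> {u. x u \<noteq> 0}" "v \<in> {u. x u \<noteq> 0}" for u v
        using xD(4)[of u v] that by blast
      show "act g u \<in> {u. x u \<noteq> 0}" if "g \<in> H" "u \<in> {u. x u \<noteq> 0}" for g u
        using xD(7)[OF that(1), of u] xD(3) that(2) by auto
    qed (fact xD(1-3) subgroup.subset[OF H] subgroup.m_closed[OF H] subgroup.one_closed[OF H]
        subgroup.m_inv_closed[OF H])+
    show ?thesis by (rule F.contractible_fixed)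
  qed
  then show ?thesis by blast
qed

end
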